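(* Let $X$ be a Banach space with the compact approximation property. If $\mathcal{L}(X) = \mathrm{NRA}(X)$ (that is, every bounded linear operator on $X$ attains its numerical radius), then $X$ is finite dimensional.
   Context: Banach spaces are over $\mathbb{K}=\mathbb{R}$ or $\mathbb{C}$. $S_X$ is the unit sphere of $X$, $X^*$ is the topological dual, and $\mathcal{L}(X)$ is the space of all bounded linear operators from $X$ into $X$. Set $\Pi(X) = \{(x,x^* ) \in S_X \times S_{X^*} : x^*(x)=1\}$. The numerical radius of $T \in \mathcal{L}(X)$ is $\nu(T) = \sup\{|x^*(T(x))| : (x,x^* ) \in \Pi(X)\}$. The operator $T$ attains its numerical radius if there is $(x,x^* ) \in \Pi(X)$ with $\nu(T) = |x^*(T(x))|$; $\mathrm{NRA}(X)$ is the set of all numerical radius attaining operators $T\in\mathcal{L}(X)$. $X$ has the compact approximation property if for every compact set $K \subseteq X$ and every $\varepsilon>0$ there is a compact linear operator $T : X \to X$ with $\|T(x)-x\| \leq \varepsilon$ for all $x \in K$. *)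

theory Defs
  imports "HOL-Analysis.Analysis"
begin

text \<open>
  HOL-Analysis only has real normed spaces. To treat the scalar fields \<open>\<real>\<close> and \<open>\<complex>\<close>
  uniformly, a Banach space over \<open>'k\<close> is a real Banach space (type class \<^class>\<open>banach\<close>) with a
  scalar multiplication by \<open>'k\<close> that extends the real one and for which the given norm is
  homogeneous. The definitions below take this scalar multiplication as a parameter; it is used with
  \<open>'k = real\<close> and \<open>'k = complex\<close>.
\<close>

locale banach_space_over = vector_space smul
  for smul :: "'k::real_normed_field \<Rightarrow> 'a::banach \<Rightarrow> 'a" +
  assumes smul_of_real: "smul (of_real r) x = r *\<^sub>R x"
    and norm_smul: "norm (smul c x) = norm c * norm x"

lemma banach_space_over_scaleR:
  "banach_space_over (scaleR :: real \<Rightarrow> 'a::banach \<Rightarrow> 'a)"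
  by unfold_locales (simp_all add: scaleR_add_right scaleR_add_left)

lemma banach_space_over_complex:
  "banach_space_over ((*) :: complex \<Rightarrow> complex \<Rightarrow> complex)"
  by unfold_locales (auto simp: algebra_simps norm_mult scaleR_conv_of_real)

text \<open>
  \<^const>\<open>bounded_linear\<close> contributes the boundedness; the real linearity it contains is a
  consequence of linearity over \<open>'k\<close>.
\<close>

definition bounded_maps ::
  "('k::real_normed_field \<Rightarrow> 'a::real_normed_vector \<Rightarrow> 'a) \<Rightarrow>
   ('k \<Rightarrow> 'b::real_normed_vector \<Rightarrow> 'b) \<Rightarrow> ('a \<Rightarrow> 'b) set"
  where "bounded_maps s1 s2 = {f. Vector_Spaces.linear s1 s2 f \<and> bounded_linear f}"

definition bounded_operators ::
  "('k::real_normed_field \<Rightarrow> 'a::real_normed_vector \<Rightarrow> 'a) \<Rightarrow> ('a \<Rightarrow> 'a) set"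
  where "bounded_operators smul = bounded_maps smul smul"

definition dual_space ::
  "('k::real_normed_field \<Rightarrow> 'a::real_normed_vector \<Rightarrow> 'a) \<Rightarrow> ('a \<Rightarrow> 'k) set"
  where "dual_space smul = bounded_maps smul (*)"

definition state_pairs ::
  "('k::real_normed_field \<Rightarrow> 'a::real_normed_vector \<Rightarrow> 'a) \<Rightarrow> ('a \<times> ('a \<Rightarrow> 'k)) set"
  where "state_pairs smul =
    {(x, f). x \<in> sphere 0 1 \<and> f \<in> dual_space smul \<and> onorm f = 1 \<and> f x = 1}"

definition numerical_radius ::
  "('k::real_normed_field \<Rightarrow> 'a::real_normed_vector \<Rightarrow> 'a) \<Rightarrow> ('a \<Rightarrow> 'a) \<Rightarrow> real"
  where "numerical_radius smul T = (SUP (x, f)\<in>state_pairs smul. norm (f (T x)))"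

definition NRA ::
  "('k::real_normed_field \<Rightarrow> 'a::real_normed_vector \<Rightarrow> 'a) \<Rightarrow> ('a \<Rightarrow> 'a) set"
  where "NRA smul = {T \<in> bounded_operators smul.
    \<exists>(x, f)\<in>state_pairs smul. numerical_radius smul T = norm (f (T x))}"

definition compact_operators ::
  "('k::real_normed_field \<Rightarrow> 'a::real_normed_vector \<Rightarrow> 'a) \<Rightarrow> ('a \<Rightarrow> 'a) set"
  where "compact_operators smul =
    {T \<in> bounded_operators smul. compact (closure (T ` cball 0 1))}"

definition compact_approximation_property ::
  "('k::real_normed_field \<Rightarrow> 'a::real_normed_vector \<Rightarrow> 'a) \<Rightarrow> bool"
  where "compact_approximation_property smul \<longleftrightarrow>
    (\<forall>K. compact K \<longrightarrow>
      (\<forall>\<epsilon>>0. \<exists>T\<in>compact_operators smul. \<forall>x\<in>K. norm (T x - x) \<le> \<epsilon>))"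

definition finite_dimensional ::
  "('k::real_normed_field \<Rightarrow> 'a::real_normed_vector \<Rightarrow> 'a) \<Rightarrow> bool"
  where "finite_dimensional smul \<longleftrightarrow> (\<exists>B. finite_dimensional_vector_space smul B)"

end

theory Submission
  imports Defs "HOL-Library.Diagonal_Subsequence"
begin

text \<open>The proof is an argument by James's method on the space of operators. For a set \<open>\<Gamma>\<close> of functionals on
  a Banach space, James's theorem says, in the form of \<open>james_approximation\<close>: if every vector attains
  its supremum over \<open>\<Gamma>\<close>, and bounded sequences have cluster points with respect to \<open>\<Gamma>\<close>, then every
  linear functional dominated by \<open>sup \<Gamma>\<close> is a norm limit of linear combinations of elements of \<open>\<Gamma>\<close>.
  The numerical radius is the supremum over the functionals \<open>T \<mapsto> Re (l * f (T x))\<close>, where \<open>(x, f)\<close> is a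
  state pair and \<open>l\<close> a scalar of modulus 1, so the principle applies as soon as all operators attain
  their numerical radius. It is used twice.

  First, to the rank one operators with range spanned by a fixed unit vector \<open>y0\<close>. Their numerical
  radius is at least a twentieth of their norm, so a multiple of any element of the bidual is
  dominated, and it becomes a limit of evaluations: \<open>X\<close> is reflexive (\<open>reflexive_if_NRA\<close>).

  Second, to all operators. Suppose that \<open>X\<close> is infinite dimensional. If a compact \<open>K\<close> had distance
  less than 1 from the identity in numerical radius, then \<open>K\<close> would be bounded below on the unit sphere,
  which makes the unit ball compact. Hence there is a functional \<open>\<Phi>\<close> dominated by the numerical radius,
  with \<open>\<Phi> I \<ge> 1\<close> and \<open>\<Phi> K = 0\<close> for all compact \<open>K\<close> (\<open>functional_vanishing_on_compacts\<close>). Cluster points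
  of bounded sequences of operators exist by reflexivity, so \<open>\<Phi>\<close> is a limit of finite sums of tensors
  \<open>T \<mapsto> g (T x)\<close>. By reflexivity again the norm of such sums is their projective tensor norm, and \<open>\<Phi>\<close> is
  an absolutely convergent series of tensors (\<open>nuclear_expansion\<close>). A series of this kind is nearly
  unchanged when the identity is replaced by a compact operator close to it on a suitable compact
  set, and the compact approximation property yields \<open>\<Phi> I < 1\<close>, a contradiction.

  Reflexivity is what makes unbounded compact approximations harmless: the bounded sequence of
  operators required by James's method is produced by duality and not by the approximation property.

  The argument only uses real functionals; linearity over the scalars is recorded as commutation
  with scalar multiplication.\<close>

section \<open>Sublinear functionals and the Mazur--Orlicz theorem\<close>

definition sublinear :: "('v::real_vector \<Rightarrow> real) \<Rightarrow> bool" where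
  "sublinear p \<longleftrightarrow> (\<forall>x y. p (x + y) \<le> p x + p y) \<and> (\<forall>c x. 0 \<le> c \<longrightarrow> p (c *\<^sub>R x) = c * p x)"

lemma sublinear_add: "sublinear p \<Longrightarrow> p (x + y) \<le> p x + p y"
  and sublinear_scale: "sublinear p \<Longrightarrow> 0 \<le> c \<Longrightarrow> p (c *\<^sub>R x) = c * p x"
  by (auto simp: sublinear_def)

lemma sublinear_zero: "sublinear p \<Longrightarrow> p 0 = 0"
  using sublinear_scale[of p 0 0] by simp

lemma sublinear_minus: "sublinear p \<Longrightarrow> - p (- x) \<le> p x"
  using sublinear_add[of p x "- x"] sublinear_zero[of p] by simp

lemma sublinear_norm: "sublinear norm"
  by (auto simp: sublinear_def norm_triangle_ineq)

lemma sublinearI: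
  assumes add: "\<And>x y. p (x + y) \<le> p x + p y"
    and scale: "\<And>c x. 0 < c \<Longrightarrow> p (c *\<^sub>R x) \<le> c * p x"
    and zero: "p 0 = 0"
  shows "sublinear p"
  unfolding sublinear_def
proof (intro conjI allI impI add)
  fix c :: real and x assume "0 \<le> c"
  show "p (c *\<^sub>R x) = c * p x"
  proof (cases "c = 0")
    case False
    with \<open>0 \<le> c\<close> have c: "0 < c" by simp
    have "p x \<le> (1 / c) * p (c *\<^sub>R x)"
      using scale[of "1 / c" "c *\<^sub>R x"] c by simp
    then have "c * p x \<le> p (c *\<^sub>R x)"
      using c by (simp add: field_simps)
    with scale[OF c, of x] show ?thesis by simp
  qed (simp add: zero)
qed

text \<open>A cone of pairs \<open>(s, c)\<close> encodes the constraints \<open>\<beta> s \<le> c\<close> imposed on a linear functional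
  \<open>\<beta>\<close>. Pairs make room for several constraints on one vector, so that no well-definedness has to be
  checked when a cone is generated by parametrised vectors.\<close>

definition constraint_cone :: "('v::real_vector \<times> real) set \<Rightarrow> bool" where
  "constraint_cone R \<longleftrightarrow> (0, 0) \<in> R \<and>
    (\<forall>s c s' c'. (s, c) \<in> R \<longrightarrow> (s', c') \<in> R \<longrightarrow> (s + s', c + c') \<in> R) \<and>
    (\<forall>t s c. 0 < t \<longrightarrow> (s, c) \<in> R \<longrightarrow> (t *\<^sub>R s, t * c) \<in> R)"

text \<open>The infimal convolution of \<open>p\<close> with the constraints. The domination hypothesis is what keeps the
  infimum finite.\<close>

lemma sublinear_constrained:
  assumes p: "sublinear p" and R: "constraint_cone R"
    and dom: "\<And>s c. (s, c) \<in> R \<Longrightarrow> - p (- s) \<le> c"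
  obtains q where "sublinear q" "\<And>x. q x \<le> p x" "\<And>s c. (s, c) \<in> R \<Longrightarrow> q s \<le> c"
proof
  define q where "q = (\<lambda>x. INF (s, c)\<in>R. p (x - s) + c)"
  have R0: "(0, 0) \<in> R" and Radd: "\<And>s c s' c'. (s, c) \<in> R \<Longrightarrow> (s', c') \<in> R \<Longrightarrow> (s + s', c + c') \<in> R"
    and Rscale: "\<And>t s c. 0 < t \<Longrightarrow> (s, c) \<in> R \<Longrightarrow> (t *\<^sub>R s, t * c) \<in> R"
    using R by (auto simp: constraint_cone_def)
  have lower: "- p (- x) \<le> p (x - s) + c" if "(s, c) \<in> R" for x s c
  proof -
    have "p (- s) \<le> p (x - s) + p (- x)"
      using sublinear_add[OF p, of "x - s" "- x"] by simp
    with dom[OF that] show ?thesis by simp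
  qed
  have bdd: "bdd_below ((\<lambda>(s, c). p (x - s) + c) ` R)" for x
    using lower[of _ _ x] by (intro bdd_belowI[of _ "- p (- x)"]) auto
  have le: "q x \<le> p (x - s) + c" if "(s, c) \<in> R" for x s c
    unfolding q_def using cINF_lower[OF bdd that] by auto
  have ge: "m \<le> q x" if "\<And>s c. (s, c) \<in> R \<Longrightarrow> m \<le> p (x - s) + c" for m x
    unfolding q_def using R0 that by (intro cINF_greatest) auto
  show qp: "q x \<le> p x" for x using le[OF R0, of x] by simp
  have q0: "q 0 = 0"
  proof (rule antisym)
    show "q 0 \<le> 0" using qp[of 0] sublinear_zero[OF p] by simp
    show "0 \<le> q 0" using lower[of _ _ 0] sublinear_zero[OF p] by (intro ge) fastforce
  qed
  show "q s \<le> c" if "(s, c) \<in> R" for s c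
    using le[OF that, of s] sublinear_zero[OF p] by simp
  show "sublinear q"
  proof (rule sublinearI[where p = q, OF _ _ q0])
    fix x y
    have "q (x + y) - (p (x - s) + c) \<le> p (y - s') + c'" if "(s, c) \<in> R" "(s', c') \<in> R" for s c s' c'
      using le[OF Radd[OF that], of "x + y"] sublinear_add[OF p, of "x - s" "y - s'"]
      by (simp add: algebra_simps)
    then have "q (x + y) - (p (x - s) + c) \<le> q y" if "(s, c) \<in> R" for s c
      using that by (intro ge) blast
    then have "q (x + y) - q y \<le> q x"
      by (intro ge) (simp add: algebra_simps)
    then show "q (x + y) \<le> q x + q y" by simp
  next
    fix t :: real and x assume t: "0 < t"
    have "q (t *\<^sub>R x) / t \<le> p (x - s) + c" if "(s, c) \<in> R" for s c
    proof -
      have "q (t *\<^sub>R x) \<le> p (t *\<^sub>R (x - s)) + t * c"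
        using le[OF Rscale[OF t that], of "t *\<^sub>R x"] by (simp add: algebra_simps)
      also have "\<dots> = t * (p (x - s) + c)"
        using t by (subst sublinear_scale[OF p]) (simp_all add: algebra_simps)
      finally show ?thesis using t by (simp add: field_simps)
    qed
    then have "q (t *\<^sub>R x) / t \<le> q x" by (rule ge)
    then show "q (t *\<^sub>R x) \<le> t * q x" using t by (simp add: field_simps)
  qed
qed

lemma constraint_cone_ray: "constraint_cone {(t *\<^sub>R a, t * e) | t. 0 \<le> t}" (is "constraint_cone ?R")
  unfolding constraint_cone_def
proof (intro conjI allI impI)
  show "(0, 0) \<in> ?R" by (auto intro!: exI[of _ 0])
  show "(s + s', c + c') \<in> ?R" if "(s, c) \<in> ?R" "(s', c') \<in> ?R" for s c s' c'
  proof -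
    from that obtain t t' where "0 \<le> t" "0 \<le> t'" "s = t *\<^sub>R a" "c = t * e"
      "s' = t' *\<^sub>R a" "c' = t' * e" by auto
    then show ?thesis by (auto intro!: exI[of _ "t + t'"] simp: algebra_simps)
  qed
  show "(u *\<^sub>R s, u * c) \<in> ?R" if "0 < u" "(s, c) \<in> ?R" for u s c
  proof -
    from that obtain t where "0 \<le> t" "s = t *\<^sub>R a" "c = t * e" by auto
    then show ?thesis using \<open>0 < u\<close> by (auto intro!: exI[of _ "u * t"])
  qed
qed

text \<open>Imposing the constraint \<open>q' (- a) \<le> - q a\<close> cannot lower a minimal \<open>q\<close>; so \<open>q (- a) \<le> - q a\<close>, which
  together with subadditivity gives additivity.\<close>

lemma minimal_sublinear_linear:
  assumes q: "sublinear q" and min: "\<And>q'. sublinear q' \<Longrightarrow> (\<And>x. q' x \<le> q x) \<Longrightarrow> q' = q"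
  shows "linear q"
proof -
  have add: "q (x + a) = q x + q a" for x a
  proof -
    let ?R = "{(t *\<^sub>R (- a), t * (- q a)) | t. 0 \<le> t}"
    obtain q' where q': "sublinear q'" "\<And>x. q' x \<le> q x" "\<And>s c. (s, c) \<in> ?R \<Longrightarrow> q' s \<le> c"
      by (rule sublinear_constrained[OF q constraint_cone_ray[of "- a" "- q a"]]) (auto simp: sublinear_scale[OF q])
    have "q' = q" using q' min by blast
    moreover have "(- a, - q a) \<in> ?R" by (auto intro!: exI[of _ 1])
    ultimately have "q (- a) \<le> - q a" using q'(3) by blast
    then show ?thesis
      using sublinear_add[OF q, of x a] sublinear_add[OF q, of "x + a" "- a"] by simp
  qed
  have neg: "q (- x) = - q x" for x
    using add[of x "- x"] sublinear_zero[OF q] by simp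
  have "q (c *\<^sub>R x) = c *\<^sub>R q x" for c x
    using sublinear_scale[OF q, of c x] sublinear_scale[OF q, of "- c" "x"] neg[of "c *\<^sub>R x"]
    by (cases "0 \<le> c") auto
  with add show ?thesis by (auto intro: linearI)
qed

lemma sublinear_dominates_linear:
  assumes p: "sublinear p"
  obtains \<beta> where "linear \<beta>" "\<And>x. \<beta> x \<le> p x"
proof -
  define A where "A = {q. sublinear q \<and> (\<forall>x. q x \<le> p x)}"
  define P where "P = (\<lambda>a b :: 'a \<Rightarrow> real. b \<le> a)"
  have "\<exists>m\<in>A. \<forall>a\<in>A. P m a \<longrightarrow> a = m"
  proof (rule predicate_Zorn)
    show "partial_order_on A (relation_of P A)"
      by (rule partial_order_on_relation_ofI) (auto simp: P_def)
  next
    fix C assume "C \<in> Chains (relation_of P A)"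
    then have CA: "C \<subseteq> A" and chain: "\<And>a b. a \<in> C \<Longrightarrow> b \<in> C \<Longrightarrow> a \<le> b \<or> b \<le> a"
      by (auto simp: Chains_def relation_of_def P_def)
    show "\<exists>u\<in>A. \<forall>a\<in>C. P a u"
    proof (cases "C = {}")
      case True
      then show ?thesis using p by (auto simp: A_def)
    next
      case False
      define u where "u = (\<lambda>x. INF q\<in>C. q x)"
      have sub: "sublinear q" and dom: "q x \<le> p x" if "q \<in> C" for q x
        using that CA by (auto simp: A_def)
      have lower: "- p (- x) \<le> q x" if "q \<in> C" for q x
        using sublinear_minus[OF sub[OF that], of x] dom[OF that, of "- x"] by simp
      have bdd: "bdd_below ((\<lambda>q. q x) ` C)" for x
        using lower[of _ x] by (auto simp: bdd_below_def)
      have le: "u x \<le> q x" if "q \<in> C" for q x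
        unfolding u_def by (rule cINF_lower[OF bdd that])
      have ge: "m \<le> u x" if "\<And>q. q \<in> C \<Longrightarrow> m \<le> q x" for m x
        unfolding u_def using False that by (intro cINF_greatest) auto
      have up: "u x \<le> p x" for x using False le dom by (meson all_not_in_conv order_trans)
      have u0: "u 0 = 0"
      proof (rule antisym)
        show "u 0 \<le> 0" using up[of 0] sublinear_zero[OF p] by simp
        show "0 \<le> u 0" by (rule ge) (simp add: sublinear_zero[OF sub])
      qed
      have "sublinear u"
      proof (rule sublinearI[where p = u, OF _ _ u0])
        fix x y
        have "u (x + y) - q x \<le> q' y" if "q \<in> C" "q' \<in> C" for q q'
        proof (cases "q \<le> q'")
          case True
          then show ?thesis
            using le[OF that(1), of "x + y"] sublinear_add[OF sub[OF that(1)], of x y]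
              le_funD[OF True, of y] by linarith
        next
          case False
          then have "q' \<le> q" using chain that by blast
          then show ?thesis
            using le[OF that(2), of "x + y"] sublinear_add[OF sub[OF that(2)], of x y]
              le_funD[of q' q x] by linarith
        qed
        then have "u (x + y) - q x \<le> u y" if "q \<in> C" for q
          using that by (intro ge) blast
        then have "u (x + y) - u y \<le> u x"
          by (intro ge) (simp add: algebra_simps)
        then show "u (x + y) \<le> u x + u y" by simp
      next
        fix t :: real and x assume t: "0 < t"
        have "u (t *\<^sub>R x) / t \<le> q x" if "q \<in> C" for q
          using le[OF that, of "t *\<^sub>R x"] sublinear_scale[OF sub[OF that], of t x] t
          by (simp add: field_simps)
        then have "u (t *\<^sub>R x) / t \<le> u x" by (rule ge)
        then show "u (t *\<^sub>R x) \<le> t * u x" using t by (simp add: field_simps)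
      qed
      with up le show ?thesis by (auto simp: A_def P_def le_fun_def)
    qed
  qed
  then obtain m where m: "m \<in> A" "\<And>a. a \<in> A \<Longrightarrow> a \<le> m \<Longrightarrow> a = m"
    by (auto simp: P_def)
  have "linear m"
  proof (rule minimal_sublinear_linear)
    show "sublinear m" using m by (auto simp: A_def)
    fix q' assume "sublinear q'" "\<And>x. q' x \<le> m x"
    then show "q' = m" using m by (intro m(2)) (auto simp: A_def le_fun_def intro: order_trans)
  qed
  with m that show ?thesis by (auto simp: A_def)
qed

text \<open>The one form of the Hahn--Banach theorem from which norming functionals, extensions, separation
  and Banach limits are all obtained below, each by a choice of the cone \<open>R\<close>.\<close>

theorem mazur_orlicz:
  assumes p: "sublinear p" and R: "constraint_cone R" and dom: "\<forall>(s, c)\<in>R. - p (- s) \<le> c"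
  shows "\<exists>\<beta>. linear \<beta> \<and> (\<forall>x. \<beta> x \<le> p x) \<and> (\<forall>(s, c)\<in>R. \<beta> s \<le> c)"
proof -
  obtain q where q: "sublinear q" "\<And>x. q x \<le> p x" "\<And>s c. (s, c) \<in> R \<Longrightarrow> q s \<le> c"
    using sublinear_constrained[OF p R] dom by blast
  obtain \<beta> where \<beta>: "linear \<beta>" "\<And>x. \<beta> x \<le> q x"
    using sublinear_dominates_linear[OF q(1)] by blast
  have "\<beta> x \<le> p x" for x using \<beta>(2) q(2) by (rule order_trans)
  moreover have "\<beta> s \<le> c" if "(s, c) \<in> R" for s c using \<beta>(2) q(3)[OF that] by (rule order_trans)
  ultimately show ?thesis using \<beta>(1) by blast
qed

lemma linear_le_norm_blinfun:
  fixes \<beta> :: "'v::real_normed_vector \<Rightarrow> real"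
  assumes "linear \<beta>" "\<And>x. \<beta> x \<le> d * norm x" "0 \<le> d"
  obtains \<phi> :: "'v \<Rightarrow>\<^sub>L real" where "\<And>x. blinfun_apply \<phi> x = \<beta> x" "norm \<phi> \<le> d"
proof
  have abs: "norm (\<beta> x) \<le> d * norm x" for x
    using assms(2)[of x] assms(2)[of "- x"] linear_neg[OF assms(1), of x] by (auto simp: abs_le_iff)
  then have "bounded_linear \<beta>"
    using abs by (intro bounded_linear_intro[where K = d])
      (simp_all add: linear_add[OF assms(1)] linear_scale[OF assms(1)] mult.commute)
  then show "blinfun_apply (Blinfun \<beta>) x = \<beta> x" for x
    by (simp add: bounded_linear_Blinfun_apply)
  with abs assms(3) show "norm (Blinfun \<beta>) \<le> d" by (intro norm_blinfun_bound) auto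
qed

lemma norming_functional:
  fixes x :: "'v::real_normed_vector"
  obtains \<phi> :: "'v \<Rightarrow>\<^sub>L real" where "norm \<phi> \<le> 1" "blinfun_apply \<phi> x = norm x"
proof -
  let ?R = "{(t *\<^sub>R (- x), t * (- norm x)) | t. 0 \<le> t}"
  have "\<forall>(s, c)\<in>?R. - norm (- s) \<le> c" by auto
  from mazur_orlicz[OF sublinear_norm constraint_cone_ray this]
  obtain \<beta> where \<beta>: "linear \<beta>" "\<forall>y. \<beta> y \<le> norm y" "\<forall>(s, c)\<in>?R. \<beta> s \<le> c"
    by (elim exE conjE)
  have "(- x, - norm x) \<in> ?R" by (auto intro!: exI[of _ 1])
  then have "\<beta> (- x) \<le> - norm x" using \<beta>(3) by blast
  then have "\<beta> x \<ge> norm x" using linear_neg[OF \<beta>(1), of x] by simp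
  with \<beta>(2) have eq: "\<beta> x = norm x" by (simp add: antisym)
  obtain \<phi> :: "'v \<Rightarrow>\<^sub>L real" where "\<And>x. blinfun_apply \<phi> x = \<beta> x" "norm \<phi> \<le> 1"
    using linear_le_norm_blinfun[OF \<beta>(1), of 1] \<beta>(2) by auto
  with eq that show ?thesis by simp
qed

lemma linear_extension_dominated:
  assumes p: "sublinear p" and S: "subspace S" and f: "linear f" and dom: "\<And>x. x \<in> S \<Longrightarrow> f x \<le> p x"
  obtains g where "linear g" "\<And>x. g x \<le> p x" "\<And>x. x \<in> S \<Longrightarrow> g x = f x"
proof -
  let ?R = "(\<lambda>x. (x, f x)) ` S"
  have cone: "constraint_cone ?R"
    using S f by (auto simp: constraint_cone_def subspace_def linear_add linear_scale linear_0 image_iff)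
  have "\<forall>(s, c)\<in>?R. - p (- s) \<le> c"
  proof clarify
    fix x assume "x \<in> S"
    then show "- p (- x) \<le> f x" using dom[of "- x"] subspace_neg[OF S] linear_neg[OF f, of x] by simp
  qed
  from mazur_orlicz[OF p cone this]
  obtain g where g: "linear g" "\<forall>x. g x \<le> p x" "\<forall>(s, c)\<in>?R. g s \<le> c"
    by (elim exE conjE)
  have "g x = f x" if "x \<in> S" for x
  proof (rule antisym)
    show "g x \<le> f x" using g(3) that by blast
    have "(- x, f (- x)) \<in> ?R" using subspace_neg[OF S that] by blast
    then show "f x \<le> g x" using g(3) linear_neg[OF f] linear_neg[OF g(1)] by fastforce
  qed
  with g that show ?thesis by blast
qed

section \<open>James's iteration\<close>

text \<open>Every point of \<open>A\<close> gains at least \<open>\<beta> * \<alpha> + \<eta>\<close> over \<open>p u\<close>. Going to a point \<open>a\<close> that nearly minimises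
  the gain keeps the same rate for the following step: a small gain from \<open>u + \<beta> a\<close> in a direction \<open>y\<close>
  would, by convexity, give a point of \<open>A\<close> between \<open>a\<close> and \<open>y\<close> with a gain from \<open>u\<close> below the infimum.\<close>

lemma james_step:
  assumes p: "sublinear p" and A: "convex A" "A \<noteq> {}" and pos: "0 < \<beta>" "0 < \<beta>'" "0 < \<eta>"
    and low: "\<And>a. a \<in> A \<Longrightarrow> p u + \<beta> * \<alpha> + \<eta> \<le> p (u + \<beta> *\<^sub>R a)"
  obtains a \<eta>' where "a \<in> A" "0 < \<eta>'"
    "\<And>y. y \<in> A \<Longrightarrow> p (u + \<beta> *\<^sub>R a) + \<beta>' * \<alpha> + \<eta>' \<le> p (u + \<beta> *\<^sub>R a + \<beta>' *\<^sub>R y)"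
proof -
  define I where "I = (INF a\<in>A. p (u + \<beta> *\<^sub>R a))"
  define \<kappa> where "\<kappa> = \<beta>' * \<eta> / (2 * \<beta>)"
  have \<beta>\<kappa>: "\<beta> * \<kappa> * 2 = \<beta>' * \<eta>" using pos by (simp add: \<kappa>_def)
  have \<kappa>: "0 < \<kappa>" using pos by (simp add: \<kappa>_def)
  have bdd: "bdd_below ((\<lambda>a. p (u + \<beta> *\<^sub>R a)) ` A)"
    using low by (intro bdd_belowI[of _ "p u + \<beta> * \<alpha> + \<eta>"]) auto
  have I_ge: "p u + \<beta> * \<alpha> + \<eta> \<le> I"
    unfolding I_def using A low by (intro cINF_greatest) auto
  obtain a where a: "a \<in> A" "p (u + \<beta> *\<^sub>R a) < I + \<kappa>"
    using cINF_less_iff[OF A(2) bdd, of "I + \<kappa>"] \<kappa> unfolding I_def by auto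
  have "p (u + \<beta> *\<^sub>R a) + \<beta>' * \<alpha> + \<kappa> \<le> p (u + \<beta> *\<^sub>R a + \<beta>' *\<^sub>R y)" if y: "y \<in> A" for y
  proof -
    define v where "v = u + \<beta> *\<^sub>R a + \<beta>' *\<^sub>R y"
    define z where "z = (\<beta> / (\<beta> + \<beta>')) *\<^sub>R a + (\<beta>' / (\<beta> + \<beta>')) *\<^sub>R y"
    have "z \<in> A"
      unfolding z_def using a y pos
      by (intro convexD[OF A(1)]) (simp_all add: add_divide_distrib[symmetric] add_nonneg_eq_0_iff)
    then have "I \<le> p (u + \<beta> *\<^sub>R z)"
      unfolding I_def by (intro cINF_lower[OF bdd])
    then have "(\<beta> + \<beta>') * I \<le> p ((\<beta> + \<beta>') *\<^sub>R (u + \<beta> *\<^sub>R z))"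
      using pos by (simp add: sublinear_scale[OF p])
    also have "(\<beta> + \<beta>') *\<^sub>R (u + \<beta> *\<^sub>R z) = \<beta> *\<^sub>R v + \<beta>' *\<^sub>R u"
    proof -
      have "(\<beta> + \<beta>') *\<^sub>R z = \<beta> *\<^sub>R a + \<beta>' *\<^sub>R y"
        using pos by (simp add: z_def scaleR_add_right)
      moreover have "(\<beta> + \<beta>') *\<^sub>R (u + \<beta> *\<^sub>R z) = (\<beta> + \<beta>') *\<^sub>R u + \<beta> *\<^sub>R ((\<beta> + \<beta>') *\<^sub>R z)"
        by (simp add: scaleR_add_right mult.commute)
      ultimately have "(\<beta> + \<beta>') *\<^sub>R (u + \<beta> *\<^sub>R z) = (\<beta> + \<beta>') *\<^sub>R u + \<beta> *\<^sub>R (\<beta> *\<^sub>R a + \<beta>' *\<^sub>R y)"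
        by (simp only:)
      then show ?thesis by (simp add: v_def algebra_simps)
    qed
    also have "p (\<beta> *\<^sub>R v + \<beta>' *\<^sub>R u) \<le> \<beta> * p v + \<beta>' * p u"
      using sublinear_add[OF p, of "\<beta> *\<^sub>R v" "\<beta>' *\<^sub>R u"] pos by (simp add: sublinear_scale[OF p])
    finally have "\<beta> * I + \<beta>' * (I - p u) \<le> \<beta> * p v"
      by (simp add: algebra_simps)
    moreover have "\<beta>' * (\<beta> * \<alpha> + \<eta>) \<le> \<beta>' * (I - p u)"
      using I_ge pos by (intro mult_left_mono) auto
    ultimately have "\<beta> * (I + \<beta>' * \<alpha> + 2 * \<kappa>) \<le> \<beta> * p v"
      using \<open>\<beta> * I + \<beta>' * (I - p u) \<le> \<beta> * p v\<close> \<beta>\<kappa> by (simp add: algebra_simps)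
    then have "I + \<beta>' * \<alpha> + 2 * \<kappa> \<le> p v"
      using pos by simp
    with a(2) show ?thesis by (simp add: v_def)
  qed
  with a(1) \<kappa> that show ?thesis by blast
qed

lemma james_sequence:
  fixes A :: "nat \<Rightarrow> 'v::real_vector set"
  assumes p: "sublinear p" and A: "\<And>n. convex (A n)" "\<And>n. A n \<noteq> {}" "\<And>n. A (Suc n) \<subseteq> A n"
    and low: "\<And>a. a \<in> A 0 \<Longrightarrow> d \<le> p a" and \<alpha>: "\<alpha> < d" and \<beta>: "\<And>n. (0::real) < \<beta> n"
  obtains a where "\<And>n. a n \<in> A n"
    "\<And>n. p (\<Sum>i<n. \<beta> i *\<^sub>R a i) + \<beta> n * \<alpha> \<le> p (\<Sum>i<Suc n. \<beta> i *\<^sub>R a i)"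
proof -
  define P where "P = (\<lambda>n u. \<exists>\<eta>>0. \<forall>y\<in>A n. p u + \<beta> n * \<alpha> + \<eta> \<le> p (u + \<beta> n *\<^sub>R y))"
  define Q where "Q = (\<lambda>n u u'. \<exists>a\<in>A n. u' = u + \<beta> n *\<^sub>R a)"
  have "P 0 0"
  proof -
    have "p 0 + \<beta> 0 * \<alpha> + \<beta> 0 * (d - \<alpha>) \<le> p (0 + \<beta> 0 *\<^sub>R y)" if "y \<in> A 0" for y
      using low[OF that] \<beta>[of 0] by (simp add: sublinear_zero[OF p] sublinear_scale[OF p] algebra_simps)
    moreover have "0 < \<beta> 0 * (d - \<alpha>)" using \<alpha> \<beta> by simp
    ultimately show ?thesis unfolding P_def by blast
  qed
  moreover have "\<exists>u'. P (Suc n) u' \<and> Q n u u'" if "P n u" for n u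
  proof -
    from that obtain \<eta> where \<eta>: "0 < \<eta>" "\<And>y. y \<in> A n \<Longrightarrow> p u + \<beta> n * \<alpha> + \<eta> \<le> p (u + \<beta> n *\<^sub>R y)"
      by (auto simp: P_def)
    obtain a \<eta>' where "a \<in> A n" "0 < \<eta>'"
      "\<And>y. y \<in> A n \<Longrightarrow> p (u + \<beta> n *\<^sub>R a) + \<beta> (Suc n) * \<alpha> + \<eta>' \<le> p (u + \<beta> n *\<^sub>R a + \<beta> (Suc n) *\<^sub>R y)"
      by (rule james_step[OF p A(1,2)[of n] \<beta>[of n] \<beta>[of "Suc n"] \<eta>]) blast+
    then show ?thesis unfolding P_def Q_def using A(3)[of n] by blast
  qed
  ultimately obtain u where u: "u 0 = 0" "\<And>n. P n (u n)" "\<And>n. Q n (u n) (u (Suc n))"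
    using dependent_nat_choice[of "\<lambda>n x. P n x \<and> (n = 0 \<longrightarrow> x = 0)" Q] by (metis nat.distinct(1))
  then obtain a where a: "\<And>n. a n \<in> A n" "\<And>n. u (Suc n) = u n + \<beta> n *\<^sub>R a n"
    unfolding Q_def by metis
  have sum: "u n = (\<Sum>i<n. \<beta> i *\<^sub>R a i)" for n
    by (induction n) (simp_all add: u a)
  have "p (u n) + \<beta> n * \<alpha> \<le> p (u (Suc n))" for n
  proof -
    obtain \<eta> where "0 < \<eta>" "p (u n) + \<beta> n * \<alpha> + \<eta> \<le> p (u n + \<beta> n *\<^sub>R a n)"
      using u(2)[of n] a(1)[of n] by (auto simp: P_def)
    then show ?thesis by (simp add: a(2))
  qed
  then show ?thesis unfolding sum by (intro that[OF a(1)])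
qed

section \<open>Pryce's subsequences\<close>

text \<open>Real-valued lower and upper limits, to be used for bounded sequences only.\<close>

definition real_liminf :: "(nat \<Rightarrow> real) \<Rightarrow> real" where
  "real_liminf x = Sup {c. \<forall>\<^sub>F n in sequentially. c \<le> x n}"

definition real_limsup :: "(nat \<Rightarrow> real) \<Rightarrow> real" where
  "real_limsup x = - real_liminf (\<lambda>n. - x n)"

lemma
  assumes bnd: "\<And>n. \<bar>x n\<bar> \<le> M"
  shows real_liminf_geI: "(\<forall>\<^sub>F n in sequentially. c \<le> x n) \<Longrightarrow> c \<le> real_liminf x"
    and real_liminf_leI: "(\<And>c. (\<forall>\<^sub>F n in sequentially. c \<le> x n) \<Longrightarrow> c \<le> m) \<Longrightarrow> real_liminf x \<le> m"
    and real_liminf_abs_le: "\<bar>real_liminf x\<bar> \<le> M"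
proof -
  have le: "c \<le> M" if ev: "\<forall>\<^sub>F n in sequentially. c \<le> x n" for c
  proof -
    obtain n where "c \<le> x n" using eventually_happens'[OF _ ev] by auto
    with bnd[of n] show ?thesis by simp
  qed
  have mem: "- M \<in> {c. \<forall>\<^sub>F n in sequentially. c \<le> x n}"
    using bnd by (auto simp: abs_le_iff minus_le_iff)
  have bdd: "bdd_above {c. \<forall>\<^sub>F n in sequentially. c \<le> x n}" using le by (auto simp: bdd_above_def)
  show 1: "c \<le> real_liminf x" if "\<forall>\<^sub>F n in sequentially. c \<le> x n" for c
    unfolding real_liminf_def using that bdd by (intro cSup_upper) auto
  show 2: "real_liminf x \<le> m" if "\<And>c. (\<forall>\<^sub>F n in sequentially. c \<le> x n) \<Longrightarrow> c \<le> m" for m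
    unfolding real_liminf_def using mem that by (intro cSup_least) auto
  show "\<bar>real_liminf x\<bar> \<le> M" using 1[of "- M"] 2[of M] mem le by (auto simp: abs_le_iff)
qed

lemma real_liminf_subseq:
  assumes bnd: "\<And>n. \<bar>x n\<bar> \<le> M" and r: "strict_mono r"
  shows "real_liminf x \<le> real_liminf (\<lambda>n. x (r n))"
proof (rule real_liminf_leI[OF bnd])
  fix c assume "\<forall>\<^sub>F n in sequentially. c \<le> x n"
  then have "\<forall>\<^sub>F n in sequentially. c \<le> x (r n)" by (rule eventually_subseq[OF r])
  then show "c \<le> real_liminf (\<lambda>n. x (r n))" by (rule real_liminf_geI[OF bnd])
qed

lemma real_limsup_subseq:
  assumes bnd: "\<And>n. \<bar>x n\<bar> \<le> M" and r: "strict_mono r"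
  shows "real_limsup (\<lambda>n. x (r n)) \<le> real_limsup x"
  using real_liminf_subseq[of "\<lambda>n. - x n" M r] assms by (simp add: real_limsup_def)

lemma real_liminf_shift:
  assumes bnd: "\<And>n. \<bar>x n\<bar> \<le> M"
  shows "real_liminf (\<lambda>n. x (m + n)) = real_liminf x"
proof (rule antisym)
  show "real_liminf x \<le> real_liminf (\<lambda>n. x (m + n))"
    by (rule real_liminf_subseq[OF bnd]) (auto simp: strict_mono_def)
  show "real_liminf (\<lambda>n. x (m + n)) \<le> real_liminf x"
  proof (rule real_liminf_leI[OF bnd])
    fix c assume "\<forall>\<^sub>F n in sequentially. c \<le> x (m + n)"
    then have "\<forall>\<^sub>F n in sequentially. c \<le> x n"
      using eventually_sequentially_seg[of "\<lambda>n. c \<le> x n" m] by (simp add: add.commute)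
    then show "c \<le> real_liminf x" by (rule real_liminf_geI[OF bnd])
  qed
qed

lemma real_limsup_shift:
  assumes bnd: "\<And>n. \<bar>x n\<bar> \<le> M"
  shows "real_limsup (\<lambda>n. x (m + n)) = real_limsup x"
  using real_liminf_shift[of "\<lambda>n. - x n" M m] assms by (simp add: real_limsup_def)

lemma subseq_near_real_liminf:
  assumes bnd: "\<And>n. \<bar>x n\<bar> \<le> M" and e: "0 < e"
  obtains r where "strict_mono r" "real_limsup (\<lambda>n. x (r n)) \<le> real_liminf x + e"
proof -
  have "\<not> (\<forall>\<^sub>F n in sequentially. real_liminf x + e \<le> x n)"
    using real_liminf_geI[where x = x, OF bnd, of "real_liminf x + e"] e by auto
  then have "\<exists>\<^sub>F n in sequentially. x n < real_liminf x + e"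
    by (simp add: not_eventually not_le)
  then have "infinite {n. x n < real_liminf x + e}"
    by (simp add: frequently_cofinite cofinite_eq_sequentially[symmetric])
  then obtain r :: "nat \<Rightarrow> nat" where r: "strict_mono r" "\<And>n. r n \<in> {n. x n < real_liminf x + e}"
    using infinite_enumerate by blast
  have "- (real_liminf x + e) \<le> real_liminf (\<lambda>n. - x (r n))"
  proof (rule real_liminf_geI[of _ M])
    show "\<forall>\<^sub>F n in sequentially. - (real_liminf x + e) \<le> - x (r n)"
      using r(2) by (intro always_eventually allI) (simp only: neg_le_iff_le mem_Collect_eq less_imp_le)
  qed (simp add: bnd)
  with r(1) that show ?thesis by (simp add: real_limsup_def)
qed

text \<open>Separability in the form needed for a diagonal argument: rational combinations of the sequence,
  enumerated.\<close>

lemma countable_dense_span: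
  fixes f :: "nat \<Rightarrow> 'v::real_normed_vector"
  obtains g :: "nat \<Rightarrow> 'v" where "\<And>h e. h \<in> closure (span (range f)) \<Longrightarrow> 0 < e \<Longrightarrow> \<exists>i. norm (h - g i) < e"
proof -
  define comb where "comb = (\<lambda>xs :: (rat \<times> nat) list. \<Sum>(q, i)\<leftarrow>xs. of_rat q *\<^sub>R f i)"
  have dense_span: "\<exists>xs. norm (h - comb xs) < e" if "h \<in> span (range f)" "0 < e" for h e
    using that
  proof (induction arbitrary: e rule: span_induct_alt)
    case base
    then show ?case by (intro exI[of _ "[]"]) (simp add: comb_def)
  next
    case (step c x y)
    then obtain i where x: "x = f i" by auto
    obtain xs where xs: "norm (y - comb xs) < e / 2" using step.IH[of "e / 2"] step.prems by auto
    let ?b = "e / (2 * (norm x + 1))"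
    have "0 < ?b" using step.prems by (simp add: add_nonneg_pos)
    then obtain q where q: "c < of_rat q" "of_rat q < c + ?b" using of_rat_dense[of c "c + ?b"] by auto
    have "\<bar>c - of_rat q\<bar> * norm x \<le> ?b * norm x" using q by (intro mult_right_mono) auto
    also have "\<dots> = (e / 2) * (norm x / (norm x + 1))" by (simp add: field_simps)
    also have "\<dots> \<le> e / 2" using step.prems by (intro mult_left_le) (auto simp: divide_le_eq_1 add_nonneg_pos)
    finally have small: "norm ((c - of_rat q) *\<^sub>R x) \<le> e / 2" by simp
    have split: "(c *\<^sub>R x + y) - comb ((q, i) # xs) = (c - of_rat q) *\<^sub>R x + (y - comb xs)"
      by (simp add: comb_def x algebra_simps)
    have "norm ((c *\<^sub>R x + y) - comb ((q, i) # xs)) < e"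
      unfolding split using small xs norm_triangle_ineq[of "(c - of_rat q) *\<^sub>R x" "y - comb xs"] by linarith
    then show ?case by blast
  qed
  have dense: "\<exists>xs. norm (h - comb xs) < e" if h: "h \<in> closure (span (range f))" and e: "0 < e" for h e
  proof -
    from h e obtain h' where h': "h' \<in> span (range f)" "dist h' h < e / 2"
      unfolding closure_approachable by (meson half_gt_zero)
    moreover obtain xs where "norm (h' - comb xs) < e / 2"
      using dense_span[OF h'(1), of "e / 2"] e by auto
    ultimately have "norm (h - comb xs) < e"
      using norm_triangle_ineq[of "h - h'" "h' - comb xs"] by (simp add: dist_norm norm_minus_commute)
    then show ?thesis by blast
  qed
  show ?thesis
  proof (rule that[of "comb \<circ> from_nat"])
    fix h and e :: real assume "h \<in> closure (span (range f))" "0 < e"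
    then obtain xs where "norm (h - comb xs) < e" using dense by blast
    then show "\<exists>i. norm (h - (comb \<circ> from_nat) i) < e"
      by (intro exI[of _ "to_nat xs"]) simp
  qed
qed

lemma blinfun_real_abs_le:
  fixes \<gamma> :: "'v::real_normed_vector \<Rightarrow>\<^sub>L real"
  assumes "norm \<gamma> \<le> 1"
  shows "\<bar>blinfun_apply \<gamma> v\<bar> \<le> norm v"
proof -
  have "\<bar>blinfun_apply \<gamma> v\<bar> \<le> norm \<gamma> * norm v" using norm_blinfun[of \<gamma> v] by simp
  also have "\<dots> \<le> norm v" using assms by (simp add: mult_left_le_one_le)
  finally show ?thesis .
qed

text \<open>Pryce's device replaces separability of \<open>\<Gamma>\<close>. Along the subsequence the
  supremum over \<open>\<Gamma>\<close> of \<open>h - liminf\<close> equals that of \<open>h - limsup\<close>, although the two limits may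
  differ on single elements of \<open>\<Gamma>\<close>. For one \<open>h\<close> up to an error \<open>e\<close>, pick
  \<open>\<gamma>1\<close> that nearly attains the first supremum and a subsequence on which \<open>\<gamma>1\<close> nearly converges to its lower
  limit; this survives the passage to subsequences, so that a diagonal sequence treats countably many
  \<open>h\<close> and \<open>e\<close> at once.\<close>

lemma pryce_subsequence:
  fixes \<Gamma> :: "('v::real_normed_vector \<Rightarrow>\<^sub>L real) set" and f :: "nat \<Rightarrow> 'v"
  assumes \<Gamma>_ball: "\<Gamma> \<subseteq> cball 0 1" and f: "\<And>n. norm (f n) \<le> 1"
  shows "\<exists>s. strict_mono s \<and> (\<forall>h\<in>closure (span (range f)). \<forall>\<gamma>\<in>\<Gamma>. \<forall>e>0.
      \<exists>\<gamma>'\<in>\<Gamma>. blinfun_apply \<gamma> h - real_liminf (\<lambda>n. blinfun_apply \<gamma> (f (s n))) - e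
        \<le> blinfun_apply \<gamma>' h - real_limsup (\<lambda>n. blinfun_apply \<gamma>' (f (s n))))"
proof -
  have \<Gamma>: "norm \<gamma> \<le> 1" if "\<gamma> \<in> \<Gamma>" for \<gamma> using that \<Gamma>_ball by auto
  obtain g :: "nat \<Rightarrow> 'v" where g: "\<And>h e. h \<in> closure (span (range f)) \<Longrightarrow> 0 < e \<Longrightarrow> \<exists>i. norm (h - g i) < e"
    using countable_dense_span[of f] by blast
  have bnd: "\<bar>blinfun_apply \<gamma> (f n)\<bar> \<le> 1" if "\<gamma> \<in> \<Gamma>" for \<gamma> n
    using blinfun_real_abs_le[OF \<Gamma>[OF that], of "f n"] f[of n] by simp
  define near where "near = (\<lambda>h e s. \<forall>\<gamma>\<in>\<Gamma>. \<exists>\<gamma>'\<in>\<Gamma>.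
      blinfun_apply \<gamma> h - real_liminf (\<lambda>n. blinfun_apply \<gamma> (f (s n))) - e
        \<le> blinfun_apply \<gamma>' h - real_limsup (\<lambda>n. blinfun_apply \<gamma>' (f (s n))))"
  define P where "P = (\<lambda>n s. case prod_decode n of (i, k) \<Rightarrow> near (g i) (1 / real (Suc k)) s)"
  have ex: "\<exists>r. strict_mono r \<and> near h e (s \<circ> r)" if e: "0 < e" for h e and s :: "nat \<Rightarrow> nat"
  proof (cases "\<Gamma> = {}")
    case True
    then show ?thesis by (intro exI[of _ id]) (auto simp: near_def strict_mono_def)
  next
    case False
    let ?v = "\<lambda>\<gamma>. blinfun_apply \<gamma> h - real_liminf (\<lambda>n. blinfun_apply \<gamma> (f (s n)))"
    have "?v \<gamma> \<le> norm h + 1" if "\<gamma> \<in> \<Gamma>" for \<gamma>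
      using blinfun_real_abs_le[OF \<Gamma>[OF that], of h]
        real_liminf_abs_le[of "\<lambda>n. blinfun_apply \<gamma> (f (s n))" 1] bnd[OF that] by (auto simp: abs_le_iff)
    then have bdd: "bdd_above (?v ` \<Gamma>)" by (auto simp: bdd_above_def)
    have "(SUP \<gamma>\<in>\<Gamma>. ?v \<gamma>) - e / 2 < (SUP \<gamma>\<in>\<Gamma>. ?v \<gamma>)" using e by simp
    then obtain \<gamma>1 where \<gamma>1: "\<gamma>1 \<in> \<Gamma>" "(SUP \<gamma>\<in>\<Gamma>. ?v \<gamma>) - e / 2 < ?v \<gamma>1"
      using less_cSUP_iff[OF False bdd] by blast
    obtain r where r: "strict_mono r"
      "real_limsup (\<lambda>n. blinfun_apply \<gamma>1 (f (s (r n)))) \<le> real_liminf (\<lambda>n. blinfun_apply \<gamma>1 (f (s n))) + e / 2"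
      using subseq_near_real_liminf[of "\<lambda>n. blinfun_apply \<gamma>1 (f (s n))" 1 "e / 2"] bnd[OF \<gamma>1(1)] e by auto
    have "near h e (s \<circ> r)"
      unfolding near_def
    proof
      fix \<gamma> assume \<gamma>: "\<gamma> \<in> \<Gamma>"
      have "?v \<gamma> \<le> (SUP \<gamma>\<in>\<Gamma>. ?v \<gamma>)" by (rule cSUP_upper[OF \<gamma> bdd])
      moreover have "real_liminf (\<lambda>n. blinfun_apply \<gamma> (f (s n))) \<le> real_liminf (\<lambda>n. blinfun_apply \<gamma> (f (s (r n))))"
        using real_liminf_subseq[of "\<lambda>n. blinfun_apply \<gamma> (f (s n))" 1 r] bnd[OF \<gamma>] r(1) by simp
      ultimately show "\<exists>\<gamma>'\<in>\<Gamma>. blinfun_apply \<gamma> h - real_liminf (\<lambda>n. blinfun_apply \<gamma> (f ((s \<circ> r) n))) - e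
        \<le> blinfun_apply \<gamma>' h - real_limsup (\<lambda>n. blinfun_apply \<gamma>' (f ((s \<circ> r) n)))"
        using \<gamma>1 r(2) by (intro bexI[of _ \<gamma>1]) auto
    qed
    with r(1) show ?thesis by blast
  qed
  have stable: "near h e (s \<circ> r)" if "near h e s" "strict_mono r" for h e s r
    unfolding near_def
  proof
    fix \<gamma> assume \<gamma>: "\<gamma> \<in> \<Gamma>"
    with that(1) obtain \<gamma>' where \<gamma>': "\<gamma>' \<in> \<Gamma>" "blinfun_apply \<gamma> h - real_liminf (\<lambda>n. blinfun_apply \<gamma> (f (s n))) - e
        \<le> blinfun_apply \<gamma>' h - real_limsup (\<lambda>n. blinfun_apply \<gamma>' (f (s n)))"
      unfolding near_def by blast
    have "real_liminf (\<lambda>n. blinfun_apply \<gamma> (f (s n))) \<le> real_liminf (\<lambda>n. blinfun_apply \<gamma> (f (s (r n))))"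
      using real_liminf_subseq[of "\<lambda>n. blinfun_apply \<gamma> (f (s n))" 1 r] bnd[OF \<gamma>] that(2) by simp
    moreover have "real_limsup (\<lambda>n. blinfun_apply \<gamma>' (f (s (r n)))) \<le> real_limsup (\<lambda>n. blinfun_apply \<gamma>' (f (s n)))"
      using real_limsup_subseq[of "\<lambda>n. blinfun_apply \<gamma>' (f (s n))" 1 r] bnd[OF \<gamma>'(1)] that(2) by simp
    ultimately show "\<exists>\<gamma>'\<in>\<Gamma>. blinfun_apply \<gamma> h - real_liminf (\<lambda>n. blinfun_apply \<gamma> (f ((s \<circ> r) n))) - e
        \<le> blinfun_apply \<gamma>' h - real_limsup (\<lambda>n. blinfun_apply \<gamma>' (f ((s \<circ> r) n)))"
      using \<gamma>' by (intro bexI[of _ \<gamma>']) auto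
  qed
  interpret subseqs P
    by unfold_locales (simp add: P_def case_prod_beta ex)
  have near_diag: "near (g i) (1 / real (Suc k)) diagseq" for i k
  proof -
    define n where "n = prod_encode (i, k)"
    have "P n (diagseq \<circ> (+) (Suc n))"
      by (rule diagseq_holds) (auto simp: P_def split: prod.splits intro: stable)
    then have "near (g i) (1 / real (Suc k)) (\<lambda>j. diagseq (Suc n + j))"
      by (simp add: P_def n_def o_def)
    moreover have "real_liminf (\<lambda>j. blinfun_apply \<gamma> (f (diagseq (Suc n + j)))) = real_liminf (\<lambda>j. blinfun_apply \<gamma> (f (diagseq j)))"
      "real_limsup (\<lambda>j. blinfun_apply \<gamma> (f (diagseq (Suc n + j)))) = real_limsup (\<lambda>j. blinfun_apply \<gamma> (f (diagseq j)))"
      if "\<gamma> \<in> \<Gamma>" for \<gamma>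
      using real_liminf_shift[of "\<lambda>j. blinfun_apply \<gamma> (f (diagseq j))" 1 "Suc n"]
        real_limsup_shift[of "\<lambda>j. blinfun_apply \<gamma> (f (diagseq j))" 1 "Suc n"] bnd[OF that] by simp_all
    ultimately show ?thesis unfolding near_def by simp
  qed
  show ?thesis
  proof (intro exI[of _ diagseq] conjI ballI allI impI subseq_diagseq)
    fix h \<gamma> and e :: real
    assume h: "h \<in> closure (span (range f))" and \<gamma>: "\<gamma> \<in> \<Gamma>" and e: "0 < e"
    obtain i where i: "norm (h - g i) < e / 3" using g[OF h, of "e / 3"] e by auto
    obtain k where k: "1 / real (Suc k) < e / 3"
      using e nat_approx_posE[of "e / 3"] by auto
    obtain \<gamma>' where \<gamma>': "\<gamma>' \<in> \<Gamma>"
      "blinfun_apply \<gamma> (g i) - real_liminf (\<lambda>n. blinfun_apply \<gamma> (f (diagseq n))) - 1 / real (Suc k)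
        \<le> blinfun_apply \<gamma>' (g i) - real_limsup (\<lambda>n. blinfun_apply \<gamma>' (f (diagseq n)))"
      using near_diag[of i k] \<gamma> unfolding near_def by blast
    have "\<bar>blinfun_apply \<delta> h - blinfun_apply \<delta> (g i)\<bar> \<le> e / 3" if "\<delta> \<in> \<Gamma>" for \<delta>
      using blinfun_real_abs_le[OF \<Gamma>[OF that], of "h - g i"] i by (simp add: blinfun.diff_right)
    from this[OF \<gamma>] this[OF \<gamma>'(1)] \<gamma>' k
    show "\<exists>\<gamma>'\<in>\<Gamma>. blinfun_apply \<gamma> h - real_liminf (\<lambda>n. blinfun_apply \<gamma> (f (diagseq n))) - e
        \<le> blinfun_apply \<gamma>' h - real_limsup (\<lambda>n. blinfun_apply \<gamma>' (f (diagseq n)))"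
      by (intro bexI[of _ \<gamma>']) (linarith, assumption)
  qed
qed

section \<open>James's theorem\<close>

lemma convex_blinfun_ge: "convex {v. c \<le> blinfun_apply \<gamma> v}" for \<gamma> :: "'v::real_normed_vector \<Rightarrow>\<^sub>L real"
proof -
  have "convex (blinfun_apply \<gamma> -` {c..})"
    by (intro convex_linear_vimage) (auto intro: bounded_linear.linear blinfun.bounded_linear_right)
  then show ?thesis by (simp add: vimage_def)
qed

text \<open>A substitute for weak-star compactness of the unit ball: one \<open>F\<close> plays the part of a limit of the
  sequence for all \<open>\<gamma>\<close> simultaneously. Banach limits will supply it.\<close>

definition has_cluster_points :: "('v::real_normed_vector \<Rightarrow>\<^sub>L real) set \<Rightarrow> 'v set \<Rightarrow> bool" where
  "has_cluster_points \<Gamma> S \<longleftrightarrow> (\<forall>h :: nat \<Rightarrow> 'v. (\<forall>n. h n \<in> S \<and> norm (h n) \<le> 1) \<longrightarrow>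
    (\<exists>F\<in>S. \<forall>\<gamma>\<in>\<Gamma>. \<forall>c.
      ((\<forall>\<^sub>F n in sequentially. c \<le> blinfun_apply \<gamma> (h n)) \<longrightarrow> c \<le> blinfun_apply \<gamma> F) \<and>
      ((\<forall>\<^sub>F n in sequentially. blinfun_apply \<gamma> (h n) \<le> c) \<longrightarrow> blinfun_apply \<gamma> F \<le> c)))"

text \<open>The sequence is separated from its own tails: convex combinations stay at least \<open>d\<close> on some \<open>\<gamma>\<close>
  that vanishes on all but finitely many terms. The witness is \<open>T = (\<Sum>i. \<beta> i *\<^sub>R h i) - F\<close>, where the convex
  combinations \<open>h i\<close> of later and later terms come from \<open>james_sequence\<close>, the weights \<open>\<beta> i\<close> are geometric,
  and \<open>F\<close> is a cluster point of the \<open>h i\<close>. If \<open>\<gamma>0\<close> attained the supremum of \<open>T\<close>, then the gains collected by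
  James's iteration would force \<open>\<gamma>0 (h n) \<ge> \<gamma>0 F + \<alpha> / 2\<close> for all \<open>n\<close>, which is impossible for a cluster
  point.\<close>

lemma james_nonattaining:
  fixes \<Gamma> :: "('v::banach \<Rightarrow>\<^sub>L real) set" and f :: "nat \<Rightarrow> 'v"
  assumes \<Gamma>_ball: "\<Gamma> \<subseteq> cball 0 1"
    and S: "subspace S" "closed S"
    and cluster: "has_cluster_points \<Gamma> S"
    and f: "\<And>n. f n \<in> S" "\<And>n. norm (f n) \<le> 1"
    and d: "0 < d"
    and sep: "\<And>h. h \<in> convex hull (range f) \<Longrightarrow>
      \<exists>\<gamma>\<in>\<Gamma>. d \<le> blinfun_apply \<gamma> h \<and> (\<forall>\<^sub>F n in sequentially. blinfun_apply \<gamma> (f n) = 0)"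
  shows "\<exists>T\<in>S. \<forall>\<gamma>\<in>\<Gamma>. \<exists>\<gamma>'\<in>\<Gamma>. blinfun_apply \<gamma> T < blinfun_apply \<gamma>' T"
proof -
  have \<Gamma>: "norm \<gamma> \<le> 1" if "\<gamma> \<in> \<Gamma>" for \<gamma> using that \<Gamma>_ball by auto
  from pryce_subsequence[of \<Gamma> f, OF \<Gamma>_ball f(2)]
  obtain s where s: "strict_mono s" and pryce:
    "\<forall>h\<in>closure (span (range f)). \<forall>\<gamma>\<in>\<Gamma>. \<forall>e>0.
      \<exists>\<gamma>'\<in>\<Gamma>. blinfun_apply \<gamma> h - real_liminf (\<lambda>n. blinfun_apply \<gamma> (f (s n))) - e
        \<le> blinfun_apply \<gamma>' h - real_limsup (\<lambda>n. blinfun_apply \<gamma>' (f (s n)))"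
    by (elim exE conjE)
  define g where "g = (\<lambda>n. f (s n))"
  define lo where "lo = (\<lambda>\<gamma>. real_liminf (\<lambda>n. blinfun_apply \<gamma> (g n)))"
  define up where "up = (\<lambda>\<gamma>. real_limsup (\<lambda>n. blinfun_apply \<gamma> (g n)))"
  have abs_le: "\<bar>blinfun_apply \<gamma> v\<bar> \<le> norm v" if "\<gamma> \<in> \<Gamma>" for \<gamma> v
    using blinfun_real_abs_le[OF \<Gamma>[OF that]] .
  have bnd: "\<bar>blinfun_apply \<gamma> (g n)\<bar> \<le> 1" if "\<gamma> \<in> \<Gamma>" for \<gamma> n
    using abs_le[OF that, of "g n"] f(2) by (auto simp: g_def intro: order_trans)
  have lo_bnd: "\<bar>lo \<gamma>\<bar> \<le> 1" if "\<gamma> \<in> \<Gamma>" for \<gamma>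
    unfolding lo_def by (rule real_liminf_abs_le[OF bnd[OF that]])
  have "\<Gamma> \<noteq> {}" using sep[of "f 0"] by (auto simp: hull_inc)
  \<comment> \<open>The second component counts how often the lower limit is subtracted, so that a sublinear
    functional on pairs can stand for the supremum of functions on \<open>\<Gamma>\<close> outside the range of \<open>'v\<close>.\<close>
  define p where "p = (\<lambda>w :: 'v \<times> real. SUP \<gamma>\<in>\<Gamma>. blinfun_apply \<gamma> (fst w) - snd w * lo \<gamma>)"
  have p_ub: "blinfun_apply \<gamma> v - c * lo \<gamma> \<le> norm v + \<bar>c\<bar>" if "\<gamma> \<in> \<Gamma>" for \<gamma> v c
  proof -
    have "\<bar>c * lo \<gamma>\<bar> \<le> \<bar>c\<bar>"
      using lo_bnd[OF that] by (simp add: abs_mult mult_left_le)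
    then show ?thesis using abs_le[OF that, of v] by linarith
  qed
  have bdd: "bdd_above ((\<lambda>\<gamma>. blinfun_apply \<gamma> (fst w) - snd w * lo \<gamma>) ` \<Gamma>)" for w
    using p_ub by (intro bdd_aboveI[of _ "norm (fst w) + \<bar>snd w\<bar>"]) auto
  have p_ge: "blinfun_apply \<gamma> v - c * lo \<gamma> \<le> p (v, c)" if "\<gamma> \<in> \<Gamma>" for \<gamma> v c
    unfolding p_def using cSUP_upper[OF that bdd[of "(v, c)"]] by simp
  have p_le: "p (v, c) \<le> m" if "\<And>\<gamma>. \<gamma> \<in> \<Gamma> \<Longrightarrow> blinfun_apply \<gamma> v - c * lo \<gamma> \<le> m" for v c m
    unfolding p_def using \<open>\<Gamma> \<noteq> {}\<close> that by (intro cSUP_least) auto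
  have "sublinear p"
  proof (rule sublinearI)
    fix x y :: "'v \<times> real"
    obtain v c v' c' where xy: "x = (v, c)" "y = (v', c')" by (metis surj_pair)
    have "blinfun_apply \<gamma> (v + v') - (c + c') * lo \<gamma> \<le> p x + p y" if "\<gamma> \<in> \<Gamma>" for \<gamma>
      using p_ge[OF that, of v c] p_ge[OF that, of v' c'] unfolding xy
      by (simp add: blinfun.add_right algebra_simps)
    then show "p (x + y) \<le> p x + p y" unfolding xy by (simp add: p_le)
  next
    fix t :: real and x :: "'v \<times> real" assume t: "0 < t"
    obtain v c where x: "x = (v, c)" by (metis surj_pair)
    have "blinfun_apply \<gamma> (t *\<^sub>R v) - (t * c) * lo \<gamma> \<le> t * p x" if "\<gamma> \<in> \<Gamma>" for \<gamma>
      using mult_left_mono[OF p_ge[OF that, of v c], of t] t unfolding x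
      by (simp add: blinfun.scaleR_right algebra_simps)
    then show "p (t *\<^sub>R x) \<le> t * p x" unfolding x by (simp add: p_le)
  next
    show "p 0 = 0" using \<open>\<Gamma> \<noteq> {}\<close> by (simp add: p_def)
  qed
  define K where "K = (\<lambda>n. convex hull (g ` {n..}))"
  have K_norm: "norm v \<le> 1" if "v \<in> K n" for v n
  proof -
    have "K n \<subseteq> cball 0 1"
      unfolding K_def using f(2) by (intro hull_minimal) (auto simp: g_def)
    with that show ?thesis by auto
  qed
  have K_S: "v \<in> S" if "v \<in> K n" for v n
  proof -
    have "K n \<subseteq> S"
      unfolding K_def using f(1) S by (intro hull_minimal) (auto simp: g_def subspace_imp_convex)
    with that show ?thesis by auto
  qed
  have K_f: "K n \<subseteq> convex hull (range f)" for n
    unfolding K_def by (intro hull_mono) (auto simp: g_def)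
  have K_ge: "c \<le> blinfun_apply \<gamma> v" if "v \<in> K n" "\<And>k. n \<le> k \<Longrightarrow> c \<le> blinfun_apply \<gamma> (g k)"
    for c v n and \<gamma> :: "'v \<Rightarrow>\<^sub>L real"
  proof -
    have "K n \<subseteq> {v. c \<le> blinfun_apply \<gamma> v}"
      unfolding K_def by (rule hull_minimal) (use that(2) convex_blinfun_ge in auto)
    with that show ?thesis by auto
  qed
  \<comment> \<open>The ratio \<open>r\<close> is chosen so that the terms after the \<open>n\<close>-th one, together with the factor \<open>1 - r\<close> in
    \<open>\<beta> n\<close>, cost at most \<open>2 * r = \<alpha> / 2\<close> in units of \<open>r ^ n\<close>: half of what the iteration gains.\<close>
  define \<alpha> where "\<alpha> = min d 1 / 2"
  define r where "r = \<alpha> / 4"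
  have \<alpha>: "0 < \<alpha>" "\<alpha> < d" "\<alpha> \<le> 1 / 2" using d by (auto simp: \<alpha>_def)
  then have r: "0 < r" "r < 1" by (auto simp: r_def)
  define \<beta> where "\<beta> = (\<lambda>n::nat. (1 - r) * r ^ n)"
  have \<beta>: "0 < \<beta> n" "\<beta> n = r ^ n - r ^ Suc n" for n
    using r by (auto simp: \<beta>_def algebra_simps)
  have sum\<beta>: "(\<Sum>i<n. \<beta> i) = 1 - r ^ n" for n
    by (induction n) (auto simp: \<beta>(2))
  define A where "A = (\<lambda>n. K n \<times> {1::real})"
  obtain a where a: "\<And>n. a n \<in> A n"
    and a_gain: "\<And>n. p (\<Sum>i<n. \<beta> i *\<^sub>R a i) + \<beta> n * \<alpha> \<le> p (\<Sum>i<Suc n. \<beta> i *\<^sub>R a i)"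
  proof (rule james_sequence[OF \<open>sublinear p\<close>, of A d \<alpha> \<beta>])
    show "convex (A n)" for n
      unfolding A_def K_def by (intro convex_Times) (auto simp: convex_convex_hull)
    show "A n \<noteq> {}" for n by (auto simp: A_def K_def)
    show "A (Suc n) \<subseteq> A n" for n unfolding A_def K_def by (intro Sigma_mono hull_mono) auto
    show "d \<le> p w" if w: "w \<in> A 0" for w
    proof -
      from w obtain h where h: "w = (h, 1)" "h \<in> K 0" by (auto simp: A_def)
      then obtain \<gamma> where \<gamma>: "\<gamma> \<in> \<Gamma>" "d \<le> blinfun_apply \<gamma> h"
        "\<forall>\<^sub>F n in sequentially. blinfun_apply \<gamma> (f n) = 0" using sep[of h] K_f by blast
      have "\<forall>\<^sub>F n in sequentially. blinfun_apply \<gamma> (g n) = 0"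
        unfolding g_def by (rule eventually_subseq[OF s \<gamma>(3)])
      then have ev: "\<forall>\<^sub>F n in sequentially. blinfun_apply \<gamma> (g n) \<le> 0" by (auto elim: eventually_mono)
      have "c \<le> 0" if c: "\<forall>\<^sub>F n in sequentially. c \<le> blinfun_apply \<gamma> (g n)" for c
        using eventually_happens'[OF _ eventually_conj[OF c ev]] by auto
      then have "lo \<gamma> \<le> 0" unfolding lo_def by (rule real_liminf_leI[OF bnd[OF \<gamma>(1)]])
      then show ?thesis using p_ge[OF \<gamma>(1), of h 1] \<gamma>(2) by (simp add: h)
    qed
    show "\<alpha> < d" "\<And>n. 0 < \<beta> n" by (rule \<alpha>(2)) (rule \<beta>(1))
  qed blast
  define h where "h = (\<lambda>n. fst (a n))"
  have h: "h n \<in> K n" and snd_a: "snd (a n) = 1" for n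
    using a[of n] by (auto simp: h_def A_def)
  have h_norm: "norm (h n) \<le> 1" and h_S: "h n \<in> S" for n using K_norm[OF h] K_S[OF h] by auto
  define u where "u = (\<lambda>n. \<Sum>i<n. \<beta> i *\<^sub>R h i)"
  define q where "q = (\<lambda>n. p (u n, 1 - r ^ n))"
  have "(\<Sum>i<n. \<beta> i *\<^sub>R a i) = (u n, 1 - r ^ n)" for n
    by (intro prod_eqI) (simp_all add: fst_sum snd_sum u_def h_def snd_a sum\<beta>)
  with a_gain have q_gain: "q n + \<beta> n * \<alpha> \<le> q (Suc n)" for n by (simp add: q_def)
  have q_mono: "q n + \<alpha> * r ^ n \<le> q m + \<alpha> * r ^ m" if "n \<le> m" for n m
    using that
  proof (induction m rule: dec_induct)
    case (step m)
    then show ?case using q_gain[of m] by (simp add: \<beta>(2) algebra_simps)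
  qed simp
  have u_S: "u n \<in> S" for n
    unfolding u_def using S(1) h_S by (intro subspace_sum subspace_mul) auto
  have u_diff: "norm (u m - u n) \<le> r ^ n - r ^ m" if "n \<le> m" for n m
    using that
  proof (induction m rule: dec_induct)
    case (step m)
    have "norm (u (Suc m) - u n) \<le> norm (u m - u n) + norm (\<beta> m *\<^sub>R h m)"
      using norm_triangle_ineq[of "u m - u n" "\<beta> m *\<^sub>R h m"] by (simp add: u_def algebra_simps)
    also have "norm (\<beta> m *\<^sub>R h m) \<le> \<beta> m"
      using h_norm[of m] \<beta>(1)[of m] by (simp add: mult_left_le)
    finally show ?case using step.IH by (simp add: \<beta>(2))
  qed simp
  have r_lim: "(\<lambda>m. C * r ^ m) \<longlonglongrightarrow> 0" for C
    using r by (intro tendsto_mult_right_zero LIMSEQ_power_zero) auto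
  have "Cauchy u"
  proof (rule CauchyI')
    fix e :: real assume "0 < e"
    then obtain M where M: "\<And>n. n \<ge> M \<Longrightarrow> norm (1 * r ^ n) < e"
      using LIMSEQ_D[OF r_lim[of 1], of e] by auto
    have "norm (u m - u n) < e" if "M \<le> m" "m < n" for m n
      using u_diff[of m n] that M[of m] r by (simp add: norm_minus_commute)
        (smt (verit) zero_le_power)
    then show "\<exists>M. \<forall>m\<ge>M. \<forall>n>m. dist (u m) (u n) < e" by (auto simp: dist_norm)
  qed
  then obtain hs where hs: "u \<longlonglongrightarrow> hs" using Cauchy_convergent convergent_def by blast
  have hs_S: "hs \<in> S" using closed_sequentially[OF S(2)] u_S hs by blast
  have tail: "norm (hs - u n) \<le> r ^ n" for n
  proof (rule tendsto_upperbound)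
    show "(\<lambda>m. norm (u m - u n)) \<longlonglongrightarrow> norm (hs - u n)" by (intro tendsto_intros hs)
    show "\<forall>\<^sub>F m in sequentially. norm (u m - u n) \<le> r ^ n"
      using r u_diff[of n] by (intro eventually_sequentiallyI[of n]) (smt (verit) zero_le_power)
  qed simp
  have hs_closure: "hs \<in> closure (span (range f))"
  proof -
    have "convex hull (range f) \<subseteq> span (range f)"
      by (rule convex_hull_subset_span)
    then have "u n \<in> span (range f)" for n
      unfolding u_def using h K_f by (intro span_sum span_mul) blast
    with hs show ?thesis unfolding closure_sequential by blast
  qed
  obtain F where F: "F \<in> S" and F_ge: "\<And>\<gamma> c. \<gamma> \<in> \<Gamma> \<Longrightarrow> \<forall>\<^sub>F n in sequentially. c \<le> blinfun_apply \<gamma> (h n) \<Longrightarrow> c \<le> blinfun_apply \<gamma> F"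
    and F_le: "\<And>\<gamma> c. \<gamma> \<in> \<Gamma> \<Longrightarrow> \<forall>\<^sub>F n in sequentially. blinfun_apply \<gamma> (h n) \<le> c \<Longrightarrow> blinfun_apply \<gamma> F \<le> c"
    using cluster[unfolded has_cluster_points_def, rule_format, of h] h_S h_norm by blast
  have lo_F: "lo \<gamma> \<le> blinfun_apply \<gamma> F" if \<gamma>: "\<gamma> \<in> \<Gamma>" for \<gamma>
    unfolding lo_def
  proof (rule real_liminf_leI[OF bnd[OF \<gamma>]])
    fix c assume "\<forall>\<^sub>F n in sequentially. c \<le> blinfun_apply \<gamma> (g n)"
    then obtain N where "\<And>k. N \<le> k \<Longrightarrow> c \<le> blinfun_apply \<gamma> (g k)" by (auto simp: eventually_sequentially)
    then have "c \<le> blinfun_apply \<gamma> (h n)" if "N \<le> n" for n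
      using that by (intro K_ge[OF h]) auto
    then show "c \<le> blinfun_apply \<gamma> F" by (intro F_ge[OF \<gamma>] eventually_sequentiallyI)
  qed
  have F_up: "blinfun_apply \<gamma> F \<le> up \<gamma>" if \<gamma>: "\<gamma> \<in> \<Gamma>" for \<gamma>
  proof -
    have "real_liminf (\<lambda>n. - blinfun_apply \<gamma> (g n)) \<le> - blinfun_apply \<gamma> F"
    proof (rule real_liminf_leI[of _ 1])
      fix c assume "\<forall>\<^sub>F n in sequentially. c \<le> - blinfun_apply \<gamma> (g n)"
      then obtain N where "\<And>k. N \<le> k \<Longrightarrow> c \<le> blinfun_apply (- \<gamma>) (g k)"
        by (auto simp: eventually_sequentially blinfun.minus_left)
      then have "c \<le> blinfun_apply (- \<gamma>) (h n)" if "N \<le> n" for n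
        using that by (intro K_ge[OF h]) auto
      then have "blinfun_apply \<gamma> F \<le> - c"
        by (intro F_le[OF \<gamma>] eventually_sequentiallyI[of N]) (simp add: blinfun.minus_left le_minus_iff)
      then show "c \<le> - blinfun_apply \<gamma> F" by simp
    qed (use bnd[OF \<gamma>] in simp)
    then show ?thesis by (simp add: up_def real_limsup_def)
  qed
  define T where "T = hs - F"
  have "\<exists>\<gamma>'\<in>\<Gamma>. blinfun_apply \<gamma>0 T < blinfun_apply \<gamma>' T" if \<gamma>0: "\<gamma>0 \<in> \<Gamma>" for \<gamma>0
  proof (rule ccontr)
    assume "\<not> ?thesis"
    then have max: "blinfun_apply \<gamma>' T \<le> blinfun_apply \<gamma>0 T" if "\<gamma>' \<in> \<Gamma>" for \<gamma>'
      using that by (auto simp: not_less)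
    \<comment> \<open>The only use of Pryce's property: it turns the lower limit into the upper one, which \<open>F\<close>
      does not exceed.\<close>
    have q_le: "q m \<le> blinfun_apply \<gamma>0 T + 2 * r ^ m" for m
      unfolding q_def
    proof (rule p_le)
      fix \<gamma> assume \<gamma>: "\<gamma> \<in> \<Gamma>"
      have "blinfun_apply \<gamma> hs - lo \<gamma> \<le> blinfun_apply \<gamma>0 T"
      proof (rule field_le_epsilon)
        fix e :: real assume "0 < e"
        then obtain \<gamma>' where \<gamma>': "\<gamma>' \<in> \<Gamma>" "blinfun_apply \<gamma> hs - lo \<gamma> - e \<le> blinfun_apply \<gamma>' hs - up \<gamma>'"
          using pryce[rule_format, OF hs_closure \<gamma>] unfolding lo_def up_def g_def by blast
        then show "blinfun_apply \<gamma> hs - lo \<gamma> \<le> blinfun_apply \<gamma>0 T + e"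
          using F_up[OF \<gamma>'(1)] max[OF \<gamma>'(1)] by (simp add: T_def blinfun.diff_right)
      qed
      moreover have "blinfun_apply \<gamma> (u m) - blinfun_apply \<gamma> hs \<le> r ^ m"
        using abs_le[OF \<gamma>, of "hs - u m"] tail[of m] by (simp add: blinfun.diff_right)
      moreover have "r ^ m * lo \<gamma> \<le> r ^ m"
        using lo_bnd[OF \<gamma>] r by (intro mult_left_le) (auto simp: abs_le_iff)
      ultimately show "blinfun_apply \<gamma> (u m) - (1 - r ^ m) * lo \<gamma> \<le> blinfun_apply \<gamma>0 T + 2 * r ^ m"
        by (simp add: algebra_simps)
    qed
    have q_gap: "q n + \<alpha> * r ^ n \<le> blinfun_apply \<gamma>0 T" for n
    proof (rule tendsto_lowerbound)
      show "(\<lambda>m. blinfun_apply \<gamma>0 T + (2 + \<alpha>) * r ^ m) \<longlonglongrightarrow> blinfun_apply \<gamma>0 T"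
        using tendsto_add[OF tendsto_const r_lim, of "blinfun_apply \<gamma>0 T"] by simp
      have "q n + \<alpha> * r ^ n \<le> blinfun_apply \<gamma>0 T + (2 + \<alpha>) * r ^ m" if "n \<le> m" for m
        using q_mono[OF that] q_le[of m] by (simp add: algebra_simps)
      then show "\<forall>\<^sub>F m in sequentially. q n + \<alpha> * r ^ n \<le> blinfun_apply \<gamma>0 T + (2 + \<alpha>) * r ^ m"
        by (rule eventually_sequentiallyI)
    qed simp
    have "blinfun_apply \<gamma>0 F + \<alpha> / 2 \<le> blinfun_apply \<gamma>0 (h n)" for n
    proof -
      let ?F = "blinfun_apply \<gamma>0 F"
      have rn: "0 < r ^ n" "r ^ n \<le> 1" using r by (auto simp: power_le_one)
      have "(1 - r ^ n) * lo \<gamma>0 \<le> (1 - r ^ n) * ?F"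
        using lo_F[OF \<gamma>0] rn by (intro mult_left_mono) auto
      then have "r ^ n * (?F + \<alpha>) \<le> blinfun_apply \<gamma>0 (hs - u n)"
        using p_ge[OF \<gamma>0, of "u n" "1 - r ^ n"] q_gap[of n]
        by (simp add: q_def T_def blinfun.diff_right algebra_simps)
      also have "hs - u n = (hs - u (Suc n)) + \<beta> n *\<^sub>R h n" by (simp add: u_def)
      also have "blinfun_apply \<gamma>0 \<dots> \<le> r ^ Suc n + \<beta> n * blinfun_apply \<gamma>0 (h n)"
        using abs_le[OF \<gamma>0, of "hs - u (Suc n)"] tail[of "Suc n"]
        by (simp add: blinfun.add_right blinfun.scaleR_right)
      also have "\<dots> = r ^ n * (r + (1 - r) * blinfun_apply \<gamma>0 (h n))"
        by (simp add: \<beta>_def algebra_simps)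
      finally have "?F + \<alpha> \<le> r + (1 - r) * blinfun_apply \<gamma>0 (h n)"
        using rn by simp
      moreover have "- r \<le> r * blinfun_apply \<gamma>0 (h n)"
      proof -
        have "- 1 \<le> blinfun_apply \<gamma>0 (h n)" using abs_le[OF \<gamma>0, of "h n"] h_norm[of n] by linarith
        from mult_left_mono[OF this, of r] r show ?thesis by simp
      qed
      ultimately show ?thesis by (simp add: r_def algebra_simps)
    qed
    then have "blinfun_apply \<gamma>0 F + \<alpha> / 2 \<le> blinfun_apply \<gamma>0 F"
      by (intro F_ge[OF \<gamma>0]) auto
    with \<alpha> show False by simp
  qed
  moreover have "T \<in> S" unfolding T_def using S hs_S F by (intro subspace_diff)
  ultimately show ?thesis by blast
qed

lemma functional_in_span_on_subspace:
  fixes G :: "('v::real_normed_vector \<Rightarrow>\<^sub>L real) set"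
  assumes "finite G" "subspace S" "\<And>v. v \<in> S \<Longrightarrow> (\<And>\<gamma>. \<gamma> \<in> G \<Longrightarrow> blinfun_apply \<gamma> v = 0) \<Longrightarrow> blinfun_apply \<omega> v = 0"
  shows "\<exists>u\<in>span G. \<forall>v\<in>S. blinfun_apply \<omega> v = blinfun_apply u v"
  using assms
proof (induction G arbitrary: S rule: finite_induct)
  case empty
  then show ?case by (intro bexI[of _ 0]) auto
next
  case (insert \<gamma> G)
  let ?S = "{v \<in> S. blinfun_apply \<gamma> v = 0}"
  have "subspace ?S"
    using insert.prems(1) by (auto simp: subspace_def blinfun.add_right blinfun.scaleR_right)
  moreover have "blinfun_apply \<omega> v = 0" if "v \<in> ?S" "\<And>\<gamma>'. \<gamma>' \<in> G \<Longrightarrow> blinfun_apply \<gamma>' v = 0" for v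
    using that by (intro insert.prems(2)) auto
  ultimately obtain u where u: "u \<in> span G" "\<And>v. v \<in> ?S \<Longrightarrow> blinfun_apply \<omega> v = blinfun_apply u v"
    using insert.IH[of ?S] by blast
  show ?case
  proof (cases "\<exists>a\<in>S. blinfun_apply \<gamma> a \<noteq> 0")
    case False
    then have "blinfun_apply \<omega> v = blinfun_apply u v" if "v \<in> S" for v using u(2) that by auto
    then show ?thesis using u(1) span_mono[of G "insert \<gamma> G"] by blast
  next
    case True
    then obtain a where a: "a \<in> S" "blinfun_apply \<gamma> a \<noteq> 0" by blast
    define t where "t = (blinfun_apply \<omega> a - blinfun_apply u a) / blinfun_apply \<gamma> a"
    show ?thesis
    proof (intro bexI[of _ "u + t *\<^sub>R \<gamma>"] ballI)
      show "u + t *\<^sub>R \<gamma> \<in> span (insert \<gamma> G)"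
        using u(1) span_mono[of G "insert \<gamma> G"] by (intro span_add span_mul) (auto intro: span_base)
      fix v assume v: "v \<in> S"
      define c where "c = blinfun_apply \<gamma> v / blinfun_apply \<gamma> a"
      have "v - c *\<^sub>R a \<in> ?S"
        using v a insert.prems(1) by (simp add: subspace_diff subspace_mul blinfun.diff_right blinfun.scaleR_right c_def)
      from u(2)[OF this] have "blinfun_apply \<omega> v - blinfun_apply u v = c * (blinfun_apply \<omega> a - blinfun_apply u a)"
        by (simp add: blinfun.diff_right blinfun.scaleR_right algebra_simps)
      then show "blinfun_apply \<omega> v = blinfun_apply (u + t *\<^sub>R \<gamma>) v"
        using a(2) by (simp add: blinfun.add_left blinfun.scaleR_left t_def c_def mult.commute diff_eq_eq)
    qed
  qed
qed

text \<open>If \<open>\<Phi>\<close> is not approximable, Helly's argument gives, for each finite \<open>G \<subseteq> \<Gamma>\<close>, a vector of norm at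
  most 1 that is annihilated by \<open>G\<close> and on which \<open>\<Phi>\<close> takes the value \<open>e\<close>. Choosing vectors one after
  another, each annihilated by finitely many functionals that are large on all convex combinations of
  the previous ones, produces a sequence as in \<open>james_nonattaining\<close>.\<close>

theorem james_approximation:
  fixes \<Gamma> :: "('v::banach \<Rightarrow>\<^sub>L real) set" and \<Phi> :: "'v \<Rightarrow>\<^sub>L real"
  assumes \<Gamma>_ball: "\<Gamma> \<subseteq> cball 0 1"
    and S: "subspace S" "closed S"
    and cluster: "has_cluster_points \<Gamma> S"
    and attain: "\<And>T. T \<in> S \<Longrightarrow> \<exists>\<gamma>\<in>\<Gamma>. \<forall>\<gamma>'\<in>\<Gamma>. blinfun_apply \<gamma>' T \<le> blinfun_apply \<gamma> T"
    and dom: "\<And>T. T \<in> S \<Longrightarrow> \<exists>\<gamma>\<in>\<Gamma>. blinfun_apply \<Phi> T \<le> blinfun_apply \<gamma> T"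
    and e: "0 < e"
  shows "\<exists>u\<in>span \<Gamma>. \<forall>T\<in>S. \<bar>blinfun_apply \<Phi> T - blinfun_apply u T\<bar> \<le> e * norm T"
proof (rule ccontr)
  assume far: "\<not> ?thesis"
  have helly: "\<exists>T\<in>S. norm T \<le> 1 \<and> blinfun_apply \<Phi> T = e \<and> (\<forall>\<gamma>\<in>G. blinfun_apply \<gamma> T = 0)"
    if G: "finite G" "G \<subseteq> \<Gamma>" for G
  proof (rule ccontr)
    assume none: "\<not> ?thesis"
    define V0 where "V0 = {v \<in> S. \<forall>\<gamma>\<in>G. blinfun_apply \<gamma> v = 0}"
    have V0: "subspace V0"
      using S(1) by (auto simp: V0_def subspace_def blinfun.add_right blinfun.scaleR_right)
    have small: "blinfun_apply \<Phi> v \<le> e * norm v" if v: "v \<in> V0" for v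
    proof (rule ccontr)
      assume big: "\<not> ?thesis"
      moreover have "0 \<le> e * norm v" using e by simp
      ultimately have pos: "0 < blinfun_apply \<Phi> v" by linarith
      let ?w = "(e / blinfun_apply \<Phi> v) *\<^sub>R v"
      have "?w \<in> V0" using V0 v by (rule subspace_mul)
      moreover have "norm ?w \<le> 1" using big pos e by (simp add: field_simps)
      moreover have "blinfun_apply \<Phi> ?w = e" using pos by (simp add: blinfun.scaleR_right)
      ultimately show False using none by (auto simp: V0_def)
    qed
    have subl: "sublinear (\<lambda>v :: 'v. e * norm v)"
      using e norm_triangle_ineq by (auto simp: sublinear_def distrib_left[symmetric])
    have "linear (blinfun_apply \<Phi>)" by (intro bounded_linear.linear blinfun.bounded_linear_right)
    then obtain \<beta> where \<beta>: "linear \<beta>" "\<And>v. \<beta> v \<le> e * norm v" "\<And>v. v \<in> V0 \<Longrightarrow> \<beta> v = blinfun_apply \<Phi> v"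
      using linear_extension_dominated[OF subl V0 _ small] by blast
    obtain \<psi> :: "'v \<Rightarrow>\<^sub>L real" where \<psi>: "\<And>v. blinfun_apply \<psi> v = \<beta> v" "norm \<psi> \<le> e"
      using linear_le_norm_blinfun[OF \<beta>(1,2)] e by auto
    have "\<exists>u\<in>span G. \<forall>v\<in>S. blinfun_apply (\<Phi> - \<psi>) v = blinfun_apply u v"
      using \<beta>(3) by (intro functional_in_span_on_subspace[OF G(1) S(1)])
        (auto simp: V0_def \<psi> blinfun.diff_left)
    then obtain u where u: "u \<in> span G" "\<And>v. v \<in> S \<Longrightarrow> blinfun_apply \<Phi> v - blinfun_apply u v = blinfun_apply \<psi> v"
      by (auto simp: blinfun.diff_left algebra_simps)
    have "\<bar>blinfun_apply \<Phi> v - blinfun_apply u v\<bar> \<le> e * norm v" if "v \<in> S" for v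
      unfolding u(2)[OF that] using norm_blinfun[of \<psi> v] mult_right_mono[OF \<psi>(2), of "norm v"] by simp
    moreover have "u \<in> span \<Gamma>" using u(1) span_mono[OF G(2)] by blast
    ultimately show False using far by blast
  qed
  define Q where "Q = {v \<in> S. blinfun_apply \<Phi> v = e}"
  have "convex Q"
    unfolding Q_def using S(1)
    by (auto simp: convex_def subspace_def blinfun.add_right blinfun.scaleR_right simp flip: distrib_right)
  have ex_norming: "\<exists>G. finite G \<and> G \<subseteq> \<Gamma> \<and> (\<forall>h\<in>convex hull A. \<exists>\<gamma>\<in>G. e / 2 \<le> blinfun_apply \<gamma> h)"
    if A: "finite A" "A \<subseteq> Q" for A
  proof -
    have hull: "convex hull A \<subseteq> Q" using A(2) \<open>convex Q\<close> by (rule hull_minimal)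
    have compact: "compact (convex hull A)" using A(1) by (rule finite_imp_compact_convex_hull)
    have cover: "convex hull A \<subseteq> (\<Union>\<gamma>\<in>\<Gamma>. {v. e / 2 < blinfun_apply \<gamma> v})"
    proof
      fix h assume "h \<in> convex hull A"
      then have "h \<in> S" "blinfun_apply \<Phi> h = e" using hull by (auto simp: Q_def)
      then obtain \<gamma> where "\<gamma> \<in> \<Gamma>" "e \<le> blinfun_apply \<gamma> h" using dom by metis
      with e show "h \<in> (\<Union>\<gamma>\<in>\<Gamma>. {v. e / 2 < blinfun_apply \<gamma> v})" by force
    qed
    have "open {v. e / 2 < blinfun_apply \<gamma> v}" for \<gamma> :: "'v \<Rightarrow>\<^sub>L real"
      by (intro open_Collect_less continuous_intros)
    then obtain G where "G \<subseteq> \<Gamma>" "finite G" "convex hull A \<subseteq> (\<Union>\<gamma>\<in>G. {v. e / 2 < blinfun_apply \<gamma> v})"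
      by (rule compactE_image[OF compact _ cover])
    then show ?thesis by (intro exI[of _ G]) (fastforce intro: less_imp_le)
  qed
  \<comment> \<open>Finitely many functionals suffice for all convex combinations of a finite set because its
    convex hull is compact.\<close>
  define N where "N = (\<lambda>A. SOME G. finite G \<and> G \<subseteq> \<Gamma> \<and> (\<forall>h\<in>convex hull A. \<exists>\<gamma>\<in>G. e / 2 \<le> blinfun_apply \<gamma> h))"
  have N: "finite (N A)" "N A \<subseteq> \<Gamma>" "\<forall>h\<in>convex hull A. \<exists>\<gamma>\<in>N A. e / 2 \<le> blinfun_apply \<gamma> h"
    if "finite A" "A \<subseteq> Q" for A
    using someI_ex[OF ex_norming[OF that]] unfolding N_def by blast+
  define P where "P = (\<lambda>f (n::nat) v. v \<in> Q \<and> norm v \<le> 1 \<and> (\<forall>m<n. \<forall>\<gamma>\<in>N (f ` {..m}). blinfun_apply \<gamma> v = 0))"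
  have "\<exists>f. \<forall>n. P f n (f n)"
  proof (rule dependent_wf_choice[OF wf_less])
    fix f g :: "nat \<Rightarrow> 'v" and n v assume fg: "\<And>m. (m, n) \<in> {(x, y). x < y} \<Longrightarrow> f m = g m"
    have "f ` {..m} = g ` {..m}" if "m < n" for m using fg that by (intro image_cong) auto
    then show "P f n v = P g n v" unfolding P_def by auto
  next
    fix n f assume IH: "\<And>m. (m, n) \<in> {(x, y). x < y} \<Longrightarrow> P f m (f m)"
    then have sub: "f ` {..m} \<subseteq> Q" if "m < n" for m using that by (auto simp: P_def)
    have "finite (\<Union>m<n. N (f ` {..m}))" "(\<Union>m<n. N (f ` {..m})) \<subseteq> \<Gamma>"
      using N(1,2)[OF _ sub] by auto
    from helly[OF this] show "\<exists>v. P f n v" by (auto simp: P_def Q_def)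
  qed
  then obtain f where f: "\<And>n. P f n (f n)" by blast
  then have fQ: "f ` X \<subseteq> Q" for X by (auto simp: P_def)
  have "\<exists>T\<in>S. \<forall>\<gamma>\<in>\<Gamma>. \<exists>\<gamma>'\<in>\<Gamma>. blinfun_apply \<gamma> T < blinfun_apply \<gamma>' T"
  proof (rule james_nonattaining[OF \<Gamma>_ball S cluster, where f = f and d = "e / 2"])
    show "f n \<in> S" "norm (f n) \<le> 1" for n using f[of n] by (auto simp: P_def Q_def)
    show "0 < e / 2" using e by simp
    fix h assume h: "h \<in> convex hull (range f)"
    let ?U = "\<Union>m. convex hull (f ` {..m})"
    have "convex ?U"
    proof (rule convexI)
      fix x y and a b :: real assume "x \<in> ?U" "y \<in> ?U" and ab: "0 \<le> a" "0 \<le> b" "a + b = 1"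
      then obtain m k where "x \<in> convex hull (f ` {..m})" "y \<in> convex hull (f ` {..k})" by blast
      moreover have "convex hull (f ` {..m}) \<subseteq> convex hull (f ` {..max m k})"
        "convex hull (f ` {..k}) \<subseteq> convex hull (f ` {..max m k})"
        by (intro hull_mono image_mono; simp)+
      ultimately have "x \<in> convex hull (f ` {..max m k})" "y \<in> convex hull (f ` {..max m k})" by blast+
      then have "a *\<^sub>R x + b *\<^sub>R y \<in> convex hull (f ` {..max m k})"
        using ab by (intro convexD[OF convex_convex_hull])
      then show "a *\<^sub>R x + b *\<^sub>R y \<in> ?U" by blast
    qed
    moreover have "range f \<subseteq> ?U" by (auto intro!: exI hull_inc)
    ultimately have "convex hull (range f) \<subseteq> ?U" by (intro hull_minimal)
    with h obtain m where m: "h \<in> convex hull (f ` {..m})" by blast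
    obtain \<gamma> where \<gamma>: "\<gamma> \<in> N (f ` {..m})" "e / 2 \<le> blinfun_apply \<gamma> h"
      using N(3)[OF _ fQ, of "{..m}"] m by auto
    have "blinfun_apply \<gamma> (f n) = 0" if "m < n" for n
      using f[of n] that \<gamma>(1) by (auto simp: P_def)
    then have "\<forall>\<^sub>F n in sequentially. blinfun_apply \<gamma> (f n) = 0"
      by (intro eventually_sequentiallyI[of "Suc m"]) auto
    then show "\<exists>\<gamma>\<in>\<Gamma>. e / 2 \<le> blinfun_apply \<gamma> h \<and> (\<forall>\<^sub>F n in sequentially. blinfun_apply \<gamma> (f n) = 0)"
      using \<gamma> N(2)[OF _ fQ, of "{..m}"] by auto
  qed
  with attain show False by (meson not_le)
qed

section \<open>Banach limits\<close>

definition banach_limit :: "((nat \<Rightarrow> real) \<Rightarrow> real) \<Rightarrow> bool" where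
  "banach_limit L \<longleftrightarrow>
    (\<forall>x y. bounded (range x) \<longrightarrow> bounded (range y) \<longrightarrow> L (\<lambda>n. x n + y n) = L x + L y) \<and>
    (\<forall>c x. bounded (range x) \<longrightarrow> L (\<lambda>n. c * x n) = c * L x) \<and>
    (\<forall>c x. bounded (range x) \<longrightarrow> (\<forall>\<^sub>F n in sequentially. c \<le> x n) \<longrightarrow> c \<le> L x) \<and>
    (\<forall>c x. bounded (range x) \<longrightarrow> (\<forall>\<^sub>F n in sequentially. x n \<le> c) \<longrightarrow> L x \<le> c)"

lemma banach_limitD:
  assumes "banach_limit L" "bounded (range x)"
  shows "bounded (range y) \<Longrightarrow> L (\<lambda>n. x n + y n) = L x + L y"
    and "L (\<lambda>n. c * x n) = c * L x"
    and "\<forall>\<^sub>F n in sequentially. c \<le> x n \<Longrightarrow> c \<le> L x"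
    and "\<forall>\<^sub>F n in sequentially. x n \<le> c \<Longrightarrow> L x \<le> c"
  using assms unfolding banach_limit_def by blast+

text \<open>The cone consists of the pairs \<open>(s, c)\<close> with eventually \<open>s n \<le> c\<close>.\<close>

lemma banach_limit_exists: "\<exists>L. banach_limit L"
proof -
  define R where "R = {(s :: nat \<Rightarrow>\<^sub>C real, c). \<forall>\<^sub>F n in sequentially. apply_bcontfun s n \<le> c}"
  have R_iff: "(s, c) \<in> R \<longleftrightarrow> (\<forall>\<^sub>F n in sequentially. apply_bcontfun s n \<le> c)" for s c
    by (simp add: R_def)
  have cone: "constraint_cone R"
    unfolding constraint_cone_def
  proof (intro conjI allI impI)
    fix s s' :: "nat \<Rightarrow>\<^sub>C real" and c c' assume "(s, c) \<in> R" "(s', c') \<in> R"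
    then have "\<forall>\<^sub>F n in sequentially. apply_bcontfun s n \<le> c \<and> apply_bcontfun s' n \<le> c'"
      by (simp add: R_iff eventually_conj)
    then show "(s + s', c + c') \<in> R" by (auto simp: R_iff elim!: eventually_mono)
  next
    fix t :: real and s :: "nat \<Rightarrow>\<^sub>C real" and c assume "0 < t" "(s, c) \<in> R"
    then show "(t *\<^sub>R s, t * c) \<in> R" by (auto simp: R_iff elim!: eventually_mono)
  qed (simp add: R_iff)
  have "\<forall>(s, c)\<in>R. - norm (- s) \<le> c"
  proof clarify
    fix s :: "nat \<Rightarrow>\<^sub>C real" and c assume "(s, c) \<in> R"
    then have "\<forall>\<^sub>F n in sequentially. apply_bcontfun s n \<le> c" by (simp add: R_iff)
    then obtain n where "apply_bcontfun s n \<le> c" using eventually_happens' by fastforce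
    then show "- norm (- s) \<le> c" using norm_bounded[of s n] by simp
  qed
  from mazur_orlicz[OF sublinear_norm cone this]
  obtain \<beta> where lin: "linear \<beta>" and "\<forall>s. \<beta> s \<le> norm s" and \<beta>: "\<forall>(s, c)\<in>R. \<beta> s \<le> c"
    by (elim exE conjE)
  define L where "L = (\<lambda>x. \<beta> (Bcontfun x))"
  have B: "apply_bcontfun (Bcontfun x) = x" if "bounded (range x)" for x :: "nat \<Rightarrow> real"
    using that by (intro Bcontfun_inverse) (simp add: bcontfun_def)
  have scale: "L (\<lambda>n. c * x n) = c * L x" if x: "bounded (range x)" for c x
  proof -
    have "bounded (range (\<lambda>n. c * x n))"
      using bounded_scaling[OF x, of c] by (simp add: image_image)
    then have "Bcontfun (\<lambda>n. c * x n) = c *\<^sub>R Bcontfun x"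
      using B x by (intro bcontfun_eqI) simp
    then show ?thesis by (simp add: L_def linear_scale[OF lin])
  qed
  have upper: "L x \<le> c" if "bounded (range x)" "\<forall>\<^sub>F n in sequentially. x n \<le> c" for c x
  proof -
    have "(Bcontfun x, c) \<in> R" using that B by (simp add: R_iff)
    with \<beta> show ?thesis unfolding L_def by blast
  qed
  have add: "L (\<lambda>n. x n + y n) = L x + L y" if xy: "bounded (range x)" "bounded (range y)" for x y
  proof -
    have "bounded (range (\<lambda>n. x n + y n))" using xy by (rule bounded_plus_comp)
    then have "Bcontfun (\<lambda>n. x n + y n) = Bcontfun x + Bcontfun y"
      using B xy by (intro bcontfun_eqI) simp
    then show ?thesis by (simp add: L_def linear_add[OF lin])
  qed
  have lower: "c \<le> L x" if x: "bounded (range x)" and ev: "\<forall>\<^sub>F n in sequentially. c \<le> x n" for c x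
  proof -
    have "bounded (range (\<lambda>n. - 1 * x n))" using bounded_scaling[OF x, of "- 1"] by (simp add: image_image)
    then have "L (\<lambda>n. - 1 * x n) \<le> - c" by (rule upper) (use ev in simp)
    then show ?thesis using scale[OF x, of "- 1"] by simp
  qed
  have "banach_limit L"
    unfolding banach_limit_def by (intro conjI allI impI add scale lower upper)
  then show ?thesis by (rule exI[of banach_limit L])
qed

section \<open>Evaluation functionals\<close>

definition ev :: "'a::real_normed_vector \<Rightarrow> ('a \<Rightarrow>\<^sub>L real) \<Rightarrow>\<^sub>L real" where
  "ev x = Blinfun (\<lambda>g. blinfun_apply g x)"

lemma ev_apply [simp]: "blinfun_apply (ev x) g = blinfun_apply g x"
  unfolding ev_def by (simp add: bounded_linear_Blinfun_apply blinfun.bounded_linear_left)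

lemma norm_ev_le: "norm (ev x) \<le> norm x"
  by (intro norm_blinfun_bound norm_ge_zero) (simp, metis mult.commute norm_blinfun real_norm_def)

lemma subspace_range_ev: "subspace (range ev)"
proof (rule linear_subspace_image[OF _ subspace_UNIV])
  show "linear ev"
    by (intro linearI blinfun_eqI) (auto simp: blinfun.add_left blinfun.scaleR_left blinfun.add_right blinfun.scaleR_right)
qed

text \<open>The canonical image of a Banach space in its bidual is closed, because the embedding is isometric.\<close>

lemma closure_ev_range:
  fixes z :: "('a::banach \<Rightarrow>\<^sub>L real) \<Rightarrow>\<^sub>L real"
  assumes approx: "\<And>e. 0 < e \<Longrightarrow> \<exists>x. \<forall>g. \<bar>blinfun_apply z g - blinfun_apply g x\<bar> \<le> e * norm g"
  obtains x where "\<And>g. blinfun_apply z g = blinfun_apply g x"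
proof -
  have "\<exists>x. \<forall>g. \<bar>blinfun_apply z g - blinfun_apply g x\<bar> \<le> (1 / 2) ^ n * norm g" for n :: nat
    by (intro approx) simp
  then obtain x where x: "\<And>n g. \<bar>blinfun_apply z g - blinfun_apply g (x n)\<bar> \<le> (1 / 2) ^ n * norm g" by metis
  have half: "(\<lambda>n. C * (1 / 2) ^ n) \<longlonglongrightarrow> (0::real)" for C
    by (intro tendsto_mult_right_zero LIMSEQ_power_zero) auto
  have diff: "norm (x m - x n) \<le> 2 * (1 / 2) ^ m" if mn: "m \<le> n" for m n
  proof -
    obtain \<phi> :: "'a \<Rightarrow>\<^sub>L real" where \<phi>: "norm \<phi> \<le> 1" "blinfun_apply \<phi> (x m - x n) = norm (x m - x n)"
      using norming_functional by blast
    have "(1 / 2) ^ n \<le> ((1::real) / 2) ^ m" using mn by (intro power_decreasing) auto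
    moreover have "(1 / 2) ^ k * norm \<phi> \<le> (1 / 2) ^ k" for k using \<phi>(1) by (simp add: mult_left_le)
    ultimately show ?thesis
      using x[of \<phi> m] x[of \<phi> n] \<phi>(2) unfolding blinfun.diff_right by (smt (verit, best))
  qed
  have "Cauchy x"
  proof (rule CauchyI')
    fix e :: real assume "0 < e"
    then obtain M where M: "\<And>n. n \<ge> M \<Longrightarrow> norm (2 * (1 / 2) ^ n :: real) < e"
      using LIMSEQ_D[OF half[of 2], of e] by auto
    have "dist (x m) (x n) < e" if "M \<le> m" "m < n" for m n
      using diff[of m n] M[of m] that by (simp add: dist_norm)
    then show "\<exists>M. \<forall>m\<ge>M. \<forall>n>m. dist (x m) (x n) < e" by blast
  qed
  then obtain xs where xs: "x \<longlonglongrightarrow> xs" using Cauchy_convergent convergent_def by blast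
  have "blinfun_apply z g = blinfun_apply g xs" for g
  proof -
    have "(\<lambda>n. \<bar>blinfun_apply z g - blinfun_apply g (x n)\<bar>) \<longlonglongrightarrow> \<bar>blinfun_apply z g - blinfun_apply g xs\<bar>"
      by (intro tendsto_intros xs)
    moreover have "(\<lambda>n. \<bar>blinfun_apply z g - blinfun_apply g (x n)\<bar>) \<longlonglongrightarrow> 0"
    proof (rule tendsto_sandwich[OF _ _ tendsto_const half[of "norm g"]])
      show "\<forall>\<^sub>F n in sequentially. \<bar>blinfun_apply z g - blinfun_apply g (x n)\<bar> \<le> norm g * (1 / 2) ^ n"
        using x by (simp add: mult.commute)
    qed simp
    ultimately have "\<bar>blinfun_apply z g - blinfun_apply g xs\<bar> = 0" by (rule LIMSEQ_unique)
    then show ?thesis by simp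
  qed
  with that show ?thesis by blast
qed

section \<open>Banach spaces over the real or complex scalars\<close>

text \<open>The map \<open>re\<close> stands for the identity of \<open>\<real>\<close> or for the real part on \<open>\<complex>\<close>. The last assumption says that
  every real functional is the real part of a functional over \<open>'k\<close>; through it the Hahn--Banach theorem
  for real functionals serves both cases.\<close>

locale banach_space_re = banach_space_over smul
  for smul :: "'k::real_normed_field \<Rightarrow> 'a::banach \<Rightarrow> 'a" +
  fixes re :: "'k \<Rightarrow> real"
  assumes re_linear: "linear re"
    and re_le_norm: "re c \<le> norm c"
    and re_eq_1: "norm c \<le> 1 \<Longrightarrow> re c = 1 \<Longrightarrow> c = 1"
    and phase: "\<exists>l. norm l = 1 \<and> re (l * c) = norm c"
    and re_surj: "bounded_linear g \<Longrightarrow> \<exists>f\<in>dual_space smul. \<forall>x. re (f x) = g x"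
begin

lemma abs_re_le: "\<bar>re c\<bar> \<le> norm c"
  using re_le_norm[of c] re_le_norm[of "- c"] linear_neg[OF re_linear, of c] by (simp add: abs_le_iff)

lemma dual_space_bounded_linear: "f \<in> dual_space smul \<Longrightarrow> bounded_linear f"
  by (simp add: dual_space_def bounded_maps_def)

lemma dual_space_scale: "f \<in> dual_space smul \<Longrightarrow> f (smul c x) = c * f x"
  by (simp add: dual_space_def bounded_maps_def Vector_Spaces.linear_iff)

lemma dual_space_norm_le:
  assumes f: "f \<in> dual_space smul" and bound: "\<And>y. re (f y) \<le> d * norm y"
  shows "norm (f x) \<le> d * norm x"
proof -
  obtain l where l: "norm l = 1" "re (l * f x) = norm (f x)" using phase by blast
  then show ?thesis using bound[of "smul l x"] by (simp add: dual_space_scale[OF f] norm_smul)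
qed

lemma state_pairsD:
  assumes "(x, f) \<in> state_pairs smul"
  shows "norm x = 1" "f \<in> dual_space smul" "f x = 1" "norm (f y) \<le> norm y"
proof -
  show "norm x = 1" "f x = 1" and f: "f \<in> dual_space smul"
    using assms by (auto simp: state_pairs_def)
  show "norm (f y) \<le> norm y"
    using onorm[OF dual_space_bounded_linear[OF f], of y] assms by (simp add: state_pairs_def)
qed

lemma state_exists:
  assumes x: "norm x = 1"
  obtains f where "(x, f) \<in> state_pairs smul"
proof -
  obtain \<phi> :: "'a \<Rightarrow>\<^sub>L real" where \<phi>: "norm \<phi> \<le> 1" "blinfun_apply \<phi> x = norm x"
    using norming_functional by blast
  obtain f where f: "f \<in> dual_space smul" "\<And>x. re (f x) = blinfun_apply \<phi> x"
    using re_surj[OF blinfun.bounded_linear_right, of \<phi>] by blast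
  have bound: "norm (f y) \<le> 1 * norm y" for y
  proof (rule dual_space_norm_le[OF f(1)])
    show "re (f y) \<le> 1 * norm y" for y
      using blinfun_real_abs_le[OF \<phi>(1), of y] by (simp add: f(2))
  qed
  have "f x = 1" using bound[of x] f(2)[of x] \<phi>(2) x by (intro re_eq_1) auto
  moreover have "onorm f = 1"
  proof (rule antisym)
    show "onorm f \<le> 1" using bound by (rule onorm_bound[rotated]) simp
    show "1 \<le> onorm f"
      using onorm[OF dual_space_bounded_linear[OF f(1)], of x] x \<open>f x = 1\<close> by simp
  qed
  ultimately show ?thesis using f(1) x by (intro that) (auto simp: state_pairs_def)
qed

text \<open>The operators that are linear over \<open>'k\<close>, as a closed subspace of the Banach space of all bounded
  real operators.\<close>

definition equivariant :: "('a \<Rightarrow>\<^sub>L 'a) set" where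
  "equivariant = {T. \<forall>c x. blinfun_apply T (smul c x) = smul c (blinfun_apply T x)}"

lemma equivariant_bounded_operator: "T \<in> equivariant \<Longrightarrow> blinfun_apply T \<in> bounded_operators smul"
  unfolding equivariant_def bounded_operators_def bounded_maps_def Vector_Spaces.linear_iff
  using vector_space_axioms by (auto simp: blinfun.add_right blinfun.bounded_linear_right)

lemma bounded_operator_equivariant: "T \<in> bounded_operators smul \<Longrightarrow> Blinfun T \<in> equivariant \<and> blinfun_apply (Blinfun T) = T"
  unfolding equivariant_def bounded_operators_def bounded_maps_def Vector_Spaces.linear_iff
  by (auto simp: bounded_linear_Blinfun_apply)

lemma smul_scaleR: "smul c (r *\<^sub>R x) = r *\<^sub>R smul c x"
  using scale_left_commute[of c "of_real r" x] by (simp only: smul_of_real)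

lemma subspace_equivariant: "Real_Vector_Spaces.subspace equivariant"
  by (auto simp: real_vector.subspace_def equivariant_def blinfun.add_left blinfun.scaleR_left scale_right_distrib smul_scaleR)

lemma bounded_linear_smul: "bounded_linear (smul c)"
  by (rule bounded_linear_intro[where K = "norm c"]) (auto simp: scale_right_distrib norm_smul mult.commute smul_scaleR)

lemma closed_equivariant: "closed equivariant"
proof -
  have "closed {T :: 'a \<Rightarrow>\<^sub>L 'a. blinfun_apply T (smul c x) = smul c (blinfun_apply T x)}" for c x
    by (intro closed_Collect_eq continuous_intros bounded_linear.continuous_on[OF bounded_linear_smul])
  then have "closed (\<Inter>c. \<Inter>x. {T :: 'a \<Rightarrow>\<^sub>L 'a. blinfun_apply T (smul c x) = smul c (blinfun_apply T x)})"
    by blast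
  then show ?thesis by (simp add: equivariant_def Collect_all_eq)
qed

lemma numerical_radius_attained:
  assumes NRA: "bounded_operators smul = NRA smul" and T: "T \<in> equivariant"
  obtains x f where "(x, f) \<in> state_pairs smul"
    "\<And>x' f'. (x', f') \<in> state_pairs smul \<Longrightarrow> norm (f' (blinfun_apply T x')) \<le> norm (f (blinfun_apply T x))"
proof -
  have "blinfun_apply T \<in> NRA smul" using equivariant_bounded_operator[OF T] NRA by simp
  then obtain x f where xf: "(x, f) \<in> state_pairs smul"
    "numerical_radius smul (blinfun_apply T) = norm (f (blinfun_apply T x))"
    by (auto simp: NRA_def)
  have "norm (f' (blinfun_apply T x')) \<le> norm T" if "(x', f') \<in> state_pairs smul" for x' f'
    using state_pairsD(4)[OF that, of "blinfun_apply T x'"] norm_blinfun[of T x'] state_pairsD(1)[OF that] by simp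
  then have bdd: "bdd_above ((\<lambda>(x, f). norm (f (blinfun_apply T x))) ` state_pairs smul)"
    by (intro bdd_aboveI[of _ "norm T"]) auto
  have "norm (f' (blinfun_apply T x')) \<le> norm (f (blinfun_apply T x))" if "(x', f') \<in> state_pairs smul" for x' f'
    using cSUP_upper[OF that bdd] xf(2) by (simp add: numerical_radius_def)
  with xf(1) that show ?thesis by blast
qed

section \<open>Reflexivity\<close>

text \<open>For the operator \<open>x \<mapsto> f' x * y0\<close> the value at a state pair \<open>(x, f)\<close> is \<open>f' x * f y0\<close>. Of the two
  points \<open>y0 + w / 4\<close> and \<open>y0 - w / 4\<close>, with \<open>w\<close> nearly norming for \<open>g\<close>, one has a large value of \<open>g\<close>; the
  normalised point is still within \<open>1 / 2\<close> of \<open>y0\<close>, so that its supporting functionals are at least \<open>1 / 2\<close>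
  in modulus at \<open>y0\<close>.\<close>

lemma rank_one_numerical_radius:
  assumes y0: "norm y0 = 1" and f': "f' \<in> dual_space smul" "\<And>x. re (f' x) = blinfun_apply g x"
  obtains x f where "(x, f) \<in> state_pairs smul" "norm g \<le> 20 * norm (f' x * f y0)"
proof (cases "norm g = 0")
  case True
  then show ?thesis using state_exists[OF y0] that by (metis mult_nonneg_nonneg norm_ge_zero zero_le_numeral)
next
  case False
  have "\<exists>w. norm w \<le> 1 \<and> norm g / 2 \<le> blinfun_apply g w"
  proof (rule ccontr)
    assume none: "\<not> ?thesis"
    have le: "blinfun_apply g v \<le> norm g / 2 * norm v" for v
    proof (cases "v = 0")
      case False
      then have "norm ((1 / norm v) *\<^sub>R v) \<le> 1" by simp
      with none have "blinfun_apply g ((1 / norm v) *\<^sub>R v) < norm g / 2" by (meson not_le)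
      then show ?thesis using False by (simp add: blinfun.scaleR_right field_simps)
    qed simp
    have "norm (blinfun_apply g v) \<le> norm g / 2 * norm v" for v
      using le[of v] le[of "- v"] by (simp add: blinfun.minus_right abs_le_iff)
    then have "norm g \<le> norm g / 2" by (intro norm_blinfun_bound) auto
    with False show False by simp
  qed
  then obtain w where w: "norm w \<le> 1" "norm g / 2 \<le> blinfun_apply g w" by blast
  have "\<exists>y. norm (y - y0) \<le> 1 / 4 \<and> norm g / 8 \<le> \<bar>blinfun_apply g y\<bar>"
  proof (cases "norm g / 8 \<le> blinfun_apply g (y0 + (1 / 4) *\<^sub>R w)")
    case True
    then show ?thesis using w(1) by (intro exI[of _ "y0 + (1 / 4) *\<^sub>R w"]) auto
  next
    case False
    then have "norm g / 8 \<le> - blinfun_apply g (y0 - (1 / 4) *\<^sub>R w)"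
      using w(2) by (simp add: blinfun.add_right blinfun.diff_right blinfun.scaleR_right)
    also have "\<dots> \<le> \<bar>blinfun_apply g (y0 - (1 / 4) *\<^sub>R w)\<bar>" by (rule abs_ge_minus_self)
    finally show ?thesis using w(1) by (intro exI[of _ "y0 - (1 / 4) *\<^sub>R w"]) auto
  qed
  then obtain y where y: "norm (y - y0) \<le> 1 / 4" "norm g / 8 \<le> \<bar>blinfun_apply g y\<bar>" by blast
  have ny: "3 / 4 \<le> norm y" "norm y \<le> 5 / 4"
    using y(1) y0 norm_triangle_ineq2[of y0 y] norm_triangle_ineq2[of y y0] by (auto simp: norm_minus_commute)
  define x where "x = (1 / norm y) *\<^sub>R y"
  have "y \<noteq> 0" using ny by auto
  then have x: "norm x = 1" by (simp add: x_def)
  have "norm (x - y) = \<bar>1 / norm y - 1\<bar> * norm y"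
    unfolding x_def by (metis norm_scaleR scaleR_left_diff_distrib scaleR_one)
  also have "\<dots> = \<bar>1 - norm y\<bar>"
    using abs_mult[of "1 / norm y - 1" "norm y"] \<open>y \<noteq> 0\<close> by (simp add: left_diff_distrib)
  also have "\<dots> \<le> 1 / 4" by (rule abs_leI) (use ny in simp_all)
  finally have xy0: "norm (x - y0) \<le> 1 / 2"
    using y(1) norm_triangle_ineq[of "x - y" "y - y0"] by simp
  obtain f where f: "(x, f) \<in> state_pairs smul" using state_exists[OF x] .
  have "f x - f y0 = f (x - y0)"
    using linear_diff[OF bounded_linear.linear[OF dual_space_bounded_linear[OF state_pairsD(2)[OF f]]]] by simp
  then have "norm (1 - f y0) \<le> 1 / 2"
    using state_pairsD(4)[OF f, of "x - y0"] state_pairsD(3)[OF f] xy0 by simp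
  then have fy0: "1 / 2 \<le> norm (f y0)"
    using norm_triangle_ineq2[of 1 "f y0"] by simp
  have "norm g / 8 \<le> norm y * \<bar>blinfun_apply g x\<bar>"
    using y(2) \<open>y \<noteq> 0\<close> by (simp add: x_def blinfun.scaleR_right abs_mult)
  also have "\<dots> \<le> 5 / 4 * norm (f' x)"
    using ny abs_re_le[of "f' x"] by (intro mult_mono) (auto simp: f'(2))
  finally have "norm g \<le> 10 * norm (f' x)" by simp
  also have "norm (f' x) \<le> norm (f' x) * (2 * norm (f y0))"
    using mult_left_mono[of 1 "2 * norm (f y0)" "norm (f' x)"] fy0 by simp
  finally show ?thesis using f by (intro that) (simp_all add: norm_mult)
qed

text \<open>James's principle in the dual space, with \<open>\<Gamma>\<close> the functionals \<open>g \<mapsto> re (l * f' x * f y0)\<close> induced by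
  rank one operators, where \<open>f'\<close> is the functional with real part \<open>g\<close>. Each of them is the evaluation of
  \<open>g\<close> at a multiple of \<open>x\<close>. Since \<open>sup \<Gamma>\<close> is equivalent to the norm, a multiple of every \<open>z\<close> in the bidual
  is dominated, and \<open>z\<close> lies in the closure of the evaluations. Banach limits provide cluster points
  in the dual space.\<close>

theorem reflexive_if_NRA:
  fixes z :: "('a \<Rightarrow>\<^sub>L real) \<Rightarrow>\<^sub>L real"
  assumes NRA: "bounded_operators smul = NRA smul" and y0: "norm (y0 :: 'a) = 1"
  obtains x where "\<And>g. blinfun_apply z g = blinfun_apply g x"
proof -
  define \<Gamma> where "\<Gamma> = {ev (smul (l * f y0) x) | l f x. (x, f) \<in> state_pairs smul \<and> norm l = 1}"
  have \<Gamma>_ball: "\<Gamma> \<subseteq> cball 0 1"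
  proof
    fix \<gamma> assume "\<gamma> \<in> \<Gamma>"
    then obtain l f x where g: "\<gamma> = ev (smul (l * f y0) x)" "(x, f) \<in> state_pairs smul" "norm l = 1"
      by (auto simp: \<Gamma>_def)
    have "norm \<gamma> \<le> norm (smul (l * f y0) x)" unfolding g(1) by (rule norm_ev_le)
    also have "\<dots> \<le> 1"
      using state_pairsD(1)[OF g(2)] state_pairsD(4)[OF g(2), of y0] g(3) y0 by (simp add: norm_smul norm_mult)
    finally show "\<gamma> \<in> cball 0 1" by simp
  qed
  define cx where "cx = (\<lambda>g :: 'a \<Rightarrow>\<^sub>L real. SOME f. f \<in> dual_space smul \<and> (\<forall>x. re (f x) = blinfun_apply g x))"
  have "\<exists>f. f \<in> dual_space smul \<and> (\<forall>x. re (f x) = blinfun_apply g x)" for g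
    using re_surj[OF blinfun.bounded_linear_right, of g] by blast
  from someI_ex[OF this]
  have cx: "cx g \<in> dual_space smul" and re_cx: "re (cx g x) = blinfun_apply g x" for g x
    unfolding cx_def by blast+
  have ev_value: "blinfun_apply (ev (smul (l * f y0) x)) g = re (l * (cx g x * f y0))" for g x f l
    by (simp add: dual_space_scale[OF cx] mult_ac flip: re_cx)
  define op where "op = (\<lambda>g. Blinfun (\<lambda>x. smul (cx g x) y0))"
  have op: "blinfun_apply (op g) x = smul (cx g x) y0" for g x
  proof -
    have "bounded_linear (\<lambda>x. smul (cx g x) y0)"
    proof (rule bounded_linear_intro[where K = "onorm (cx g)"])
      show "smul (cx g (x + y)) y0 = smul (cx g x) y0 + smul (cx g y) y0" for x y
        using linear_add[OF bounded_linear.linear[OF dual_space_bounded_linear[OF cx]]]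
        by (simp add: scale_left_distrib)
      show "smul (cx g (r *\<^sub>R x)) y0 = r *\<^sub>R smul (cx g x) y0" for r x
        by (simp only: smul_of_real[symmetric] dual_space_scale[OF cx] scale_scale)
      show "norm (smul (cx g x) y0) \<le> norm x * onorm (cx g)" for x
        using onorm[OF dual_space_bounded_linear[OF cx], of g x] y0 by (simp add: norm_smul mult.commute)
    qed
    then show ?thesis by (simp add: op_def bounded_linear_Blinfun_apply)
  qed
  have op_equivariant: "op g \<in> equivariant" for g
    unfolding equivariant_def by (simp add: op dual_space_scale[OF cx])
  have op_state: "f (blinfun_apply (op g) x) = cx g x * f y0" if "(x, f) \<in> state_pairs smul" for g x f
    by (simp add: op dual_space_scale[OF state_pairsD(2)[OF that]])
  have cluster: "has_cluster_points \<Gamma> UNIV"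
    unfolding has_cluster_points_def
  proof (intro allI impI)
    fix h :: "nat \<Rightarrow> 'a \<Rightarrow>\<^sub>L real" assume h: "\<forall>n. h n \<in> UNIV \<and> norm (h n) \<le> 1"
    obtain L where "banach_limit L" using banach_limit_exists ..
    note L = banach_limitD[OF this]
    have abs: "\<bar>blinfun_apply (h n) x\<bar> \<le> norm x" for n x using h by (intro blinfun_real_abs_le) auto
    then have bdd: "bounded (range (\<lambda>n. blinfun_apply (h n) x))" for x
      by (intro boundedI[of _ "norm x"]) auto
    have "linear (\<lambda>x. L (\<lambda>n. blinfun_apply (h n) x))"
      by (intro linearI) (simp_all add: blinfun.add_right blinfun.scaleR_right L(2)[OF bdd] L(1)[OF bdd bdd])
    moreover have "L (\<lambda>n. blinfun_apply (h n) x) \<le> 1 * norm x" for x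
      using abs by (intro L(4)[OF bdd]) (auto simp: abs_le_iff)
    ultimately obtain F :: "'a \<Rightarrow>\<^sub>L real" where F: "\<And>x. blinfun_apply F x = L (\<lambda>n. blinfun_apply (h n) x)"
      using linear_le_norm_blinfun[of "\<lambda>x. L (\<lambda>n. blinfun_apply (h n) x)" 1] by (metis zero_le_one)
    show "\<exists>F\<in>UNIV. \<forall>\<gamma>\<in>\<Gamma>. \<forall>c.
      ((\<forall>\<^sub>F n in sequentially. c \<le> blinfun_apply \<gamma> (h n)) \<longrightarrow> c \<le> blinfun_apply \<gamma> F) \<and>
      ((\<forall>\<^sub>F n in sequentially. blinfun_apply \<gamma> (h n) \<le> c) \<longrightarrow> blinfun_apply \<gamma> F \<le> c)"
    proof (intro bexI[of _ F] ballI allI conjI impI UNIV_I)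
      fix \<gamma> c assume "\<gamma> \<in> \<Gamma>"
      then obtain x where \<gamma>: "\<gamma> = ev x" by (auto simp: \<Gamma>_def)
      show "c \<le> blinfun_apply \<gamma> F" if "\<forall>\<^sub>F n in sequentially. c \<le> blinfun_apply \<gamma> (h n)"
        using that unfolding \<gamma> ev_apply F by (rule L(3)[OF bdd])
      show "blinfun_apply \<gamma> F \<le> c" if "\<forall>\<^sub>F n in sequentially. blinfun_apply \<gamma> (h n) \<le> c"
        using that unfolding \<gamma> ev_apply F by (rule L(4)[OF bdd])
    qed
  qed
  have attain: "\<exists>\<gamma>\<in>\<Gamma>. \<forall>\<gamma>'\<in>\<Gamma>. blinfun_apply \<gamma>' g \<le> blinfun_apply \<gamma> g" for g
  proof -
    obtain x f where xf: "(x, f) \<in> state_pairs smul"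
      "\<And>x' f'. (x', f') \<in> state_pairs smul \<Longrightarrow> norm (f' (blinfun_apply (op g) x')) \<le> norm (f (blinfun_apply (op g) x))"
      using numerical_radius_attained[OF NRA op_equivariant] by blast
    obtain l where l: "norm l = 1" "re (l * (cx g x * f y0)) = norm (cx g x * f y0)" using phase by blast
    have "blinfun_apply \<gamma>' g \<le> blinfun_apply (ev (smul (l * f y0) x)) g" if "\<gamma>' \<in> \<Gamma>" for \<gamma>'
    proof -
      from that obtain l1 f1 x1 where g1: "\<gamma>' = ev (smul (l1 * f1 y0) x1)" "(x1, f1) \<in> state_pairs smul" "norm l1 = 1"
        by (auto simp: \<Gamma>_def)
      have "blinfun_apply \<gamma>' g \<le> norm (cx g x1 * f1 y0)"
        using re_le_norm[of "l1 * (cx g x1 * f1 y0)"] unfolding g1(1) ev_value by (simp add: norm_mult g1(3))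
      also have "\<dots> \<le> norm (cx g x * f y0)" using xf(2)[OF g1(2)] by (simp add: op_state g1(2) xf(1))
      finally show ?thesis by (simp only: ev_value l(2))
    qed
    then show ?thesis using xf(1) l(1) by (intro bexI[of _ "ev (smul (l * f y0) x)"]) (auto simp: \<Gamma>_def)
  qed
  define C where "C = 1 / (20 * (norm z + 1))"
  have C: "0 < C" by (simp add: C_def add_nonneg_pos)
  have dom: "\<exists>\<gamma>\<in>\<Gamma>. blinfun_apply (C *\<^sub>R z) g \<le> blinfun_apply \<gamma> g" for g
  proof -
    obtain x f where xf: "(x, f) \<in> state_pairs smul" "norm g \<le> 20 * norm (cx g x * f y0)"
      using rank_one_numerical_radius[OF y0 cx re_cx] by blast
    obtain l where l: "norm l = 1" "re (l * (cx g x * f y0)) = norm (cx g x * f y0)" using phase by blast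
    have "blinfun_apply (C *\<^sub>R z) g \<le> C * (norm z * norm g)"
      using C norm_blinfun[of z g] by (simp add: blinfun.scaleR_left)
    also have "\<dots> \<le> C * ((norm z + 1) * norm g)"
      using C by (intro mult_left_mono mult_right_mono) auto
    also have "\<dots> = norm g / 20"
    proof -
      have "norm z + 1 \<noteq> 0" using norm_ge_zero[of z] by linarith
      then show ?thesis by (simp add: C_def divide_simps)
    qed
    also have "\<dots> \<le> blinfun_apply (ev (smul (l * f y0) x)) g"
      using xf(2) by (simp only: ev_value l(2))
    finally show ?thesis using xf(1) l(1) by (intro bexI[of _ "ev (smul (l * f y0) x)"]) (auto simp: \<Gamma>_def)
  qed
  have "\<exists>x. \<forall>g. \<bar>blinfun_apply (C *\<^sub>R z) g - blinfun_apply g x\<bar> \<le> e * norm g" if e: "0 < e" for e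
  proof -
    obtain u where u: "u \<in> Real_Vector_Spaces.span \<Gamma>" "\<And>g. \<bar>blinfun_apply (C *\<^sub>R z) g - blinfun_apply u g\<bar> \<le> e * norm g"
      using james_approximation[OF \<Gamma>_ball real_vector.subspace_UNIV closed_UNIV cluster attain dom e] by blast
    have "Real_Vector_Spaces.span \<Gamma> \<subseteq> range ev" by (rule real_vector.span_minimal[OF _ subspace_range_ev]) (auto simp: \<Gamma>_def)
    then obtain x where "u = ev x" using u(1) by blast
    with u(2) show ?thesis by auto
  qed
  then obtain x where x: "\<And>g. blinfun_apply (C *\<^sub>R z) g = blinfun_apply g x"
    using closure_ev_range by blast
  show ?thesis
  proof (rule that[of "(1 / C) *\<^sub>R x"])
    show "blinfun_apply z g = blinfun_apply g ((1 / C) *\<^sub>R x)" for g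
      using C by (simp add: blinfun.scaleR_right blinfun.scaleR_left flip: x)
  qed
qed

end

section \<open>Operators bounded below modulo compact ones\<close>

context banach_space_re
begin

lemma finite_span_if_separated:
  assumes "finite G" "G \<subseteq> dual_space smul" "subspace S" "\<And>x. x \<in> S \<Longrightarrow> (\<And>f. f \<in> G \<Longrightarrow> f x = 0) \<Longrightarrow> x = 0"
  shows "\<exists>B. finite B \<and> S \<subseteq> span B"
  using assms
proof (induction G arbitrary: S rule: finite_induct)
  case empty
  then show ?case by (intro exI[of _ "{}"]) auto
next
  case (insert f G)
  have f: "f (smul c x) = c * f x" "f (x - y) = f x - f y" "f (x + y) = f x + f y" "f 0 = 0" for c x y
    using insert.prems(1) dual_space_scale[of f]
      linear_diff[OF bounded_linear.linear[OF dual_space_bounded_linear[of f]]]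
      linear_add[OF bounded_linear.linear[OF dual_space_bounded_linear[of f]]]
      linear_0[OF bounded_linear.linear[OF dual_space_bounded_linear[of f]]] by auto
  let ?S = "{x \<in> S. f x = 0}"
  have "subspace ?S" using insert.prems(2) by (auto simp: subspace_def f)
  then obtain B where B: "finite B" "?S \<subseteq> span B"
    using insert.IH[of ?S] insert.prems by fastforce
  show ?case
  proof (cases "\<exists>a\<in>S. f a \<noteq> 0")
    case False
    then have "S \<subseteq> span B" using B(2) by auto
    with B(1) show ?thesis by blast
  next
    case True
    then obtain a where a: "a \<in> S" "f a \<noteq> 0" by blast
    have "x \<in> span (insert a B)" if x: "x \<in> S" for x
    proof -
      have "x - smul (f x / f a) a \<in> ?S"
        using x a insert.prems(2) by (simp add: f subspace_diff subspace_scale)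
      then have "x - smul (f x / f a) a \<in> span (insert a B)"
        using B(2) span_mono[of B "insert a B"] by blast
      then have "x - smul (f x / f a) a + smul (f x / f a) a \<in> span (insert a B)"
        by (rule span_add) (intro span_scale span_base; simp)
      then show ?thesis by simp
    qed
    with B(1) show ?thesis by (intro exI[of _ "insert a B"]) auto
  qed
qed

text \<open>By compactness of the sphere finitely many functionals have no common zero on it, so they embed
  the space into a finite dimensional one.\<close>

lemma finite_dimensional_if_compact_ball:
  assumes "compact (cball 0 1 :: 'a set)"
  shows "finite_dimensional smul"
proof -
  have sphere: "compact (sphere 0 1 :: 'a set)"
  proof -
    have "closed (sphere 0 1 :: 'a set)"
      unfolding sphere_def by (intro closed_Collect_eq continuous_intros)
    from compact_Int_closed[OF assms this] show ?thesis by (simp add: Int_absorb1 sphere_cball)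
  qed
  have op: "open {y. f y \<noteq> 0}" if "f \<in> dual_space smul" for f
    using linear_continuous_on[OF dual_space_bounded_linear[OF that], of UNIV]
    by (intro open_Collect_neq continuous_on_const)
  have cover: "sphere 0 1 \<subseteq> (\<Union>f\<in>dual_space smul. {y. f y \<noteq> 0})"
  proof
    fix x :: 'a assume "x \<in> sphere 0 1"
    then have "norm x = 1" by simp
    then obtain f where f: "(x, f) \<in> state_pairs smul" by (rule state_exists)
    show "x \<in> (\<Union>f\<in>dual_space smul. {y. f y \<noteq> 0})"
      using state_pairsD(2,3)[OF f] by (intro UN_I[of f]) auto
  qed
  obtain G where G: "G \<subseteq> dual_space smul" "finite G" "sphere 0 1 \<subseteq> (\<Union>f\<in>G. {y. f y \<noteq> 0})"
    by (rule compactE_image[OF sphere op cover])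
  have "x = 0" if "\<And>f. f \<in> G \<Longrightarrow> f x = 0" for x
  proof (rule ccontr)
    assume "x \<noteq> 0"
    then have "(1 / norm x) *\<^sub>R x \<in> sphere 0 1" by simp
    then obtain f where f: "f \<in> G" "f ((1 / norm x) *\<^sub>R x) \<noteq> 0" using G(3) by blast
    then show False
      using that[OF f(1)] G(1) linear_scale[OF bounded_linear.linear[OF dual_space_bounded_linear[of f]]] by auto
  qed
  then obtain B where B: "finite B" "UNIV \<subseteq> span B"
    using finite_span_if_separated[OF G(2,1) subspace_UNIV] by auto
  obtain C where C: "C \<subseteq> B" "independent C" "B \<subseteq> span C"
    using maximal_independent_subset by blast
  have "span C = UNIV" using span_mono[OF C(3)] B(2) by (auto simp: span_span)
  then have "finite_dimensional_vector_space smul C"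
    using C finite_subset[OF C(1) B(1)] by unfold_locales auto
  then show ?thesis by (auto simp: finite_dimensional_def)
qed

definition compacts :: "('a \<Rightarrow>\<^sub>L 'a) set" where
  "compacts = {T \<in> equivariant. compact (closure (blinfun_apply T ` cball 0 1))}"

lemma compacts_if_subset_compact:
  assumes "T \<in> equivariant" "blinfun_apply T ` cball 0 1 \<subseteq> C" "compact C"
  shows "T \<in> compacts"
proof -
  have sub: "closure (blinfun_apply T ` cball 0 1) \<subseteq> C"
    using assms(2,3) by (intro closure_minimal compact_imp_closed)
  then have "compact (C \<inter> closure (blinfun_apply T ` cball 0 1))"
    using assms(3) by (intro compact_Int_closed closed_closure)
  with sub assms(1) show ?thesis by (simp add: compacts_def Int_absorb1)
qed

lemma subspace_compacts: "Real_Vector_Spaces.subspace compacts"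
  unfolding real_vector.subspace_def
proof (intro conjI ballI allI)
  show "0 \<in> compacts"
    by (rule compacts_if_subset_compact[of _ "{0}"]) (use subspace_equivariant in \<open>auto simp: real_vector.subspace_def\<close>)
  fix S assume S: "S \<in> compacts"
  show "r *\<^sub>R S \<in> compacts" for r
  proof (rule compacts_if_subset_compact)
    show "r *\<^sub>R S \<in> equivariant" using S subspace_equivariant by (simp add: compacts_def real_vector.subspace_def)
    show "compact ((*\<^sub>R) r ` closure (blinfun_apply S ` cball 0 1))"
      using S by (intro compact_scaling) (simp add: compacts_def)
    show "blinfun_apply (r *\<^sub>R S) ` cball 0 1 \<subseteq> (*\<^sub>R) r ` closure (blinfun_apply S ` cball 0 1)"
      using closure_subset by (fastforce simp: blinfun.scaleR_left)
  qed
  fix T assume T: "T \<in> compacts"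
  show "S + T \<in> compacts"
  proof (rule compacts_if_subset_compact)
    show "S + T \<in> equivariant" using S T subspace_equivariant by (simp add: compacts_def real_vector.subspace_def)
    show "compact {x + y | x y. x \<in> closure (blinfun_apply S ` cball 0 1) \<and> y \<in> closure (blinfun_apply T ` cball 0 1)}"
      using S T by (intro compact_sums) (simp_all add: compacts_def)
    show "blinfun_apply (S + T) ` cball 0 1
        \<subseteq> {x + y | x y. x \<in> closure (blinfun_apply S ` cball 0 1) \<and> y \<in> closure (blinfun_apply T ` cball 0 1)}"
    proof (intro image_subsetI CollectI exI conjI)
      fix x :: 'a assume x: "x \<in> cball 0 1"
      show "blinfun_apply (S + T) x = blinfun_apply S x + blinfun_apply T x" by (rule blinfun.add_left)
      show "blinfun_apply S x \<in> closure (blinfun_apply S ` cball 0 1)"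
        "blinfun_apply T x \<in> closure (blinfun_apply T ` cball 0 1)"
        using closure_subset imageI[OF x] by fast+
    qed
  qed
qed

lemma finite_dimensional_if_compact_bounded_below:
  assumes T: "T \<in> compacts" and d: "0 < d" and below: "\<And>x. norm x = 1 \<Longrightarrow> d \<le> norm (blinfun_apply T x)"
  shows "finite_dimensional smul"
proof (rule finite_dimensional_if_compact_ball)
  have below': "d * norm x \<le> norm (blinfun_apply T x)" for x
  proof (cases "x = 0")
    case False
    then show ?thesis
      using below[of "(1 / norm x) *\<^sub>R x"] by (simp add: blinfun.scaleR_right field_simps)
  qed simp
  have "seq_compact (cball 0 1 :: 'a set)"
    unfolding seq_compact_def
  proof (intro allI impI)
    fix x :: "nat \<Rightarrow> 'a" assume x: "\<forall>n. x n \<in> cball 0 1"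
    have cpt: "compact (closure (blinfun_apply T ` cball 0 1))" using T by (simp add: compacts_def)
    have "\<forall>n. blinfun_apply T (x n) \<in> closure (blinfun_apply T ` cball 0 1)"
      using x closure_subset by blast
    then obtain l r where r: "strict_mono r" "((\<lambda>n. blinfun_apply T (x n)) \<circ> r) \<longlonglongrightarrow> l"
      by (rule seq_compactE[OF compact_imp_seq_compact[OF cpt]])
    have "Cauchy (x \<circ> r)"
    proof (rule metric_CauchyI)
      fix e :: real assume "0 < e"
      then have "0 < d * e" using d by simp
      from metric_CauchyD[OF LIMSEQ_imp_Cauchy[OF r(2)] this]
      obtain M where M: "\<forall>m\<ge>M. \<forall>n\<ge>M. dist (blinfun_apply T (x (r m))) (blinfun_apply T (x (r n))) < d * e"
        by (auto simp: o_def)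
      have "dist ((x \<circ> r) m) ((x \<circ> r) n) < e" if "M \<le> m" "M \<le> n" for m n
      proof -
        have "d * norm (x (r m) - x (r n)) < d * e"
          using below'[of "x (r m) - x (r n)"] M[rule_format, OF that]
          unfolding dist_norm blinfun.diff_right by linarith
        then show ?thesis using d by (simp add: dist_norm)
      qed
      then show "\<exists>M. \<forall>m\<ge>M. \<forall>n\<ge>M. dist ((x \<circ> r) m) ((x \<circ> r) n) < e" by blast
    qed
    then obtain y where y: "(x \<circ> r) \<longlonglongrightarrow> y" using Cauchy_convergent convergent_def by blast
    moreover have "y \<in> cball 0 1" by (rule closed_sequentially[OF closed_cball _ y]) (use x in auto)
    ultimately show "\<exists>l\<in>cball 0 1. \<exists>r. strict_mono r \<and> (x \<circ> r) \<longlonglongrightarrow> l" using r(1) by blast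
  qed
  then show "compact (cball 0 1 :: 'a set)" by (simp add: compact_eq_seq_compact_metric)
qed

end

section \<open>Numerical states\<close>

definition tensor :: "'a::real_normed_vector \<Rightarrow> ('a \<Rightarrow>\<^sub>L real) \<Rightarrow> ('a \<Rightarrow>\<^sub>L 'a) \<Rightarrow>\<^sub>L real" where
  "tensor x g = Blinfun (\<lambda>T. blinfun_apply g (blinfun_apply T x))"

lemma tensor_apply [simp]: "blinfun_apply (tensor x g) T = blinfun_apply g (blinfun_apply T x)"
  unfolding tensor_def
  by (simp add: bounded_linear_Blinfun_apply
      bounded_linear_compose[OF blinfun.bounded_linear_right blinfun.bounded_linear_left])

lemma tensor_abs_le: "\<bar>blinfun_apply (tensor x g) T\<bar> \<le> norm x * norm g * norm T"
proof -
  have "\<bar>blinfun_apply g (blinfun_apply T x)\<bar> \<le> norm g * norm (blinfun_apply T x)"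
    using norm_blinfun[of g] by simp
  also have "\<dots> \<le> norm g * (norm T * norm x)" by (intro mult_left_mono norm_blinfun) simp
  finally show ?thesis by (simp add: mult_ac)
qed

lemma norm_tensor_le: "norm (tensor x g) \<le> norm x * norm g"
  using tensor_abs_le by (intro norm_blinfun_bound) auto

lemma tensor_bilinear:
  "tensor (x + y) g = tensor x g + tensor y g" "tensor (r *\<^sub>R x) g = r *\<^sub>R tensor x g"
  "tensor x (g + h) = tensor x g + tensor x h" "tensor x (r *\<^sub>R g) = r *\<^sub>R tensor x g"
  "tensor 0 g = 0"
  by (auto intro!: blinfun_eqI simp: blinfun.add_left blinfun.add_right blinfun.scaleR_left blinfun.scaleR_right)

context banach_space_re
begin

text \<open>The functionals whose supremum is the numerical radius. Rotating by \<open>l\<close> turns the modulus in the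
  definition of the numerical radius into a real part.\<close>

definition states :: "(('a \<Rightarrow>\<^sub>L 'a) \<Rightarrow>\<^sub>L real) set" where
  "states = {tensor x g | x g. \<exists>f l. (x, f) \<in> state_pairs smul \<and> norm l = 1 \<and> (\<forall>y. blinfun_apply g y = re (l * f y))}"

lemma stateI:
  assumes "(x, f) \<in> state_pairs smul" "norm l = 1"
  obtains \<gamma> where "\<gamma> \<in> states" "\<And>T. blinfun_apply \<gamma> T = re (l * f (blinfun_apply T x))"
proof -
  note f = linear_add[OF bounded_linear.linear[OF dual_space_bounded_linear[OF state_pairsD(2)[OF assms(1)]]]]
    linear_scale[OF bounded_linear.linear[OF dual_space_bounded_linear[OF state_pairsD(2)[OF assms(1)]]]]
  have "bounded_linear (\<lambda>y. re (l * f y))"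
  proof (rule bounded_linear_intro[where K = 1])
    show "re (l * f (x + y)) = re (l * f x) + re (l * f y)" for x y
      by (simp add: f distrib_left linear_add[OF re_linear])
    show "re (l * f (r *\<^sub>R x)) = r *\<^sub>R re (l * f x)" for r x
      by (simp add: f linear_scale[OF re_linear])
    show "norm (re (l * f y)) \<le> norm y * 1" for y
      using abs_re_le[of "l * f y"] state_pairsD(4)[OF assms(1), of y] assms(2) by (simp add: norm_mult)
  qed
  then have g: "blinfun_apply (Blinfun (\<lambda>y. re (l * f y))) y = re (l * f y)" for y
    by (simp add: bounded_linear_Blinfun_apply)
  show ?thesis
    by (rule that[of "tensor x (Blinfun (\<lambda>y. re (l * f y)))"]) (use assms g in \<open>auto simp: states_def\<close>)
qed

lemma states_ball: "states \<subseteq> cball 0 1"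
proof
  fix \<gamma> assume "\<gamma> \<in> states"
  then obtain x g f l where g: "\<gamma> = tensor x g" "(x, f) \<in> state_pairs smul" "norm l = 1"
    "\<And>y. blinfun_apply g y = re (l * f y)" by (auto simp: states_def)
  have "norm g \<le> 1"
  proof (rule norm_blinfun_bound)
    show "norm (blinfun_apply g y) \<le> 1 * norm y" for y
      using abs_re_le[of "l * f y"] state_pairsD(4)[OF g(2), of y] g(3,4) by (simp add: norm_mult)
  qed simp
  then have "norm \<gamma> \<le> 1" using norm_tensor_le[of x g] state_pairsD(1)[OF g(2)] g(1) by simp
  then show "\<gamma> \<in> cball 0 1" by simp
qed

lemma states_attain:
  assumes NRA: "bounded_operators smul = NRA smul" and T: "T \<in> equivariant"
  shows "\<exists>\<gamma>\<in>states. \<forall>\<gamma>'\<in>states. blinfun_apply \<gamma>' T \<le> blinfun_apply \<gamma> T"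
proof -
  obtain x f where xf: "(x, f) \<in> state_pairs smul"
    "\<And>x' f'. (x', f') \<in> state_pairs smul \<Longrightarrow> norm (f' (blinfun_apply T x')) \<le> norm (f (blinfun_apply T x))"
    using numerical_radius_attained[OF NRA T] by blast
  obtain l where l: "norm l = 1" "re (l * f (blinfun_apply T x)) = norm (f (blinfun_apply T x))" using phase by blast
  obtain \<gamma> where \<gamma>: "\<gamma> \<in> states" "\<And>T. blinfun_apply \<gamma> T = re (l * f (blinfun_apply T x))"
    using stateI[OF xf(1) l(1)] by blast
  have "blinfun_apply \<gamma>' T \<le> blinfun_apply \<gamma> T" if \<gamma>': "\<gamma>' \<in> states" for \<gamma>'
  proof -
    obtain x1 g f1 l1 where g: "\<gamma>' = tensor x1 g" "(x1, f1) \<in> state_pairs smul" "norm l1 = 1"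
      "\<And>y. blinfun_apply g y = re (l1 * f1 y)" using \<gamma>' by (auto simp: states_def)
    have "blinfun_apply \<gamma>' T \<le> norm (f1 (blinfun_apply T x1))"
      using re_le_norm[of "l1 * f1 (blinfun_apply T x1)"] g(1,3,4) by (simp add: norm_mult)
    also have "\<dots> \<le> blinfun_apply \<gamma> T" using xf(2)[OF g(2)] l(2) \<gamma>(2) by simp
    finally show ?thesis .
  qed
  with \<gamma>(1) show ?thesis by blast
qed

lemma states_uminus: "\<gamma> \<in> states \<Longrightarrow> - \<gamma> \<in> states"
proof -
  assume "\<gamma> \<in> states"
  then obtain x g f l where g: "\<gamma> = tensor x g" "(x, f) \<in> state_pairs smul" "norm l = 1"
    "\<And>y. blinfun_apply g y = re (l * f y)" by (auto simp: states_def)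
  have "- \<gamma> = tensor x (- g)" unfolding g(1) by (auto intro!: blinfun_eqI simp: blinfun.minus_left)
  moreover have "blinfun_apply (- g) y = re (- l * f y)" for y
    using linear_neg[OF re_linear, of "l * f y"] by (simp add: blinfun.minus_left g(4))
  ultimately show ?thesis using g(2,3) unfolding states_def by (auto intro!: exI[of _ x] exI[of _ "- g"] exI[of _ f] exI[of _ "- l"])
qed

text \<open>The numerical radius of \<open>I - K\<close> is at least 1 for compact \<open>K\<close>: otherwise all state values of \<open>K\<close>
  would have real part bounded away from 0, and \<open>K\<close> would be bounded below. The functional is then
  obtained from the constraints \<open>\<Phi> (K - t I) \<le> - t\<close> for compact \<open>K\<close> and \<open>t \<ge> 0\<close>.\<close>

lemma functional_vanishing_on_compacts:
  assumes NRA: "bounded_operators smul = NRA smul" and inf: "\<not> finite_dimensional smul" and y0: "norm (y0 :: 'a) = 1"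
  obtains \<Phi> where "blinfun_apply \<Phi> id_blinfun \<ge> 1" "\<And>T. T \<in> compacts \<Longrightarrow> blinfun_apply \<Phi> T = 0"
    "\<And>T. T \<in> equivariant \<Longrightarrow> \<exists>\<gamma>\<in>states. blinfun_apply \<Phi> T \<le> blinfun_apply \<gamma> T"
    "norm \<Phi> \<le> 1"
proof -
  define p where "p = (\<lambda>T. SUP \<gamma>\<in>states. blinfun_apply \<gamma> T)"
  obtain f0 where f0: "(y0, f0) \<in> state_pairs smul" using state_exists[OF y0] .
  obtain \<gamma>0 where \<gamma>0: "\<gamma>0 \<in> states" using stateI[OF f0, of 1] by auto
  have abs: "\<bar>blinfun_apply \<gamma> T\<bar> \<le> norm T" if "\<gamma> \<in> states" for \<gamma> T
    using that states_ball by (intro blinfun_real_abs_le) auto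
  have bdd: "bdd_above ((\<lambda>\<gamma>. blinfun_apply \<gamma> T) ` states)" for T
    using abs by (intro bdd_aboveI[of _ "norm T"]) (auto simp: abs_le_iff)
  have p_ge: "blinfun_apply \<gamma> T \<le> p T" if "\<gamma> \<in> states" for \<gamma> T
    unfolding p_def by (rule cSUP_upper[OF that bdd])
  have p_le: "p T \<le> m" if "\<And>\<gamma>. \<gamma> \<in> states \<Longrightarrow> blinfun_apply \<gamma> T \<le> m" for T m
    unfolding p_def using \<gamma>0 that by (intro cSUP_least) auto
  have p_nonneg: "0 \<le> p T" for T
    using p_ge[OF \<gamma>0, of T] p_ge[OF states_uminus[OF \<gamma>0], of T] by (simp add: blinfun.minus_left)
  have p: "sublinear p"
  proof (rule sublinearI)
    show "p (S + T) \<le> p S + p T" for S T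
      using p_ge[of _ S] p_ge[of _ T] by (intro p_le) (auto simp: blinfun.add_right intro: add_mono)
    show "p (c *\<^sub>R T) \<le> c * p T" if "0 < c" for c T
      using p_ge[of _ T] that by (intro p_le) (auto simp: blinfun.scaleR_right)
    show "p 0 = 0" using p_nonneg[of 0] p_le[of 0 0] by auto
  qed
  have far: "1 \<le> p (id_blinfun - K)" if K: "K \<in> compacts" for K
  proof (rule ccontr)
    assume near: "\<not> ?thesis"
    have "1 - p (id_blinfun - K) \<le> norm (blinfun_apply K x)" if x: "norm x = 1" for x
    proof -
      obtain f where f: "(x, f) \<in> state_pairs smul" using state_exists[OF x] .
      obtain l where l: "norm l = 1" "re (l * 1) = norm (1 :: 'k)" using phase by blast
      \<comment> \<open>This only serves to see that \<open>re 1 = 1\<close>.\<close>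
      then have "l = 1" by (intro re_eq_1) auto
      obtain \<gamma> where \<gamma>: "\<gamma> \<in> states" "\<And>T. blinfun_apply \<gamma> T = re (1 * f (blinfun_apply T x))"
        using stateI[OF f, of 1] by auto
      have "blinfun_apply \<gamma> id_blinfun = 1" using \<gamma>(2)[of id_blinfun] state_pairsD(3)[OF f] l \<open>l = 1\<close> by simp
      moreover have "blinfun_apply \<gamma> K \<le> norm (blinfun_apply K x)"
        using \<gamma>(2)[of K] re_le_norm[of "f (blinfun_apply K x)"] state_pairsD(4)[OF f, of "blinfun_apply K x"] by simp
      ultimately show ?thesis using p_ge[OF \<gamma>(1), of "id_blinfun - K"] by (simp add: blinfun.diff_right)
    qed
    with near inf show False
      using finite_dimensional_if_compact_bounded_below[OF K, of "1 - p (id_blinfun - K)"] by simp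
  qed
  define R where "R = {(K - t *\<^sub>R id_blinfun, - t) | K t. K \<in> compacts \<and> 0 \<le> t}"
  have R_I: "(K - t *\<^sub>R id_blinfun, - t) \<in> R" if "K \<in> compacts" "0 \<le> t" for K t using that by (auto simp: R_def)
  have K0: "0 \<in> compacts" and K_add: "\<And>S T. S \<in> compacts \<Longrightarrow> T \<in> compacts \<Longrightarrow> S + T \<in> compacts"
    and K_scale: "\<And>r T. T \<in> compacts \<Longrightarrow> r *\<^sub>R T \<in> compacts"
    using subspace_compacts by (auto simp: real_vector.subspace_def)
  have cone: "constraint_cone R"
    unfolding constraint_cone_def
  proof (intro conjI allI impI)
    show "(0, 0) \<in> R" using R_I[OF K0, of 0] by simp
    show "(s + s', c + c') \<in> R" if sc: "(s, c) \<in> R" "(s', c') \<in> R" for s c s' c'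
    proof -
      from sc obtain K t K' t' where K: "K \<in> compacts" "0 \<le> t" "K' \<in> compacts" "0 \<le> t'"
        "s = K - t *\<^sub>R id_blinfun" "c = - t" "s' = K' - t' *\<^sub>R id_blinfun" "c' = - t'" by (auto simp: R_def)
      show ?thesis
        using R_I[OF K_add[OF K(1,3)], of "t + t'"] K(2,4) unfolding K(5-8) by (simp add: algebra_simps)
    qed
    show "(u *\<^sub>R s, u * c) \<in> R" if u: "0 < u" "(s, c) \<in> R" for u s c
    proof -
      from u obtain K t where K: "K \<in> compacts" "0 \<le> t" "s = K - t *\<^sub>R id_blinfun" "c = - t" by (auto simp: R_def)
      show ?thesis
        using R_I[OF K_scale[OF K(1), of u], of "u * t"] K(2) u(1) unfolding K(3,4) by (simp add: algebra_simps)
    qed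
  qed
  have "\<forall>(s, c)\<in>R. - p (- s) \<le> c"
  proof clarify
    fix s c assume "(s, c) \<in> R"
    then obtain K t where K: "K \<in> compacts" "0 \<le> t" "s = K - t *\<^sub>R id_blinfun" "c = - t" by (auto simp: R_def)
    have "t \<le> p (t *\<^sub>R id_blinfun - K)"
    proof (cases "t = 0")
      case False
      have "t * 1 \<le> t * p (id_blinfun - (1 / t) *\<^sub>R K)"
        using far[OF K_scale[OF K(1)], of "1 / t"] K(2) by (intro mult_left_mono) auto
      also have "\<dots> = p (t *\<^sub>R (id_blinfun - (1 / t) *\<^sub>R K))" using K(2) by (simp add: sublinear_scale[OF p])
      also have "t *\<^sub>R (id_blinfun - (1 / t) *\<^sub>R K) = t *\<^sub>R id_blinfun - K"
        using False by (simp add: scaleR_diff_right)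
      finally show ?thesis by simp
    qed (use p_nonneg in simp)
    then show "- p (- s) \<le> c" using K by simp
  qed
  from mazur_orlicz[OF p cone this]
  obtain \<beta> where \<beta>: "linear \<beta>" "\<forall>T. \<beta> T \<le> p T" "\<forall>(s, c)\<in>R. \<beta> s \<le> c"
    by (elim exE conjE)
  have \<beta>_R: "\<beta> s \<le> c" if "(s, c) \<in> R" for s c using \<beta>(3) that by blast
  have "\<beta> T \<le> 1 * norm T" for T
    using \<beta>(2)[rule_format, of T] p_le[of T "norm T"] abs by (force simp: abs_le_iff)
  then obtain \<Phi> :: "('a \<Rightarrow>\<^sub>L 'a) \<Rightarrow>\<^sub>L real" where \<Phi>: "\<And>T. blinfun_apply \<Phi> T = \<beta> T" "norm \<Phi> \<le> 1"
    using linear_le_norm_blinfun[OF \<beta>(1), of 1] by auto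
  show ?thesis
  proof (rule that)
    show "1 \<le> blinfun_apply \<Phi> id_blinfun"
      using \<beta>_R[OF R_I[OF K0, of 1]] linear_neg[OF \<beta>(1), of id_blinfun] by (simp add: \<Phi>(1))
    show "blinfun_apply \<Phi> T = 0" if T: "T \<in> compacts" for T
      using \<beta>_R[OF R_I[OF T, of 0]] \<beta>_R[OF R_I[OF K_scale[OF T, of "- 1"], of 0]]
        linear_neg[OF \<beta>(1), of T] by (simp add: \<Phi>(1))
    show "\<exists>\<gamma>\<in>states. blinfun_apply \<Phi> T \<le> blinfun_apply \<gamma> T" if T: "T \<in> equivariant" for T
    proof -
      obtain \<gamma> where \<gamma>: "\<gamma> \<in> states" "\<And>\<gamma>'. \<gamma>' \<in> states \<Longrightarrow> blinfun_apply \<gamma>' T \<le> blinfun_apply \<gamma> T"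
        using states_attain[OF NRA T] by blast
      then have "\<beta> T \<le> blinfun_apply \<gamma> T" using \<beta>(2)[rule_format, of T] p_le[of T] by force
      with \<gamma>(1) show ?thesis by (auto simp: \<Phi>)
    qed
    show "norm \<Phi> \<le> 1" by (rule \<Phi>(2))
  qed
qed

end

section \<open>Nuclear representation and compact approximation\<close>

lemma functionals_separate:
  fixes x y :: "'a::real_normed_vector"
  assumes "\<And>g :: 'a \<Rightarrow>\<^sub>L real. blinfun_apply g x = blinfun_apply g y"
  shows "x = y"
proof -
  obtain \<phi> :: "'a \<Rightarrow>\<^sub>L real" where "blinfun_apply \<phi> (x - y) = norm (x - y)"
    using norming_functional by blast
  then show ?thesis using assms[of \<phi>] by (simp add: blinfun.diff_right)
qed

definition tensor_ball :: "(('a::real_normed_vector \<Rightarrow>\<^sub>L 'a) \<Rightarrow>\<^sub>L real) set" where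
  "tensor_ball = {tensor x g | x g. norm x \<le> 1 \<and> norm g \<le> 1}"

text \<open>Elements of the convex hull are controlled by finitely many points of the unit ball. These points
  enter the compact set to which the approximation property is applied.\<close>

lemma tensor_ball_hull_support:
  fixes u :: "('a::real_normed_vector \<Rightarrow>\<^sub>L 'a) \<Rightarrow>\<^sub>L real"
  assumes "u \<in> convex hull tensor_ball"
  shows "\<exists>F. finite F \<and> F \<subseteq> cball 0 1 \<and>
    (\<forall>T d. (\<forall>x\<in>F. norm (blinfun_apply T x) \<le> d) \<longrightarrow> 0 \<le> d \<longrightarrow> \<bar>blinfun_apply u T\<bar> \<le> d)"
proof -
  define controls where "controls = (\<lambda>F (u :: ('a \<Rightarrow>\<^sub>L 'a) \<Rightarrow>\<^sub>L real).
    \<forall>T d. (\<forall>x\<in>F. norm (blinfun_apply T x) \<le> d) \<longrightarrow> 0 \<le> d \<longrightarrow> \<bar>blinfun_apply u T\<bar> \<le> d)"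
  let ?U = "{u. \<exists>F. finite F \<and> F \<subseteq> cball 0 1 \<and> controls F u}"
  have "tensor_ball \<subseteq> ?U"
  proof
    fix v :: "('a \<Rightarrow>\<^sub>L 'a) \<Rightarrow>\<^sub>L real" assume "v \<in> tensor_ball"
    then obtain x g where v: "v = tensor x g" "norm x \<le> 1" "norm g \<le> 1" by (auto simp: tensor_ball_def)
    have "controls {x} v"
      unfolding controls_def v(1) using blinfun_real_abs_le[OF v(3)] by (auto intro: order_trans)
    with v(2) show "v \<in> ?U" by (auto intro!: exI[of _ "{x}"])
  qed
  moreover have "convex ?U"
  proof (rule convexI)
    fix v w and a b :: real assume "v \<in> ?U" "w \<in> ?U" and ab: "0 \<le> a" "0 \<le> b" "a + b = 1"
    then obtain F G where FG: "finite F" "F \<subseteq> cball 0 1" "controls F v" "finite G" "G \<subseteq> cball 0 1" "controls G w"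
      by blast
    have "controls (F \<union> G) (a *\<^sub>R v + b *\<^sub>R w)"
      unfolding controls_def
    proof (intro allI impI)
      fix T :: "'a \<Rightarrow>\<^sub>L 'a" and d assume d: "\<forall>x\<in>F \<union> G. norm (blinfun_apply T x) \<le> d" "0 \<le> d"
      then have "\<bar>blinfun_apply v T\<bar> \<le> d" "\<bar>blinfun_apply w T\<bar> \<le> d"
        using FG(3,6) unfolding controls_def by blast+
      then have "a * \<bar>blinfun_apply v T\<bar> + b * \<bar>blinfun_apply w T\<bar> \<le> a * d + b * d"
        using ab by (intro add_mono mult_left_mono)
      also have "\<dots> = d" using ab(3) by (metis distrib_right mult_1)
      finally show "\<bar>blinfun_apply (a *\<^sub>R v + b *\<^sub>R w) T\<bar> \<le> d"
        using abs_triangle_ineq[of "a * blinfun_apply v T" "b * blinfun_apply w T"] ab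
        by (simp add: blinfun.add_left blinfun.scaleR_left abs_mult)
    qed
    then show "a *\<^sub>R v + b *\<^sub>R w \<in> ?U" using FG by (intro CollectI exI[of _ "F \<union> G"]) auto
  qed
  ultimately have "convex hull tensor_ball \<subseteq> ?U" by (rule hull_minimal)
  with assms show ?thesis unfolding controls_def by blast
qed

lemma compact_null_sequence_of_finite_sets:
  fixes F :: "nat \<Rightarrow> 'a::real_normed_vector set"
  assumes fin: "\<And>k. finite (F k)" and sub: "\<And>k. F k \<subseteq> cball 0 (\<rho> k)" and lim: "\<rho> \<longlonglongrightarrow> 0"
  shows "compact (insert 0 (\<Union>k. F k))"
proof (rule compactI)
  fix \<C> assume op: "\<forall>U\<in>\<C>. open U" and cover: "insert 0 (\<Union>k. F k) \<subseteq> \<Union>\<C>"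
  obtain U where U: "U \<in> \<C>" "0 \<in> U" using cover by auto
  then obtain e where e: "0 < e" "ball 0 e \<subseteq> U" using op open_contains_ball by blast
  from order_tendstoD(2)[OF lim e(1)] obtain N where N: "\<And>k. N \<le> k \<Longrightarrow> \<rho> k < e"
    by (auto simp: eventually_sequentially)
  have cpt: "compact (\<Union>k<N. F k)" using fin by (intro finite_imp_compact) auto
  have "(\<Union>k<N. F k) \<subseteq> \<Union>\<C>" using cover by blast
  then obtain \<D> where \<D>: "\<D> \<subseteq> \<C>" "finite \<D>" "(\<Union>k<N. F k) \<subseteq> \<Union>\<D>"
    by (rule compactE[OF cpt]) (use op in auto)
  have "F k \<subseteq> \<Union>(insert U \<D>)" for k
  proof (cases "k < N")
    case True
    then show ?thesis using \<D>(3) by blast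
  next
    case False
    then have "x \<in> ball 0 e" if "x \<in> F k" for x using subsetD[OF sub that] N[of k] by simp
    with e(2) show ?thesis by blast
  qed
  then show "\<exists>\<D>\<subseteq>\<C>. finite \<D> \<and> insert 0 (\<Union>k. F k) \<subseteq> \<Union>\<D>"
    using \<D> U by (intro exI[of _ "insert U \<D>"]) blast
qed

context banach_space_re
begin

definition reflexive :: bool where
  "reflexive \<longleftrightarrow> (\<forall>z :: ('a \<Rightarrow>\<^sub>L real) \<Rightarrow>\<^sub>L real. \<exists>x. \<forall>g. blinfun_apply z g = blinfun_apply g x)"

text \<open>On a reflexive space bounded bilinear forms on \<open>X \<times> X\<^sup>*\<close> are operators. The last hypothesis expresses
  linearity over \<open>'k\<close> by moving a scalar from one argument to the other.\<close>

lemma operator_of_form: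
  assumes refl: reflexive
    and bnd: "\<And>x g. B x g \<le> norm x * norm g"
    and right: "\<And>x. linear (B x)" and left: "\<And>g. linear (\<lambda>x. B x g)"
    and smul: "\<And>c x g. B (smul c x) g = B x (g o\<^sub>L Blinfun (smul c))"
  shows "\<exists>T\<in>equivariant. \<forall>x g. blinfun_apply g (blinfun_apply T x) = B x g"
proof -
  have "\<exists>y. \<forall>g. blinfun_apply g y = B x g" for x
  proof -
    obtain z :: "('a \<Rightarrow>\<^sub>L real) \<Rightarrow>\<^sub>L real" where "\<And>g. blinfun_apply z g = B x g"
      using linear_le_norm_blinfun[OF right bnd norm_ge_zero] by blast
    then show ?thesis using refl unfolding reflexive_def by metis
  qed
  then obtain F where F: "\<And>x g. blinfun_apply g (F x) = B x g" by metis
  have "bounded_linear F"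
  proof (rule bounded_linear_intro[where K = 1])
    show "F (x + y) = F x + F y" for x y
      by (rule functionals_separate) (simp add: F blinfun.add_right linear_add[OF left])
    show "F (r *\<^sub>R x) = r *\<^sub>R F x" for r x
      by (rule functionals_separate) (simp add: F blinfun.scaleR_right linear_scale[OF left])
    show "norm (F x) \<le> norm x * 1" for x
    proof -
      obtain \<phi> :: "'a \<Rightarrow>\<^sub>L real" where \<phi>: "norm \<phi> \<le> 1" "blinfun_apply \<phi> (F x) = norm (F x)"
        using norming_functional by blast
      have "norm (F x) \<le> norm x * norm \<phi>" using bnd[of x \<phi>] by (simp add: \<phi>(2) flip: F)
      also have "\<dots> \<le> norm x * 1" using \<phi>(1) by (intro mult_left_mono) auto
      finally show ?thesis .
    qed
  qed
  then have T: "blinfun_apply (Blinfun F) = F" by (rule bounded_linear_Blinfun_apply)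
  have "F (smul c x) = smul c (F x)" for c x
  proof (rule functionals_separate)
    fix g :: "'a \<Rightarrow>\<^sub>L real"
    have "blinfun_apply g (F (smul c x)) = blinfun_apply (g o\<^sub>L Blinfun (smul c)) (F x)"
      by (simp only: F smul)
    then show "blinfun_apply g (F (smul c x)) = blinfun_apply g (smul c (F x))"
      by (simp add: bounded_linear_Blinfun_apply[OF bounded_linear_smul])
  qed
  then show ?thesis by (intro bexI[of _ "Blinfun F"]) (simp_all add: T F equivariant_def)
qed

text \<open>A Banach limit of \<open>g (h n x)\<close> is a bounded bilinear form in \<open>x\<close> and \<open>g\<close>.\<close>

lemma states_cluster:
  assumes refl: reflexive
  shows "has_cluster_points states equivariant"
  unfolding has_cluster_points_def
proof (intro allI impI)
  fix h :: "nat \<Rightarrow> 'a \<Rightarrow>\<^sub>L 'a" assume h: "\<forall>n. h n \<in> equivariant \<and> norm (h n) \<le> 1"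
  obtain L where "banach_limit L" using banach_limit_exists ..
  note L = banach_limitD[OF this]
  have abs: "\<bar>blinfun_apply g (blinfun_apply (h n) x)\<bar> \<le> norm x * norm g" for n x and g :: "'a \<Rightarrow>\<^sub>L real"
  proof -
    have "norm x * norm g * norm (h n) \<le> norm x * norm g" using h by (intro mult_left_le) auto
    then show ?thesis using tensor_abs_le[of x g "h n"] by simp
  qed
  have bdd: "bounded (range (\<lambda>n. blinfun_apply g (blinfun_apply (h n) x)))" for x and g :: "'a \<Rightarrow>\<^sub>L real"
    using abs by (intro boundedI[of _ "norm x * norm g"]) auto
  have "\<exists>T\<in>equivariant. \<forall>x g. blinfun_apply g (blinfun_apply T x) = L (\<lambda>n. blinfun_apply g (blinfun_apply (h n) x))"
  proof (rule operator_of_form[OF refl])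
    show "L (\<lambda>n. blinfun_apply g (blinfun_apply (h n) x)) \<le> norm x * norm g" for x g
      using abs[where x = x and g = g] by (intro L(4)[OF bdd] always_eventually allI) (simp add: abs_le_iff)
    show "linear (\<lambda>g. L (\<lambda>n. blinfun_apply g (blinfun_apply (h n) x)))" for x
      by (intro linearI) (simp_all add: blinfun.add_left blinfun.scaleR_left L(1)[OF bdd bdd] L(2)[OF bdd])
    show "linear (\<lambda>x. L (\<lambda>n. blinfun_apply g (blinfun_apply (h n) x)))" for g
      by (intro linearI) (simp_all add: blinfun.add_right blinfun.scaleR_right L(1)[OF bdd bdd] L(2)[OF bdd])
    show "L (\<lambda>n. blinfun_apply g (blinfun_apply (h n) (smul c x)))
        = L (\<lambda>n. blinfun_apply (g o\<^sub>L Blinfun (smul c)) (blinfun_apply (h n) x))" for c x g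
      using h by (simp add: equivariant_def bounded_linear_Blinfun_apply[OF bounded_linear_smul])
  qed
  then obtain F where F: "F \<in> equivariant"
    "\<And>x g. blinfun_apply g (blinfun_apply F x) = L (\<lambda>n. blinfun_apply g (blinfun_apply (h n) x))" by blast
  show "\<exists>F\<in>equivariant. \<forall>\<gamma>\<in>states. \<forall>c.
      ((\<forall>\<^sub>F n in sequentially. c \<le> blinfun_apply \<gamma> (h n)) \<longrightarrow> c \<le> blinfun_apply \<gamma> F) \<and>
      ((\<forall>\<^sub>F n in sequentially. blinfun_apply \<gamma> (h n) \<le> c) \<longrightarrow> blinfun_apply \<gamma> F \<le> c)"
  proof (intro bexI[OF _ F(1)] ballI allI conjI impI)
    fix \<gamma> c assume "\<gamma> \<in> states"
    then obtain x g where \<gamma>: "\<gamma> = tensor x g" by (auto simp: states_def)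
    show "c \<le> blinfun_apply \<gamma> F" if "\<forall>\<^sub>F n in sequentially. c \<le> blinfun_apply \<gamma> (h n)"
      using that unfolding \<gamma> tensor_apply F(2) by (rule L(3)[OF bdd])
    show "blinfun_apply \<gamma> F \<le> c" if "\<forall>\<^sub>F n in sequentially. blinfun_apply \<gamma> (h n) \<le> c"
      using that unfolding \<gamma> tensor_apply F(2) by (rule L(4)[OF bdd])
  qed
qed

definition tensors :: "(('a \<Rightarrow>\<^sub>L 'a) \<Rightarrow>\<^sub>L real) set" where
  "tensors = Real_Vector_Spaces.span {tensor x g | x g. True}"

text \<open>Norm approximation by finite sums of tensors, for the restriction of \<open>\<Phi>\<close> to the operators
  that are linear over \<open>'k\<close>.\<close>

definition approximable :: "(('a \<Rightarrow>\<^sub>L 'a) \<Rightarrow>\<^sub>L real) \<Rightarrow> bool" where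
  "approximable \<Phi> \<longleftrightarrow> (\<forall>e>0. \<exists>u\<in>tensors. \<forall>T\<in>equivariant. \<bar>blinfun_apply \<Phi> T - blinfun_apply u T\<bar> \<le> e * norm T)"

text \<open>The norm bound on \<open>\<Phi>\<close> can be realised by the approximating sums: they can be taken in \<open>r\<close> times the
  convex hull of the tensors of norm at most 1. Otherwise \<open>\<Phi>\<close> is separated from that convex set by a linear
  \<open>\<beta>\<close>. By reflexivity \<open>(x, g) \<mapsto> \<beta> (tensor x g)\<close> comes from an operator \<open>T\<close>, and \<open>\<beta>\<close> agrees with the evaluation
  at \<open>T\<close> on sums of tensors, hence on their limit \<open>\<Phi>\<close>. Then \<open>\<Phi> T = \<beta> \<Phi>\<close> exceeds \<open>r * norm T\<close>, against the
  bound.\<close>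

lemma nuclear_approximation:
  assumes refl: reflexive and approx: "approximable \<Phi>" and r: "0 < r" and \<eta>: "0 < \<eta>"
    and bound: "\<And>T. T \<in> equivariant \<Longrightarrow> \<bar>blinfun_apply \<Phi> T\<bar> \<le> r * norm T"
  shows "\<exists>u\<in>convex hull tensor_ball. \<forall>T\<in>equivariant. \<bar>blinfun_apply \<Phi> T - r * blinfun_apply u T\<bar> \<le> \<eta> * norm T"
proof (rule ccontr)
  assume far: "\<not> ?thesis"
  define D where "D = {T \<in> equivariant. norm T \<le> 1}"
  have "0 \<in> D" using subspace_equivariant by (simp add: D_def real_vector.subspace_0)
  \<comment> \<open>The norm of the restriction to the operators linear over \<open>'k\<close>.\<close>
  define p where "p = (\<lambda>\<Psi> :: ('a \<Rightarrow>\<^sub>L 'a) \<Rightarrow>\<^sub>L real. SUP T\<in>D. blinfun_apply \<Psi> T)"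
  have le_norm: "blinfun_apply \<Psi> T \<le> norm \<Psi>" if "T \<in> D" for \<Psi> :: "('a \<Rightarrow>\<^sub>L 'a) \<Rightarrow>\<^sub>L real" and T
  proof -
    have "blinfun_apply \<Psi> T \<le> norm \<Psi> * norm T" using norm_blinfun[of \<Psi> T] by simp
    also have "\<dots> \<le> norm \<Psi>" using that by (intro mult_left_le) (auto simp: D_def)
    finally show ?thesis .
  qed
  have bdd: "bdd_above (blinfun_apply \<Psi> ` D)" for \<Psi> :: "('a \<Rightarrow>\<^sub>L 'a) \<Rightarrow>\<^sub>L real"
    using le_norm by (intro bdd_aboveI[of _ "norm \<Psi>"]) auto
  have p_ge: "blinfun_apply \<Psi> T \<le> p \<Psi>" if "T \<in> D" for \<Psi> T
    unfolding p_def by (rule cSUP_upper[OF that bdd])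
  have p_le: "p \<Psi> \<le> m" if "\<And>T. T \<in> D \<Longrightarrow> blinfun_apply \<Psi> T \<le> m" for \<Psi> m
    unfolding p_def using \<open>0 \<in> D\<close> that by (intro cSUP_least) auto
  have p: "sublinear p"
  proof (rule sublinearI)
    show "p (S + T) \<le> p S + p T" for S T
      using p_ge[of _ S] p_ge[of _ T] by (intro p_le) (auto simp: blinfun.add_left intro: add_mono)
    show "p (c *\<^sub>R T) \<le> c * p T" if "0 < c" for c T
      using p_ge[of _ T] that by (intro p_le) (auto simp: blinfun.scaleR_left)
    show "p 0 = 0" using p_le[of 0 0] p_ge[OF \<open>0 \<in> D\<close>, of 0] by simp
  qed
  have abs_le_p: "\<bar>blinfun_apply \<Psi> T\<bar> \<le> p \<Psi> * norm T" if T: "T \<in> equivariant" for \<Psi> T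
  proof (cases "T = 0")
    case False
    have "c *\<^sub>R T \<in> equivariant" for c using subspace_equivariant T by (rule real_vector.subspace_scale)
    then have "(1 / norm T) *\<^sub>R T \<in> D" "(- 1 / norm T) *\<^sub>R T \<in> D" using False by (simp_all only: D_def mem_Collect_eq) auto
    from p_ge[OF this(1), of \<Psi>] p_ge[OF this(2), of \<Psi>] False show ?thesis
      by (auto simp: blinfun.scaleR_right blinfun.minus_right abs_le_iff field_simps)
  qed simp
  have p_far: "\<eta> \<le> p (\<Phi> - r *\<^sub>R u)" if u: "u \<in> convex hull tensor_ball" for u
  proof (rule ccontr)
    assume "\<not> ?thesis"
    then have le: "p (\<Phi> - r *\<^sub>R u) * norm T \<le> \<eta> * norm T" for T :: "'a \<Rightarrow>\<^sub>L 'a"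
      by (intro mult_right_mono) auto
    have "\<bar>blinfun_apply \<Phi> T - r * blinfun_apply u T\<bar> \<le> \<eta> * norm T" if "T \<in> equivariant" for T
      using order_trans[OF abs_le_p[OF that, of "\<Phi> - r *\<^sub>R u"] le] by (simp add: blinfun.diff_left blinfun.scaleR_left)
    with far u show False by blast
  qed
  define C where "C = convex hull (tensor_ball :: (('a \<Rightarrow>\<^sub>L 'a) \<Rightarrow>\<^sub>L real) set)"
  have C: "convex C" unfolding C_def by (rule convex_convex_hull)
  have tensor_C: "tensor x g \<in> C" if "norm x \<le> 1" "norm g \<le> 1" for x :: 'a and g
    unfolding C_def using that by (intro hull_inc) (auto simp: tensor_ball_def)
  then have C0: "0 \<in> C" using tensor_C[of 0 0] by (simp add: tensor_bilinear)
  define R where "R = {(t *\<^sub>R (r *\<^sub>R u - \<Phi>), - (t * \<eta>)) | t u. 0 \<le> t \<and> u \<in> C}"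
  have R_I: "(t *\<^sub>R (r *\<^sub>R u - \<Phi>), - (t * \<eta>)) \<in> R" if "0 \<le> t" "u \<in> C" for t u using that by (auto simp: R_def)
  have cone: "constraint_cone R"
    unfolding constraint_cone_def
  proof (intro conjI allI impI)
    show "(0, 0) \<in> R" using R_I[OF _ C0, of 0] by simp
    show "(s + s', c + c') \<in> R" if sc: "(s, c) \<in> R" "(s', c') \<in> R" for s c s' c'
    proof -
      from sc obtain t u t' u' where K: "0 \<le> t" "u \<in> C" "0 \<le> t'" "u' \<in> C" "s = t *\<^sub>R (r *\<^sub>R u - \<Phi>)" "c = - (t * \<eta>)"
        "s' = t' *\<^sub>R (r *\<^sub>R u' - \<Phi>)" "c' = - (t' * \<eta>)" by (auto simp: R_def)
      show ?thesis
      proof (cases "t + t' = 0")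
        case True
        then have "t = 0" "t' = 0" using K(1,3) by auto
        then show ?thesis using R_I[OF _ C0, of 0] unfolding K(5-8) by simp
      next
        case False
        define w where "w = (t / (t + t')) *\<^sub>R u + (t' / (t + t')) *\<^sub>R u'"
        have "w \<in> C"
          unfolding w_def using K(1-4) False
          by (intro convexD[OF C]) (simp_all add: add_divide_distrib[symmetric])
        moreover have "(t + t') *\<^sub>R w = t *\<^sub>R u + t' *\<^sub>R u'"
          using False by (simp add: w_def scaleR_add_right)
        moreover have "(t + t') *\<^sub>R (r *\<^sub>R w - \<Phi>) = r *\<^sub>R ((t + t') *\<^sub>R w) - (t + t') *\<^sub>R \<Phi>"
          by (simp add: scaleR_diff_right mult.commute)
        ultimately have "w \<in> C" "(t + t') *\<^sub>R (r *\<^sub>R w - \<Phi>) = s + s'"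
          unfolding K(5,7) by (simp_all add: algebra_simps)
        then show ?thesis using R_I[of "t + t'" w] K(1,3) unfolding K(6,8) by (simp add: algebra_simps)
      qed
    qed
    show "(a *\<^sub>R s, a * c) \<in> R" if a: "0 < a" "(s, c) \<in> R" for a s c
    proof -
      from a obtain t u where K: "0 \<le> t" "u \<in> C" "s = t *\<^sub>R (r *\<^sub>R u - \<Phi>)" "c = - (t * \<eta>)" by (auto simp: R_def)
      show ?thesis using R_I[of "a * t" u] K(1,2) a(1) unfolding K(3,4) by (simp add: mult.assoc)
    qed
  qed
  have "\<forall>(s, c)\<in>R. - p (- s) \<le> c"
  proof clarify
    fix s c assume "(s, c) \<in> R"
    then obtain t u where K: "0 \<le> t" "u \<in> C" "s = t *\<^sub>R (r *\<^sub>R u - \<Phi>)" "c = - (t * \<eta>)" by (auto simp: R_def)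
    have "t * \<eta> \<le> t * p (\<Phi> - r *\<^sub>R u)" using K(1) p_far[OF K(2)[unfolded C_def]] by (intro mult_left_mono)
    also have "\<dots> = p (t *\<^sub>R (\<Phi> - r *\<^sub>R u))" using K(1) by (simp add: sublinear_scale[OF p])
    also have "t *\<^sub>R (\<Phi> - r *\<^sub>R u) = - s" by (simp add: K(3) algebra_simps)
    finally show "- p (- s) \<le> c" using K(4) by simp
  qed
  from mazur_orlicz[OF p cone this]
  obtain \<beta> where \<beta>: "linear \<beta>" "\<forall>\<Psi>. \<beta> \<Psi> \<le> p \<Psi>" "\<forall>(s, c)\<in>R. \<beta> s \<le> c"
    by (elim exE conjE)
  have \<beta>_abs: "\<bar>\<beta> \<Psi>\<bar> \<le> m" if "\<And>T. T \<in> D \<Longrightarrow> \<bar>blinfun_apply \<Psi> T\<bar> \<le> m" for \<Psi> m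
  proof -
    have "p \<Psi> \<le> m" "p (- \<Psi>) \<le> m" using that by (auto intro!: p_le simp: blinfun.minus_left abs_le_iff)
    then show ?thesis
      using \<beta>(2)[rule_format, of \<Psi>] \<beta>(2)[rule_format, of "- \<Psi>"] linear_neg[OF \<beta>(1), of \<Psi>] by (simp add: abs_le_iff)
  qed
  have \<beta>_sep: "r * \<beta> u + \<eta> \<le> \<beta> \<Phi>" if "u \<in> C" for u
  proof -
    have "\<beta> (1 *\<^sub>R (r *\<^sub>R u - \<Phi>)) \<le> - (1 * \<eta>)" using \<beta>(3) R_I[OF _ that, of 1] by fastforce
    then show ?thesis by (simp add: linear_diff[OF \<beta>(1)] linear_scale[OF \<beta>(1)])
  qed
  have "\<exists>T\<in>equivariant. \<forall>x g. blinfun_apply g (blinfun_apply T x) = \<beta> (tensor x g)"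
  proof (rule operator_of_form[OF refl])
    show "\<beta> (tensor x g) \<le> norm x * norm g" for x g
      using \<beta>(2)[rule_format, of "tensor x g"] p_le[OF le_norm, of "tensor x g"] norm_tensor_le[of x g] by linarith
    show "linear (\<lambda>g. \<beta> (tensor x g))" "linear (\<lambda>x. \<beta> (tensor x g))" for x g
      by (intro linearI; simp add: tensor_bilinear linear_add[OF \<beta>(1)] linear_scale[OF \<beta>(1)])+
    show "\<beta> (tensor (smul c x) g) = \<beta> (tensor x (g o\<^sub>L Blinfun (smul c)))" for c x g
    proof -
      have "\<bar>\<beta> (tensor (smul c x) g - tensor x (g o\<^sub>L Blinfun (smul c)))\<bar> \<le> 0"
        by (rule \<beta>_abs) (simp add: D_def equivariant_def blinfun.diff_left bounded_linear_Blinfun_apply[OF bounded_linear_smul])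
      then show ?thesis by (simp add: linear_diff[OF \<beta>(1)])
    qed
  qed
  then obtain T where T: "T \<in> equivariant" "\<And>x g. blinfun_apply g (blinfun_apply T x) = \<beta> (tensor x g)" by blast
  have \<beta>_tensors: "\<beta> u = blinfun_apply u T" if "u \<in> tensors" for u
    using that unfolding tensors_def
  proof (induction rule: real_vector.span_induct_alt)
    case base
    then show ?case by (simp add: linear_0[OF \<beta>(1)])
  next
    case (step c x y)
    then show ?case by (auto simp: T(2) linear_add[OF \<beta>(1)] linear_scale[OF \<beta>(1)] blinfun.add_left blinfun.scaleR_left)
  qed
  have "\<bar>\<beta> \<Phi> - blinfun_apply \<Phi> T\<bar> \<le> e" if e: "0 < e" for e
  proof -
    define e' where "e' = e / (1 + norm T)"
    have "0 < 1 + norm T" by (simp add: add_pos_nonneg)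
    then have "0 < e'" "e' * (1 + norm T) = e" using e by (simp_all add: e'_def)
    then have e': "0 < e'" "e' + e' * norm T = e" by (simp_all add: algebra_simps)
    then obtain u where u: "u \<in> tensors" "\<And>T. T \<in> equivariant \<Longrightarrow> \<bar>blinfun_apply \<Phi> T - blinfun_apply u T\<bar> \<le> e' * norm T"
      using approx unfolding approximable_def by blast
    have "\<bar>\<beta> (\<Phi> - u)\<bar> \<le> e'"
    proof (rule \<beta>_abs)
      fix S assume S: "S \<in> D"
      then have "e' * norm S \<le> e'" using e'(1) by (intro mult_left_le) (auto simp: D_def)
      then show "\<bar>blinfun_apply (\<Phi> - u) S\<bar> \<le> e'"
        using u(2)[of S] S by (simp add: D_def blinfun.diff_left)
    qed
    then show ?thesis
      using u(2)[OF T(1)] e'(2) \<beta>_tensors[OF u(1)] by (simp add: linear_diff[OF \<beta>(1)] abs_le_iff)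
  qed
  then have "\<bar>\<beta> \<Phi> - blinfun_apply \<Phi> T\<bar> \<le> 0" by (rule field_le_epsilon) simp
  then have \<beta>\<Phi>: "\<beta> \<Phi> = blinfun_apply \<Phi> T" by simp
  define m where "m = (\<beta> \<Phi> - \<eta>) / r"
  have m: "\<beta> u \<le> m" if "u \<in> C" for u
    using \<beta>_sep[OF that] r by (simp add: m_def field_simps)
  have "norm T \<le> m"
  proof (rule norm_blinfun_bound)
    show m0: "0 \<le> m" using m[OF C0] by (simp add: linear_0[OF \<beta>(1)])
    fix x
    show "norm (blinfun_apply T x) \<le> m * norm x"
    proof (cases "x = 0")
      case False
      obtain \<phi> :: "'a \<Rightarrow>\<^sub>L real" where \<phi>: "norm \<phi> \<le> 1" "blinfun_apply \<phi> (blinfun_apply T x) = norm (blinfun_apply T x)"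
        using norming_functional by blast
      have "\<beta> (tensor ((1 / norm x) *\<^sub>R x) \<phi>) \<le> m" using False \<phi>(1) by (intro m tensor_C) auto
      then show ?thesis
        using False by (simp add: tensor_bilinear linear_scale[OF \<beta>(1)] \<phi>(2) field_simps flip: T(2))
    qed simp
  qed
  then have "r * norm T \<le> \<beta> \<Phi> - \<eta>" using r by (simp add: m_def field_simps)
  with bound[OF T(1)] \<eta> show False unfolding \<beta>\<Phi> by (simp add: abs_le_iff)
qed

text \<open>Apply the previous lemma to the remainders, halving the bound at each step.\<close>

lemma nuclear_expansion:
  assumes refl: reflexive and approx: "approximable \<Phi>"
    and bound: "\<And>T. T \<in> equivariant \<Longrightarrow> \<bar>blinfun_apply \<Phi> T\<bar> \<le> norm T"
  obtains u where "\<And>k. u k \<in> convex hull tensor_ball"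
    "\<And>n T. T \<in> equivariant \<Longrightarrow> \<bar>blinfun_apply \<Phi> T - (\<Sum>k<n. (1 / 2) ^ k * blinfun_apply (u k) T)\<bar> \<le> (1 / 2) ^ n * norm T"
proof -
  define P where "P = (\<lambda>(n::nat) \<Psi>. approximable \<Psi> \<and> (\<forall>T\<in>equivariant. \<bar>blinfun_apply \<Psi> T\<bar> \<le> (1 / 2) ^ n * norm T) \<and> (n = 0 \<longrightarrow> \<Psi> = \<Phi>))"
  define Q where "Q = (\<lambda>(n::nat) (\<Psi> :: ('a \<Rightarrow>\<^sub>L 'a) \<Rightarrow>\<^sub>L real) \<Psi>'. \<exists>u\<in>convex hull tensor_ball. \<Psi>' = \<Psi> - (1 / 2) ^ n *\<^sub>R u)"
  have hull_tensors: "u \<in> tensors" if "u \<in> convex hull tensor_ball" for u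
  proof -
    have "convex hull tensor_ball \<subseteq> tensors"
      unfolding tensors_def tensor_ball_def
      by (intro hull_minimal real_vector.span_superset[THEN subset_trans[rotated]] subspace_imp_convex real_vector.subspace_span) auto
    with that show ?thesis by blast
  qed
  have start: "P 0 \<Phi>" using approx bound by (simp add: P_def)
  have step: "\<exists>\<Psi>'. P (Suc n) \<Psi>' \<and> Q n \<Psi> \<Psi>'" if "P n \<Psi>" for n \<Psi>
  proof -
    have \<Psi>: "approximable \<Psi>" "\<And>T. T \<in> equivariant \<Longrightarrow> \<bar>blinfun_apply \<Psi> T\<bar> \<le> (1 / 2) ^ n * norm T"
      using that by (auto simp: P_def)
    have "\<exists>u\<in>convex hull tensor_ball. \<forall>T\<in>equivariant. \<bar>blinfun_apply \<Psi> T - (1 / 2) ^ n * blinfun_apply u T\<bar> \<le> (1 / 2) ^ Suc n * norm T"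
      by (rule nuclear_approximation[OF refl \<Psi>(1) _ _ \<Psi>(2)]) auto
    then obtain u where u: "u \<in> convex hull tensor_ball"
      "\<forall>T\<in>equivariant. \<bar>blinfun_apply \<Psi> T - (1 / 2) ^ n * blinfun_apply u T\<bar> \<le> (1 / 2) ^ Suc n * norm T" by (elim bexE)
    define \<Psi>' where "\<Psi>' = \<Psi> - (1 / 2) ^ n *\<^sub>R u"
    have "approximable \<Psi>'"
      unfolding approximable_def
    proof (intro allI impI)
      fix e :: real assume "0 < e"
      then obtain v where v: "v \<in> tensors" "\<forall>T\<in>equivariant. \<bar>blinfun_apply \<Psi> T - blinfun_apply v T\<bar> \<le> e * norm T"
        using \<Psi>(1) unfolding approximable_def by blast
      have "v - (1 / 2) ^ n *\<^sub>R u \<in> tensors"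
        using v(1) hull_tensors[OF u(1)] unfolding tensors_def
        by (intro real_vector.span_diff real_vector.span_scale)
      then show "\<exists>w\<in>tensors. \<forall>T\<in>equivariant. \<bar>blinfun_apply \<Psi>' T - blinfun_apply w T\<bar> \<le> e * norm T"
        using v(2) by (intro bexI[of _ "v - (1 / 2) ^ n *\<^sub>R u"]) (auto simp: \<Psi>'_def blinfun.diff_left)
    qed
    moreover have "\<bar>blinfun_apply \<Psi>' T\<bar> \<le> (1 / 2) ^ Suc n * norm T" if "T \<in> equivariant" for T
      using u(2) that unfolding \<Psi>'_def blinfun.diff_left blinfun.scaleR_left by simp
    ultimately have "P (Suc n) \<Psi>'" by (simp add: P_def)
    moreover have "Q n \<Psi> \<Psi>'" using u(1) by (auto simp: Q_def \<Psi>'_def)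
    ultimately show ?thesis by blast
  qed
  obtain \<Psi> where \<Psi>: "\<forall>n. P n (\<Psi> n)" "\<forall>n. Q n (\<Psi> n) (\<Psi> (Suc n))"
    using dependent_nat_choice[of P Q, OF _ step] start by blast
  then obtain u where u: "\<And>k. u k \<in> convex hull tensor_ball" "\<And>k. \<Psi> (Suc k) = \<Psi> k - (1 / 2) ^ k *\<^sub>R u k"
    unfolding Q_def by metis
  have "\<Psi> 0 = \<Phi>" using \<Psi>(1) by (auto simp: P_def)
  have "blinfun_apply (\<Psi> n) T = blinfun_apply \<Phi> T - (\<Sum>k<n. (1 / 2) ^ k * blinfun_apply (u k) T)" for n T
    by (induction n) (simp_all add: \<open>\<Psi> 0 = \<Phi>\<close> u(2) blinfun.diff_left blinfun.scaleR_left)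
  moreover have "\<bar>blinfun_apply (\<Psi> n) T\<bar> \<le> (1 / 2) ^ n * norm T" if "T \<in> equivariant" for n T
    using \<Psi>(1) that unfolding P_def by blast
  ultimately have "\<bar>blinfun_apply \<Phi> T - (\<Sum>k<n. (1 / 2) ^ k * blinfun_apply (u k) T)\<bar> \<le> (1 / 2) ^ n * norm T"
    if "T \<in> equivariant" for n T using that by metis
  then show ?thesis by (rule that[OF u(1)])
qed

text \<open>The finite sets supporting the terms of the expansion are shrunk by the factors \<open>(3 / 4) ^ k\<close>, so
  that together they form a null sequence and their union with 0 is compact. The \<open>k\<close>-th term has
  weight \<open>(1 / 2) ^ k\<close>; undoing the shrinking leaves \<open>(1 / 2) ^ k * (4 / 3) ^ k = (2 / 3) ^ k\<close>, whose sum is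
  3. An approximation error \<open>1 / 6\<close> on the compact set therefore changes \<open>\<Phi> I\<close> by at most \<open>1 / 2\<close>, although
  the norm of the compact operator is not under control.\<close>

lemma functional_determined_by_compacts:
  assumes refl: reflexive and approx: "approximable \<Phi>" and bound: "norm \<Phi> \<le> 1"
    and CAP: "compact_approximation_property smul"
    and vanish: "\<And>T. T \<in> compacts \<Longrightarrow> blinfun_apply \<Phi> T = 0"
  shows "blinfun_apply \<Phi> id_blinfun < 1"
proof (rule ccontr)
  assume one: "\<not> ?thesis"
  have abs: "\<bar>blinfun_apply \<Phi> T\<bar> \<le> norm T" for T using blinfun_real_abs_le[OF bound] .
  obtain u where u: "\<And>k. u k \<in> convex hull tensor_ball"
    "\<And>n T. T \<in> equivariant \<Longrightarrow> \<bar>blinfun_apply \<Phi> T - (\<Sum>k<n. (1 / 2) ^ k * blinfun_apply (u k) T)\<bar> \<le> (1 / 2) ^ n * norm T"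
    using nuclear_expansion[OF refl approx abs] by blast
  have "\<forall>k. \<exists>F. finite F \<and> F \<subseteq> cball 0 1 \<and>
      (\<forall>T d. (\<forall>x\<in>F. norm (blinfun_apply T x) \<le> d) \<longrightarrow> 0 \<le> d \<longrightarrow> \<bar>blinfun_apply (u k) T\<bar> \<le> d)"
    using tensor_ball_hull_support[OF u(1)] by blast
  then obtain F where F: "\<forall>k. finite (F k) \<and> F k \<subseteq> cball 0 1 \<and>
      (\<forall>T d. (\<forall>x\<in>F k. norm (blinfun_apply T x) \<le> d) \<longrightarrow> 0 \<le> d \<longrightarrow> \<bar>blinfun_apply (u k) T\<bar> \<le> d)"
    by (rule choice[THEN exE])
  have control: "\<bar>blinfun_apply (u k) T\<bar> \<le> d" if "\<And>x. x \<in> F k \<Longrightarrow> norm (blinfun_apply T x) \<le> d" "0 \<le> d" for k T d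
    using F that by blast
  define G where "G = (\<lambda>k. (*\<^sub>R) ((3 / 4) ^ k) ` F k)"
  have "compact (insert 0 (\<Union>k. G k))"
  proof (rule compact_null_sequence_of_finite_sets[where \<rho> = "\<lambda>k. (3 / 4) ^ k"])
    show "finite (G k)" for k using F by (simp add: G_def)
    show "G k \<subseteq> cball 0 ((3 / 4) ^ k)" for k
    proof -
      have "F k \<subseteq> cball 0 1" using F by blast
      then have "norm x \<le> 1" if "x \<in> F k" for x using that by auto
      then show ?thesis by (auto simp: G_def mult_left_le)
    qed
    show "(\<lambda>k. (3 / 4) ^ k) \<longlonglongrightarrow> (0::real)" by (intro LIMSEQ_power_zero) auto
  qed
  then obtain K where K: "K \<in> compact_operators smul" "\<forall>y\<in>insert 0 (\<Union>k. G k). norm (K y - y) \<le> 1 / 6"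
    using CAP unfolding compact_approximation_property_def by (metis zero_less_divide_1_iff zero_less_numeral)
  have K_eq: "Blinfun K \<in> equivariant" and K_apply: "blinfun_apply (Blinfun K) = K"
    using bounded_operator_equivariant[of K] K(1) by (auto simp: compact_operators_def)
  then have K_cpt: "Blinfun K \<in> compacts" using K(1) by (simp add: compacts_def compact_operators_def)
  define S where "S = id_blinfun - Blinfun K"
  have S_eq: "S \<in> equivariant"
    using K_eq by (simp add: S_def equivariant_def blinfun.diff_left scale_right_diff_distrib)
  have "1 \<le> blinfun_apply \<Phi> S" using one vanish[OF K_cpt] by (simp add: S_def blinfun.diff_right)
  have uS: "\<bar>blinfun_apply (u k) S\<bar> \<le> (4 / 3) ^ k / 6" for k
  proof -
    have "norm (blinfun_apply S x) \<le> (4 / 3) ^ k / 6" if x: "x \<in> F k" for x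
    proof -
      have "(3 / 4) ^ k *\<^sub>R x \<in> (\<Union>k. G k)" using x by (auto simp: G_def)
      then have "norm (K ((3 / 4) ^ k *\<^sub>R x) - (3 / 4) ^ k *\<^sub>R x) \<le> 1 / 6" using K(2) by blast
      also have "K ((3 / 4) ^ k *\<^sub>R x) - (3 / 4) ^ k *\<^sub>R x = (3 / 4) ^ k *\<^sub>R (- blinfun_apply S x)"
        using blinfun.scaleR_right[of "Blinfun K" "(3 / 4) ^ k" x]
        by (simp add: S_def blinfun.diff_left K_apply scaleR_diff_right)
      finally have "(3 / 4) ^ k * norm (blinfun_apply S x) \<le> 1 / 6" by simp
      then have "(4 / 3) ^ k * ((3 / 4) ^ k * norm (blinfun_apply S x)) \<le> (4 / 3) ^ k * (1 / 6)"
        by (intro mult_left_mono) auto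
      then show ?thesis by (simp flip: mult.assoc power_mult_distrib)
    qed
    then show ?thesis by (rule control) auto
  qed
  have geo: "(\<Sum>k<n. (1 / 2) ^ k * ((4 / 3) ^ k / 6)) \<le> (1 / 2 :: real)" for n :: nat
  proof -
    have "(\<Sum>k<n. (1 / 2) ^ k * ((4 / 3) ^ k / 6)) = (1 - (2 / 3) ^ n) / (2 :: real)"
    proof (induction n)
      case (Suc n)
      have "(1 / 2) ^ n * (4 / 3) ^ n = ((2 / 3) ^ n :: real)" by (simp flip: power_mult_distrib)
      then show ?case using Suc by (simp add: field_simps)
    qed simp
    then show ?thesis by simp
  qed
  have "1 / 2 \<le> (1 / 2) ^ n * norm S" for n :: nat
  proof -
    have "\<bar>\<Sum>k<n. (1 / 2) ^ k * blinfun_apply (u k) S\<bar> \<le> (\<Sum>k<n. \<bar>(1 / 2) ^ k * blinfun_apply (u k) S\<bar>)"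
      by (rule sum_abs)
    also have "\<dots> \<le> (\<Sum>k<n. (1 / 2) ^ k * ((4 / 3) ^ k / 6))"
      using uS by (intro sum_mono) (simp add: abs_mult mult_left_mono)
    also have "\<dots> \<le> 1 / 2" by (rule geo)
    finally show ?thesis using u(2)[OF S_eq, of n] \<open>1 \<le> blinfun_apply \<Phi> S\<close> by linarith
  qed
  moreover have "(\<lambda>n. (1 / 2) ^ n * norm S) \<longlonglongrightarrow> 0"
    by (intro tendsto_mult_left_zero LIMSEQ_power_zero) auto
  ultimately have "1 / 2 \<le> (0::real)"
    by (intro tendsto_lowerbound[where F = sequentially]) auto
  then show False by simp
qed

theorem finite_dimensional_if_NRA:
  assumes CAP: "compact_approximation_property smul" and NRA: "bounded_operators smul = NRA smul"
  shows "finite_dimensional smul"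
proof (rule ccontr)
  assume inf: "\<not> finite_dimensional smul"
  have "\<exists>y0 :: 'a. norm y0 = 1"
  proof (rule ccontr)
    assume none: "\<not> ?thesis"
    have "x = 0" for x :: 'a
    proof (rule ccontr)
      assume "x \<noteq> 0"
      then have "norm ((1 / norm x) *\<^sub>R x) = 1" by simp
      with none show False by blast
    qed
    then have "cball 0 1 = {0 :: 'a}" by auto
    then have "compact (cball 0 1 :: 'a set)" by simp
    with finite_dimensional_if_compact_ball inf show False by blast
  qed
  then obtain y0 :: 'a where y0: "norm y0 = 1" ..
  have refl: reflexive
    unfolding reflexive_def
  proof
    fix z :: "('a \<Rightarrow>\<^sub>L real) \<Rightarrow>\<^sub>L real"
    show "\<exists>x. \<forall>g. blinfun_apply z g = blinfun_apply g x"
      by (rule reflexive_if_NRA[OF NRA y0, of z]) blast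
  qed
  obtain \<Phi> where \<Phi>: "1 \<le> blinfun_apply \<Phi> id_blinfun" "\<And>T. T \<in> compacts \<Longrightarrow> blinfun_apply \<Phi> T = 0"
    "\<And>T. T \<in> equivariant \<Longrightarrow> \<exists>\<gamma>\<in>states. blinfun_apply \<Phi> T \<le> blinfun_apply \<gamma> T" "norm \<Phi> \<le> 1"
    using functional_vanishing_on_compacts[OF NRA inf y0] by blast
  have "approximable \<Phi>"
    unfolding approximable_def
  proof (intro allI impI)
    fix e :: real assume "0 < e"
    have "\<exists>u\<in>Real_Vector_Spaces.span states. \<forall>T\<in>equivariant. \<bar>blinfun_apply \<Phi> T - blinfun_apply u T\<bar> \<le> e * norm T"
      by (rule james_approximation[OF states_ball subspace_equivariant closed_equivariant states_cluster[OF refl]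
            states_attain[OF NRA] \<Phi>(3) \<open>0 < e\<close>])
    moreover have "Real_Vector_Spaces.span states \<subseteq> tensors"
      unfolding tensors_def by (intro real_vector.span_mono) (auto simp: states_def)
    ultimately show "\<exists>u\<in>tensors. \<forall>T\<in>equivariant. \<bar>blinfun_apply \<Phi> T - blinfun_apply u T\<bar> \<le> e * norm T" by blast
  qed
  then show False using functional_determined_by_compacts[OF refl _ \<Phi>(4) CAP \<Phi>(2)] \<Phi>(1) by simp
qed

end

section \<open>Real and complex scalars\<close>

lemma banach_space_re_real: "banach_space_re (scaleR :: real \<Rightarrow> 'a::banach \<Rightarrow> 'a) (\<lambda>r. r)"
proof -
  interpret banach_space_over "scaleR :: real \<Rightarrow> 'a \<Rightarrow> 'a" by (rule banach_space_over_scaleR)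
  show ?thesis
  proof (intro banach_space_re.intro banach_space_re_axioms.intro)
    show "banach_space_over (scaleR :: real \<Rightarrow> 'a \<Rightarrow> 'a)" by (rule banach_space_over_scaleR)
    show "linear (\<lambda>r :: real. r)" by (rule linear_id[unfolded id_def])
    show "\<exists>l. norm l = 1 \<and> l * c = norm c" for c :: real
      by (cases "0 \<le> c") (auto intro: exI[of _ 1] exI[of _ "- 1"])
    fix g :: "'a \<Rightarrow> real" assume "bounded_linear g"
    moreover have "Vector_Spaces.linear scaleR (*) g"
      using bounded_linear.linear[OF calculation] unfolding linear_def by (simp add: real_scaleR_def[abs_def])
    ultimately show "\<exists>f\<in>dual_space scaleR. \<forall>x. f x = g x"
      by (intro bexI[of _ g]) (auto simp: dual_space_def bounded_maps_def)
  qed auto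
qed

lemma banach_space_re_complex:
  fixes smul :: "complex \<Rightarrow> 'a::banach \<Rightarrow> 'a"
  assumes "banach_space_over smul"
  shows "banach_space_re smul Re"
proof -
  interpret banach_space_over smul by fact
  show ?thesis
  proof (intro banach_space_re.intro banach_space_re_axioms.intro)
    show "banach_space_over smul" by fact
    show "linear Re" by (rule bounded_linear.linear[OF bounded_linear_Re])
    show "Re c \<le> norm c" for c by (rule complex_Re_le_cmod)
    show "c = 1" if "norm c \<le> 1" "Re c = 1" for c
    proof -
      have "(Re c)\<^sup>2 + (Im c)\<^sup>2 \<le> 1" using that(1) by (simp add: cmod_def)
      then show ?thesis using that(2) by (simp add: complex_eq_iff)
    qed
    show "\<exists>l. norm l = 1 \<and> Re (l * c) = norm c" for c
    proof (cases "c = 0")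
      case False
      have "cnj c * c = complex_of_real (norm c) * complex_of_real (norm c)"
        using complex_norm_square[of c] by (simp add: power2_eq_square mult.commute)
      then have "cnj c / norm c * c = complex_of_real (norm c)"
        using False by (simp add: divide_eq_eq)
      then show ?thesis using False by (intro exI[of _ "cnj c / norm c"]) (simp add: norm_divide)
    qed (auto intro: exI[of _ 1])
    fix g :: "'a \<Rightarrow> real" assume g: "bounded_linear g"
    note lin = linear_add[OF bounded_linear.linear[OF g]] linear_scale[OF bounded_linear.linear[OF g]]
    \<comment> \<open>The unique complex linear functional with real part \<open>g\<close>.\<close>
    define f where "f = (\<lambda>x. Complex (g x) (- g (smul \<i> x)))"
    have add: "f (x + y) = f x + f y" for x y
      by (simp add: f_def lin scale_right_distrib complex_eq_iff)
    have scaleR: "smul \<i> (r *\<^sub>R x) = r *\<^sub>R smul \<i> x" for r x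
      using scale_left_commute[of \<i> "of_real r" x] by (simp only: smul_of_real)
    have split: "smul c x = Re c *\<^sub>R x + Im c *\<^sub>R smul \<i> x" for c x
    proof -
      have "c = of_real (Re c) + of_real (Im c) * \<i>" by (simp add: complex_eq_iff)
      then have "smul c x = smul (of_real (Re c) + of_real (Im c) * \<i>) x" by (rule arg_cong)
      then show ?thesis by (simp only: scale_left_distrib scale_scale[symmetric] smul_of_real)
    qed
    have ii: "smul \<i> (smul \<i> x) = - x" for x
      by simp
    have scale: "f (smul c x) = c * f x" for c x
      by (simp add: f_def split[of c] lin scale_right_distrib scaleR ii complex_eq_iff
          linear_neg[OF bounded_linear.linear[OF g]] linear_diff[OF bounded_linear.linear[OF g]] del: scale_scale)
    obtain M where M: "\<And>x. norm (g x) \<le> norm x * M" using bounded_linear.bounded[OF g] by blast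
    have "bounded_linear f"
    proof (rule bounded_linear_intro[where K = "2 * M"])
      show "f (r *\<^sub>R x) = r *\<^sub>R f x" for r x
        using scale[of "of_real r" x] by (simp add: smul_of_real scaleR_conv_of_real)
      show "norm (f x) \<le> norm x * (2 * M)" for x
        using cmod_le[of "f x"] M[of x] M[of "smul \<i> x"] by (simp add: f_def norm_smul)
    qed (rule add)
    moreover have "Vector_Spaces.linear smul (*) f"
      using vector_space_axioms banach_space_over.axioms(1)[OF banach_space_over_complex] add scale
      by (auto simp: Vector_Spaces.linear_iff)
    ultimately show "\<exists>f\<in>dual_space smul. \<forall>x. Re (f x) = g x"
      by (intro bexI[of _ f]) (auto simp: dual_space_def bounded_maps_def f_def)
  qed
qed

theorem theorem2p5:
  shows "(compact_approximation_property (scaleR :: real \<Rightarrow> 'a::banach \<Rightarrow> 'a) \<and>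
          bounded_operators (scaleR :: real \<Rightarrow> 'a \<Rightarrow> 'a) = NRA (scaleR :: real \<Rightarrow> 'a \<Rightarrow> 'a) \<longrightarrow>
          finite_dimensional (scaleR :: real \<Rightarrow> 'a \<Rightarrow> 'a)) \<and>
         (\<forall>smul :: complex \<Rightarrow> 'a \<Rightarrow> 'a.
          banach_space_over smul \<and> compact_approximation_property smul \<and>
          bounded_operators smul = NRA smul \<longrightarrow>
          finite_dimensional smul)"
  using banach_space_re.finite_dimensional_if_NRA[OF banach_space_re_real]
    banach_space_re.finite_dimensional_if_NRA[OF banach_space_re_complex] by blast

end
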